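(* Let $b$ be a real constant with $|b|<1$, let $q\in\{1,2,3,4\}$, and let $T>0$, $K>0$, and $c_{CFL}>0$ be any constants. There is a constant $C$, independent of $\varepsilon$, $N$ and $\Delta t$, such that the following holds for every $\varepsilon>0$, every integer $N\ge1$ and every $\Delta t>0$ with $\Delta t\le\min\{c_{CFL}/N^2,1\}$. Let $(u,w)$ be the solution, $2\pi$-periodic in $x$, for $t\ge0$, of $$\partial_tu+\partial_x(bu+w)=0,\qquad \partial_tw+\partial_x\big((1-b^2)u-bw\big)=-\frac1\varepsilon w,$$ and suppose that one of the following two cases holds for the initial data and the starting time $T_0\ge0$ of the scheme: Case 1: $\|\partial_t^{q+1}u(0)\|_{H^1}+\|\partial_t^{q+1}w(0)\|_{H^1}\le K$ and $\|\partial_t^{q}u(0)\|_{H^2}+\|\partial_t^{q}w(0)\|_{H^2}\le K$, and $T_0\ge 0$ is arbitrary; Case 2: $\|u(0)\|_{H^{q+2}}^2+\|w(0)\|_{H^{q+2}}^2\le K$, and $T_0\ge (q+2)\,\varepsilon\log(1/\varepsilon)$. Let $t_n=T_0+n\Delta t$ and let $(U_N^n,W_N^n)_{n\ge0}$ be generated by the $q$-th order IMEX-BDF scheme $$\begin{aligned}&\sum_{i=0}^q\alpha_iU_N^{n+i}+\Delta t\sum_{i=0}^{q-1}\gamma_i\,\partial_x\big(bU_N^{n+i}+W_N^{n+i}\big)=0,\\ &\sum_{i=0}^q\alpha_iW_N^{n+i}+\Delta t\sum_{i=0}^{q-1}\gamma_i\,\partial_x\big((1-b^2)U_N^{n+i}-bW_N^{n+i}\big)=-\frac{\beta\Delta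 t}{\varepsilon}W_N^{n+q},\qquad n\ge0,\end{aligned}$$ with starting values $U_N^i=\mathcal{P}_Nu(t_i,\cdot)$, $W_N^i=\mathcal{P}_Nw(t_i,\cdot)$, $i=0,\dots,q-1$. Then $$\|u(t_n)-U_N^n\|^2+\|w(t_n)-W_N^n\|^2\le C\big(\Delta t^{2q}+e_{\mathrm{proj}}\big)$$ for every $n\ge0$ such that $t_n\le T$, where $$e_{\mathrm{proj}}:=\sum_{i=0}^{q-1}\left(\|(I-\mathcal{P}_N)u(t_i)\|^2+\Big(1+\frac{\Delta t}{\varepsilon}\Big)\|(I-\mathcal{P}_N)w(t_i)\|^2\right).$$
   Context: The spatial domain is $[0,2\pi]$ with periodic boundary conditions; $\|\cdot\|$ is the $L^2$ norm in $x$ and $\|\cdot\|_{H^s}$ the Sobolev norm in $x$. $\mathbb{P}_N=\mathrm{span}\{e^{ikx}:-N\le k\le N\}$, and $\mathcal{P}_N$ is the Fourier projection $\mathcal{P}_Nf=\sum_{k=-N}^N\hat f_ke^{ikx}$, $\hat f_k=\frac1{2\pi}\int_0^{2\pi}f(x)e^{-ikx}\,dx$. The coefficients of the $q$-th order IMEX-BDF scheme are defined by $$\beta=\frac{1}{\sum_{j=1}^q\frac1j},\qquad \sum_{i=0}^q\alpha_i\zeta^i=\beta\sum_{j=1}^q\frac1j\,\zeta^{q-j}(\zeta-1)^j,\qquad \sum_{i=0}^{q-1}\gamma_i\zeta^i=\beta\big(\zeta^q-(\zeta-1)^q\big).$$ (Here $\alpha_q=1$.) Time derivatives at $t=0$ are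 those of the solution, i.e. obtained from the initial data through the equations. The constant $C$ may depend on $b,q,T,c_{CFL},K$; the bound $K$ on the initial data is independent of $\varepsilon$. *)

theory Defs
  imports "HOL-Analysis.Analysis" "HOL-Computational_Algebra.Polynomial"
begin

text \<open>
  Functions of \<open>x\<close> are complex-valued functions on the whole real line, \<open>2\<pi>\<close>-periodic where it
  matters; real-valued functions are a special case. Functions of \<open>(t, x)\<close> are curried with time
  first, and only their values at times \<open>t \<ge> 0\<close> matter.
\<close>

definition fourier_coeff :: "(real \<Rightarrow> complex) \<Rightarrow> int \<Rightarrow> complex" where
  "fourier_coeff f k =
     1 / (2 * pi) * integral {0..2 * pi} (\<lambda>x. f x * cis (- (of_int k * x)))"

definition fourier_proj :: "nat \<Rightarrow> (real \<Rightarrow> complex) \<Rightarrow> real \<Rightarrow> complex" where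
  "fourier_proj N f x =
     (\<Sum>k\<in>{- int N..int N}. fourier_coeff f k * cis (of_int k * x))"

definition trig_polys :: "nat \<Rightarrow> (real \<Rightarrow> complex) set" where
  "trig_polys N = {f. \<exists>c :: int \<Rightarrow> complex.
     f = (\<lambda>x. \<Sum>k\<in>{- int N..int N}. c k * cis (of_int k * x))}"

definition L2_norm :: "(real \<Rightarrow> complex) \<Rightarrow> real" where
  "L2_norm f = sqrt (integral {0..2 * pi} (\<lambda>x. (cmod (f x))\<^sup>2))"

definition square_integrable :: "(real \<Rightarrow> complex) \<Rightarrow> bool" where
  "square_integrable f \<longleftrightarrow> f \<in> borel_measurable (lebesgue_on {0..2 * pi}) \<and>
     (\<lambda>x. (cmod (f x))\<^sup>2) integrable_on {0..2 * pi}"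

text \<open>The periodic Sobolev space \<open>H\<^sup>s\<close>. The factor \<open>2\<pi>\<close> makes the norm for \<open>s = 0\<close> the \<open>L\<^sup>2\<close> norm,
  by Parseval's identity.\<close>

definition sobolev :: "nat \<Rightarrow> (real \<Rightarrow> complex) set" where
  "sobolev s = {f. square_integrable f \<and>
     (\<lambda>k :: int. (1 + (of_int k)\<^sup>2) ^ s * (cmod (fourier_coeff f k))\<^sup>2 :: real) summable_on UNIV}"

definition sobolev_norm :: "nat \<Rightarrow> (real \<Rightarrow> complex) \<Rightarrow> real" where
  "sobolev_norm s f =
     sqrt (2 * pi * (\<Sum>\<^sub>\<infinity>k :: int. (1 + (of_int k)\<^sup>2) ^ s * (cmod (fourier_coeff f k))\<^sup>2))"

definition dx :: "(real \<Rightarrow> complex) \<Rightarrow> real \<Rightarrow> complex" where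
  "dx f x = vector_derivative f (at x)"

text \<open>At \<open>t = 0\<close> the time derivative is one-sided.\<close>

definition dt :: "(real \<Rightarrow> real \<Rightarrow> complex) \<Rightarrow> real \<Rightarrow> real \<Rightarrow> complex" where
  "dt u t x = vector_derivative (\<lambda>s. u s x) (at t within {0..})"

text \<open>The time derivatives up to order \<open>m\<close> exist and are continuous in \<open>(t, x)\<close>, up to \<open>t = 0\<close>; then
  \<open>(dt ^^ j) u\<close> is the genuine \<open>j\<close>-th time derivative for \<open>j \<le> m\<close>.\<close>

definition time_smooth :: "nat \<Rightarrow> (real \<Rightarrow> real \<Rightarrow> complex) \<Rightarrow> bool" where
  "time_smooth m u \<longleftrightarrow>
     (\<forall>j<m. \<forall>t\<ge>0. \<forall>x. (\<lambda>s. (dt ^^ j) u s x) differentiable (at t within {0..})) \<and>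
     (\<forall>j\<le>m. continuous_on ({0..} \<times> UNIV) (\<lambda>(t, x). (dt ^^ j) u t x))"

definition C1_periodic :: "(real \<Rightarrow> real \<Rightarrow> complex) \<Rightarrow> bool" where
  "C1_periodic u \<longleftrightarrow>
     (\<forall>t\<ge>0. \<forall>x. u t (x + 2 * pi) = u t x) \<and>
     time_smooth 1 u \<and>
     (\<forall>t\<ge>0. \<forall>x. u t differentiable (at x)) \<and>
     continuous_on ({0..} \<times> UNIV) (\<lambda>(t, x). dx (u t) x)"

definition is_solution ::
  "real \<Rightarrow> real \<Rightarrow> (real \<Rightarrow> real \<Rightarrow> complex) \<Rightarrow> (real \<Rightarrow> real \<Rightarrow> complex) \<Rightarrow> bool" where
  "is_solution b \<epsilon> u w \<longleftrightarrow> C1_periodic u \<and> C1_periodic w \<and>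
     (\<forall>t\<ge>0. \<forall>x.
        dt u t x + dx (\<lambda>y. b *\<^sub>R u t y + w t y) x = 0 \<and>
        dt w t x + dx (\<lambda>y. (1 - b\<^sup>2) *\<^sub>R u t y - b *\<^sub>R w t y) x = - (1 / \<epsilon>) *\<^sub>R w t x)"

definition bdf_beta :: "nat \<Rightarrow> real" where
  "bdf_beta q = 1 / (\<Sum>j=1..q. 1 / real j)"

definition bdf_alpha :: "nat \<Rightarrow> nat \<Rightarrow> real" where
  "bdf_alpha q i = coeff
     (smult (bdf_beta q) (\<Sum>j=1..q. smult (1 / real j) (monom 1 (q - j) * [:-1, 1:] ^ j))) i"

definition bdf_gamma :: "nat \<Rightarrow> nat \<Rightarrow> real" where
  "bdf_gamma q i = coeff (smult (bdf_beta q) (monom 1 q - [:-1, 1:] ^ q)) i"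

definition imex_bdf ::
  "nat \<Rightarrow> real \<Rightarrow> real \<Rightarrow> nat \<Rightarrow> real \<Rightarrow> (nat \<Rightarrow> real \<Rightarrow> complex) \<Rightarrow> (nat \<Rightarrow> real \<Rightarrow> complex) \<Rightarrow> bool" where
  "imex_bdf q b \<epsilon> N \<Delta>t U W \<longleftrightarrow>
     (\<forall>n. U n \<in> trig_polys N \<and> W n \<in> trig_polys N) \<and>
     (\<forall>n x.
        (\<Sum>i=0..q. bdf_alpha q i *\<^sub>R U (n + i) x)
          + \<Delta>t *\<^sub>R (\<Sum>i<q. bdf_gamma q i *\<^sub>R dx (\<lambda>y. b *\<^sub>R U (n + i) y + W (n + i) y) x) = 0 \<and>
        (\<Sum>i=0..q. bdf_alpha q i *\<^sub>R W (n + i) x)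
          + \<Delta>t *\<^sub>R (\<Sum>i<q. bdf_gamma q i *\<^sub>R dx (\<lambda>y. (1 - b\<^sup>2) *\<^sub>R U (n + i) y - b *\<^sub>R W (n + i) y) x)
          = - (bdf_beta q * \<Delta>t / \<epsilon>) *\<^sub>R W (n + q) x)"

definition proj_error_sq :: "nat \<Rightarrow> (real \<Rightarrow> complex) \<Rightarrow> real" where
  "proj_error_sq N f = (L2_norm (\<lambda>x. f x - fourier_proj N f x))\<^sup>2"

definition e_proj ::
  "nat \<Rightarrow> real \<Rightarrow> nat \<Rightarrow> real \<Rightarrow> real \<Rightarrow> (real \<Rightarrow> real \<Rightarrow> complex) \<Rightarrow> (real \<Rightarrow> real \<Rightarrow> complex) \<Rightarrow> real" where
  "e_proj q \<epsilon> N \<Delta>t T0 u w =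
     (\<Sum>i<q. proj_error_sq N (u (T0 + real i * \<Delta>t))
            + (1 + \<Delta>t / \<epsilon>) * proj_error_sq N (w (T0 + real i * \<Delta>t)))"

definition bounded_time_derivs ::
  "nat \<Rightarrow> real \<Rightarrow> (real \<Rightarrow> real \<Rightarrow> complex) \<Rightarrow> (real \<Rightarrow> real \<Rightarrow> complex) \<Rightarrow> bool" where
  "bounded_time_derivs q K u w \<longleftrightarrow>
     time_smooth (q + 1) u \<and> time_smooth (q + 1) w \<and>
     (dt ^^ (q + 1)) u 0 \<in> sobolev 1 \<and> (dt ^^ (q + 1)) w 0 \<in> sobolev 1 \<and>
     sobolev_norm 1 ((dt ^^ (q + 1)) u 0) + sobolev_norm 1 ((dt ^^ (q + 1)) w 0) \<le> K \<and>
     (dt ^^ q) u 0 \<in> sobolev 2 \<and> (dt ^^ q) w 0 \<in> sobolev 2 \<and>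
     sobolev_norm 2 ((dt ^^ q) u 0) + sobolev_norm 2 ((dt ^^ q) w 0) \<le> K"

definition bounded_data ::
  "nat \<Rightarrow> real \<Rightarrow> (real \<Rightarrow> real \<Rightarrow> complex) \<Rightarrow> (real \<Rightarrow> real \<Rightarrow> complex) \<Rightarrow> bool" where
  "bounded_data q K u w \<longleftrightarrow>
     u 0 \<in> sobolev (q + 2) \<and> w 0 \<in> sobolev (q + 2) \<and>
     (sobolev_norm (q + 2) (u 0))\<^sup>2 + (sobolev_norm (q + 2) (w 0))\<^sup>2 \<le> K"

end

theory Submission
  imports Defs
begin

text \<open>
  Both the system and the scheme have constant coefficients and act on each Fourier mode
  separately. In mode \<open>k\<close> the system is a \<open>2 \<times> 2\<close> linear ODE, and the scheme is a linear multistep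
  recursion in which \<open>k\<close> enters only through \<open>k\<Delta>t\<close>, with \<open>(k\<Delta>t)\<^sup>2 \<le> c\<^sub>C\<^sub>F\<^sub>L \<Delta>t\<close> by the step restriction.
  Everything is therefore an estimate for scalar sequences, uniform in \<open>k\<close> and \<open>\<epsilon>\<close>, followed by
  a summation over the modes.

  Modes above \<open>N\<close>. The numerical solution has none, so the error there is the projection error of
  the exact solution. The energy \<open>(1 - b\<^sup>2) \<parallel>u\<parallel>\<^sup>2 + \<parallel>w\<parallel>\<^sup>2\<close> is dissipated in physical space and in
  every mode; subtracting the modes up to \<open>N\<close> from the total shows that the energy of the
  projection error decreases in time (\<open>projection_error_nonincreasing\<close>). It is thus bounded by its
  value at \<open>T0\<close>, which is part of \<open>e\<^sub>p\<^sub>r\<^sub>o\<^sub>j\<close>.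

  Modes up to \<open>N\<close>: stability (\<open>imex_mode_stability\<close>). Both error equations are tested with the
  multiplier \<open>v\<^sub>n\<^sub>+\<^sub>q - v\<^sub>n\<^sub>+\<^sub>q\<^sub>-\<^sub>1 / 2\<close>. For \<open>q \<le> 4\<close> the BDF operator then produces a telescoping positive
  definite quadratic form plus a multiple of the squares of all differences
  (\<open>bdf_multiplier_inequality\<close>); this strict dissipation is what the multiplier is for. The stiff
  implicit term has a good sign up to a telescoping term, whatever \<open>\<epsilon>\<close> is. The explicit
  transport terms are multiples of the multiplier itself up to a defect that annihilates constants:
  the leading parts cancel by skew-symmetry, and the defects, which are sums of differences, are
  absorbed by the dissipation at the cost of \<open>(k\<Delta>t)\<^sup>2 = O(\<Delta>t)\<close> times the energy. A discrete
  Gronwall argument concludes.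

  Modes up to \<open>N\<close>: consistency (\<open>mode_consistency\<close>). The stiff term \<open>w / \<epsilon>\<close> at the new level is
  eliminated through the equation, after which the residual contains only derivatives of order
  \<open>q + 1\<close> and \<open>k\<close> times derivatives of order \<open>q\<close>, without \<open>1 / \<epsilon>\<close>. These are bounded uniformly in
  \<open>\<epsilon>\<close>. In the first case the time derivatives solve the same system, so the energy controls them
  by their initial values. In the second case (\<open>mode_derivative_bound_after_layer\<close>) a mode with
  small \<open>\<epsilon>k\<close> splits into a slow part, whose derivatives cost only powers of \<open>k\<close>, and a part decaying
  at least like \<open>exp (- 5 t / (6 \<epsilon>))\<close>, which beats the powers of \<open>1 / \<epsilon>\<close> from time
  \<open>(q + 2) \<epsilon> ln (1 / \<epsilon>)\<close> on; in all other modes \<open>1 / \<epsilon>\<close> is itself \<open>O(1 + \<bar>k\<bar>)\<close>.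
\<close>

section \<open>Coefficients and order conditions of the BDF schemes\<close>

lemma bdf_beta_values:
  "bdf_beta 1 = 1" "bdf_beta 2 = 2/3" "bdf_beta 3 = 6/11" "bdf_beta 4 = 12/25"
  by (simp_all add: bdf_beta_def numeral_eq_Suc)

lemma bdf_alpha_values:
  "bdf_alpha 1 0 = -1" "bdf_alpha 1 1 = 1"
  "bdf_alpha 2 0 = 1/3" "bdf_alpha 2 1 = -4/3" "bdf_alpha 2 2 = 1"
  "bdf_alpha 3 0 = -2/11" "bdf_alpha 3 1 = 9/11" "bdf_alpha 3 2 = -18/11" "bdf_alpha 3 3 = 1"
  "bdf_alpha 4 0 = 3/25" "bdf_alpha 4 1 = -16/25" "bdf_alpha 4 2 = 36/25" "bdf_alpha 4 3 = -48/25"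
  "bdf_alpha 4 4 = 1"
  by (simp_all add: bdf_alpha_def bdf_beta_def numeral_eq_Suc monom_Suc)

lemma bdf_gamma_values:
  "bdf_gamma 1 0 = 1"
  "bdf_gamma 2 0 = -2/3" "bdf_gamma 2 1 = 4/3"
  "bdf_gamma 3 0 = 6/11" "bdf_gamma 3 1 = -18/11" "bdf_gamma 3 2 = 18/11"
  "bdf_gamma 4 0 = -12/25" "bdf_gamma 4 1 = 48/25" "bdf_gamma 4 2 = -72/25" "bdf_gamma 4 3 = 48/25"
  by (simp_all add: bdf_gamma_def bdf_beta_def numeral_eq_Suc monom_Suc)

section \<open>A Lyapunov functional for the BDF recursion\<close>

text \<open>
  Let \<open>P\<close> be the form with \<open>\<alpha>(\<zeta>) = (\<zeta> - 1) P(\<zeta>)\<close>, so that the BDF operator is \<open>P\<close> of the shifted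
  sequence minus \<open>P\<close>. The leading square is \<open>P(v)\<^sup>2 / (4 \<beta>)\<close>: since \<open>P(1) = \<beta>\<close>, the multiplier
  \<open>v\<^sub>q - v\<^sub>q\<^sub>-\<^sub>1 / 2\<close> differs from \<open>1 / (4 \<beta>)\<close> times the sum of \<open>P\<close> and its shift by a combination of
  differences only. The remaining form in the differences is a rounded numerical solution
  of the matrix inequality that makes the remainder positive definite. The weight \<open>1 / 2\<close> in the
  multiplier serves all four orders; with weight \<open>0\<close> the remainder would lose its sign for
  \<open>q = 3, 4\<close>.
\<close>
definition bdf_lyapunov :: "nat \<Rightarrow> (nat \<Rightarrow> real) \<Rightarrow> real" where
  "bdf_lyapunov q v =
    (if q = 1 then 1/4 * (v 0)^2
     else if q = 2 then 3/8 * (-1/3 * v 0 + v 1)^2 + 1/4 * (v 1 - v 0)^2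
     else if q = 3 then 11/24 * (2/11 * v 0 - 7/11 * v 1 + v 2)^2
       + 1/8 * (v 1 - v 0)^2 - 1/4 * (v 1 - v 0) * (v 2 - v 1) + 3/8 * (v 2 - v 1)^2
     else 25/48 * (-3/25 * v 0 + 13/25 * v 1 - 23/25 * v 2 + v 3)^2
       + 1/100 * (v 1 - v 0)^2 - 1/50 * (v 1 - v 0) * (v 2 - v 1) + 3/50 * (v 2 - v 1)^2
       - 1/10 * (v 2 - v 1) * (v 3 - v 2) + 7/50 * (v 3 - v 2)^2)"

text \<open>
  For each order, the difference of both sides of the multiplier inequality, and of the coercivity
  estimate, is written as an explicit sum of squares obtained by a rational Cholesky decomposition.
  The constants \<open>1 / 250\<close> and \<open>1 / 1000\<close> are those reached for \<open>q = 4\<close>; lower orders allow larger ones.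
\<close>
lemma bdf1_multiplier_inequality:
  fixes a b :: real
  shows "1/4 * b^2
      - (1/4 * a^2)
      + 1/250 * ((b - a)^2)
    \<le> (-a + b) * (b - a/2)"
proof -
  have "(-a + b) * (b - a/2) =
      1/4 * b^2
      - (1/4 * a^2)
      + 1/4 * ((b - a)^2)
      + 1/2 * (b - a)^2"
    by algebra
  moreover have "1/250 * ((b - a)^2) \<le> 1/4 * ((b - a)^2)"
    by (intro mult_right_mono) auto
  moreover have "0 \<le> 1/2 * (b - a)^2"
    by (intro add_nonneg_nonneg mult_nonneg_nonneg) auto
  ultimately show ?thesis
    by linarith
qed

lemma bdf1_lyapunov_coercive:
  fixes a :: real
  shows "1/1000 * (a^2) \<le> 1/4 * a^2"
proof -
  have "1/4 * a^2 =
      1/8 * (a^2)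
      + 1/8 * a^2"
    by algebra
  moreover have "1/1000 * (a^2) \<le> 1/8 * (a^2)"
    by (intro mult_right_mono) auto
  moreover have "0 \<le> 1/8 * a^2"
    by (intro add_nonneg_nonneg mult_nonneg_nonneg) auto
  ultimately show ?thesis
    by linarith
qed

lemma bdf2_multiplier_inequality:
  fixes a b c :: real
  shows "3/8 * (-1/3 * b + c)^2 + 1/4 * (c - b)^2
      - (3/8 * (-1/3 * a + b)^2 + 1/4 * (b - a)^2)
      + 1/250 * ((b - a)^2 + (c - b)^2)
    \<le> (1/3 * a - 4/3 * b + c) * (c - b/2)"
proof -
  have "(1/3 * a - 4/3 * b + c) * (c - b/2) =
      3/8 * (-1/3 * b + c)^2 + 1/4 * (c - b)^2
      - (3/8 * (-1/3 * a + b)^2 + 1/4 * (b - a)^2)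
      + 1/8 * ((b - a)^2 + (c - b)^2)
      + 1/6 * ((b - a) - (c - b))^2
      + 1/12 * (c - b)^2"
    by algebra
  moreover have "1/250 * ((b - a)^2 + (c - b)^2) \<le> 1/8 * ((b - a)^2 + (c - b)^2)"
    by (intro mult_right_mono) auto
  moreover have "0 \<le> 1/6 * ((b - a) - (c - b))^2
      + 1/12 * (c - b)^2"
    by (intro add_nonneg_nonneg mult_nonneg_nonneg) auto
  ultimately show ?thesis
    by linarith
qed

lemma bdf2_lyapunov_coercive:
  fixes a b :: real
  shows "1/1000 * (a^2 + b^2) \<le> 3/8 * (-1/3 * a + b)^2 + 1/4 * (b - a)^2"
proof -
  have "3/8 * (-1/3 * a + b)^2 + 1/4 * (b - a)^2 =
      1/100 * (a^2 + b^2)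
      + 169/600 * (a - 225/169 * b)^2
      + 489/4225 * b^2"
    by algebra
  moreover have "1/1000 * (a^2 + b^2) \<le> 1/100 * (a^2 + b^2)"
    by (intro mult_right_mono) auto
  moreover have "0 \<le> 169/600 * (a - 225/169 * b)^2
      + 489/4225 * b^2"
    by (intro add_nonneg_nonneg mult_nonneg_nonneg) auto
  ultimately show ?thesis
    by linarith
qed

lemma bdf3_multiplier_inequality:
  fixes a b c d :: real
  shows "11/24 * (2/11 * b - 7/11 * c + d)^2 + 1/8 * (c - b)^2 - 1/4 * (c - b) * (d - c) + 3/8 * (d - c)^2
      - (11/24 * (2/11 * a - 7/11 * b + c)^2 + 1/8 * (b - a)^2 - 1/4 * (b - a) * (c - b) + 3/8 * (c - b)^2)
      + 1/250 * ((b - a)^2 + (c - b)^2 + (d - c)^2)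
    \<le> (-2/11 * a + 9/11 * b - 18/11 * c + d) * (d - c/2)"
proof -
  have "(-2/11 * a + 9/11 * b - 18/11 * c + d) * (d - c/2) =
      11/24 * (2/11 * b - 7/11 * c + d)^2 + 1/8 * (c - b)^2 - 1/4 * (c - b) * (d - c) + 3/8 * (d - c)^2
      - (11/24 * (2/11 * a - 7/11 * b + c)^2 + 1/8 * (b - a)^2 - 1/4 * (b - a) * (c - b) + 3/8 * (c - b)^2)
      + 1/50 * ((b - a)^2 + (c - b)^2 + (d - c)^2)
      + 793/6600 * ((b - a) - 1075/793 * (c - b) + 600/793 * (d - c))^2
      + 232237/2616900 * ((c - b) + 70075/464474 * (d - c))^2
      + 7047279/92894800 * (d - c)^2"
    by algebra
  moreover have "1/250 * ((b - a)^2 + (c - b)^2 + (d - c)^2) \<le> 1/50 * ((b - a)^2 + (c - b)^2 + (d - c)^2)"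
    by (intro mult_right_mono) auto
  moreover have "0 \<le> 793/6600 * ((b - a) - 1075/793 * (c - b) + 600/793 * (d - c))^2
      + 232237/2616900 * ((c - b) + 70075/464474 * (d - c))^2
      + 7047279/92894800 * (d - c)^2"
    by (intro add_nonneg_nonneg mult_nonneg_nonneg) auto
  ultimately show ?thesis
    by linarith
qed

lemma bdf3_lyapunov_coercive:
  fixes a b c :: real
  shows "1/1000 * (a^2 + b^2 + c^2) \<le> 11/24 * (2/11 * a - 7/11 * b + c)^2 + 1/8 * (b - a)^2 - 1/4 * (b - a) * (c - b) + 3/8 * (c - b)^2"
proof -
  have "11/24 * (2/11 * a - 7/11 * b + c)^2 + 1/8 * (b - a)^2 - 1/4 * (b - a) * (c - b) + 3/8 * (c - b)^2 =
      1/100 * (a^2 + b^2 + c^2)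
      + 859/6600 * (a - 2000/859 * b + 1375/859 * c)^2
      + 37807/171800 * (b - 7525/5401 * c)^2
      + 33849/540100 * c^2"
    by algebra
  moreover have "1/1000 * (a^2 + b^2 + c^2) \<le> 1/100 * (a^2 + b^2 + c^2)"
    by (intro mult_right_mono) auto
  moreover have "0 \<le> 859/6600 * (a - 2000/859 * b + 1375/859 * c)^2
      + 37807/171800 * (b - 7525/5401 * c)^2
      + 33849/540100 * c^2"
    by (intro add_nonneg_nonneg mult_nonneg_nonneg) auto
  ultimately show ?thesis
    by linarith
qed

lemma bdf4_multiplier_inequality:
  fixes a b c d e :: real
  shows "25/48 * (-3/25 * b + 13/25 * c - 23/25 * d + e)^2
      + 1/100 * (c - b)^2 - 1/50 * (c - b) * (d - c) + 3/50 * (d - c)^2 - 1/10 * (d - c) * (e - d) + 7/50 * (e - d)^2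
      - (25/48 * (-3/25 * a + 13/25 * b - 23/25 * c + d)^2
      + 1/100 * (b - a)^2 - 1/50 * (b - a) * (c - b) + 3/50 * (c - b)^2 - 1/10 * (c - b) * (d - c) + 7/50 * (d - c)^2)
      + 1/250 * ((b - a)^2 + (c - b)^2 + (d - c)^2 + (e - d)^2)
    \<le> (3/25 * a - 16/25 * b + 36/25 * c - 48/25 * d + e) * (e - d/2)"
proof -
  have "(3/25 * a - 16/25 * b + 36/25 * c - 48/25 * d + e) * (e - d/2) =
      25/48 * (-3/25 * b + 13/25 * c - 23/25 * d + e)^2
      + 1/100 * (c - b)^2 - 1/50 * (c - b) * (d - c) + 3/50 * (d - c)^2 - 1/10 * (d - c) * (e - d) + 7/50 * (e - d)^2
      - (25/48 * (-3/25 * a + 13/25 * b - 23/25 * c + d)^2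
      + 1/100 * (b - a)^2 - 1/50 * (b - a) * (c - b) + 3/50 * (c - b)^2 - 1/10 * (c - b) * (d - c) + 7/50 * (d - c)^2)
      + 1/250 * ((b - a)^2 + (c - b)^2 + (d - c)^2 + (e - d)^2)
      + 27/2000 * ((b - a) - 70/27 * (c - b) + 65/27 * (d - c) - 40/9 * (e - d))^2
      + 1679/54000 * ((c - b) - 2110/1679 * (d - c) + 2265/1679 * (e - d))^2
      + 5167/839500 * ((d - c) - 11360/15501 * (e - d))^2
      + 200209/23251500 * (e - d)^2"
    by algebra
  moreover have "1/250 * ((b - a)^2 + (c - b)^2 + (d - c)^2 + (e - d)^2) \<le> 1/250 * ((b - a)^2 + (c - b)^2 + (d - c)^2 + (e - d)^2)"
    by (intro mult_right_mono) auto
  moreover have "0 \<le> 27/2000 * ((b - a) - 70/27 * (c - b) + 65/27 * (d - c) - 40/9 * (e - d))^2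
      + 1679/54000 * ((c - b) - 2110/1679 * (d - c) + 2265/1679 * (e - d))^2
      + 5167/839500 * ((d - c) - 11360/15501 * (e - d))^2
      + 200209/23251500 * (e - d)^2"
    by (intro add_nonneg_nonneg mult_nonneg_nonneg) auto
  ultimately show ?thesis
    by linarith
qed

lemma bdf4_lyapunov_coercive:
  fixes a b c d :: real
  shows "1/1000 * (a^2 + b^2 + c^2 + d^2) \<le> 25/48 * (-3/25 * a + 13/25 * b - 23/25 * c + d)^2
      + 1/100 * (b - a)^2 - 1/50 * (b - a) * (c - b) + 3/50 * (c - b)^2 - 1/10 * (c - b) * (d - c) + 7/50 * (d - c)^2"
proof -
  have "25/48 * (-3/25 * a + 13/25 * b - 23/25 * c + d)^2
      + 1/100 * (b - a)^2 - 1/50 * (b - a) * (c - b) + 3/50 * (c - b)^2 - 1/10 * (c - b) * (d - c) + 7/50 * (d - c)^2 =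
      1/1000 * (a^2 + b^2 + c^2 + d^2)
      + 33/2000 * (a - 35/11 * b + 45/11 * c - 125/33 * d)^2
      + 259/4125 * (b - 5095/2072 * c + 575/296 * d)^2
      + 174143/2072000 * (c - 235305/174143 * d)^2
      + 8543453/261214500 * d^2"
    by algebra
  moreover have "1/1000 * (a^2 + b^2 + c^2 + d^2) \<le> 1/1000 * (a^2 + b^2 + c^2 + d^2)"
    by (intro mult_right_mono) auto
  moreover have "0 \<le> 33/2000 * (a - 35/11 * b + 45/11 * c - 125/33 * d)^2
      + 259/4125 * (b - 5095/2072 * c + 575/296 * d)^2
      + 174143/2072000 * (c - 235305/174143 * d)^2
      + 8543453/261214500 * d^2"
    by (intro add_nonneg_nonneg mult_nonneg_nonneg) auto
  ultimately show ?thesis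
    by linarith
qed

lemma bdf_sums:
  fixes f :: "nat \<Rightarrow> 'a :: comm_monoid_add"
  shows "sum f {..<1} = f 0" "sum f {..<2} = f 0 + f 1" "sum f {..<3} = f 0 + f 1 + f 2"
    "sum f {..<4} = f 0 + f 1 + f 2 + f 3"
    "sum f {0..1} = f 0 + f 1" "sum f {0..2} = f 0 + f 1 + f 2"
    "sum f {0..3} = f 0 + f 1 + f 2 + f 3" "sum f {0..4} = f 0 + f 1 + f 2 + f 3 + f 4"
  by (simp_all add: eval_nat_numeral ac_simps)

lemma bdf_lyapunov_coercive:
  assumes "q \<in> {1, 2, 3, 4}"
  shows "1/1000 * (\<Sum>i<q. (v i)\<^sup>2) \<le> bdf_lyapunov q v"
proof -
  consider "q = 1" | "q = 2" | "q = 3" | "q = 4" using assms by auto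
  then show ?thesis
  proof cases
    case 1 then show ?thesis using bdf1_lyapunov_coercive[of "v 0"]
      by (simp only: bdf_sums bdf_lyapunov_def) simp
  next
    case 2 then show ?thesis using bdf2_lyapunov_coercive[of "v 0" "v 1"]
      by (simp only: bdf_sums bdf_lyapunov_def) simp
  next
    case 3 then show ?thesis using bdf3_lyapunov_coercive[of "v 0" "v 1" "v 2"]
      by (simp only: bdf_sums bdf_lyapunov_def) simp
  next
    case 4 then show ?thesis using bdf4_lyapunov_coercive[of "v 0" "v 1" "v 2" "v 3"]
      by (simp only: bdf_sums bdf_lyapunov_def) simp
  qed
qed

lemma bdf_multiplier_inequality:
  assumes "q \<in> {1, 2, 3, 4}"
  shows "bdf_lyapunov q (\<lambda>i. v (i + 1)) - bdf_lyapunov q v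
      + 1/250 * (\<Sum>i<q. (v (i + 1) - v i)\<^sup>2)
    \<le> (\<Sum>i=0..q. bdf_alpha q i * v i) * (v q - v (q - 1) / 2)"
proof -
  have suc: "(0::nat) + 1 = 1" "(1::nat) + 1 = 2" "(2::nat) + 1 = 3" "(3::nat) + 1 = 4"
    "(1::nat) - 1 = 0" "(2::nat) - 1 = 1" "(3::nat) - 1 = 2" "(4::nat) - 1 = 3"
    by simp_all
  consider "q = 1" | "q = 2" | "q = 3" | "q = 4" using assms by auto
  then show ?thesis
  proof cases
    case 1 then show ?thesis using bdf1_multiplier_inequality[where a="v 0" and b="v 1"]
      by (simp only: bdf_sums bdf_lyapunov_def bdf_alpha_values suc) simp
  next
    case 2 then show ?thesis using bdf2_multiplier_inequality[where a="v 0" and b="v 1" and c="v 2"]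
      by (simp only: bdf_sums bdf_lyapunov_def bdf_alpha_values suc) simp
  next
    case 3 then show ?thesis using bdf3_multiplier_inequality[where a="v 0" and b="v 1" and c="v 2" and d="v 3"]
      by (simp only: bdf_sums bdf_lyapunov_def bdf_alpha_values suc) simp
  next
    case 4 then show ?thesis using bdf4_multiplier_inequality[where a="v 0" and b="v 1" and c="v 2" and d="v 3" and e="v 4"]
      by (simp only: bdf_sums bdf_lyapunov_def bdf_alpha_values suc) simp
  qed
qed

lemma bdf_alpha_leading:
  assumes "q \<in> {1, 2, 3, 4}"
  shows "bdf_alpha q q = 1"
  using assms by (auto simp: bdf_alpha_values simp del: One_nat_def)

lemma bdf_beta_pos:
  assumes "q \<in> {1, 2, 3, 4}"
  shows "0 < bdf_beta q"
  using assms by (auto simp: bdf_beta_values simp del: One_nat_def)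

lemma bdf_alpha_order:
  assumes "q \<in> {1, 2, 3, 4}" "j \<le> q"
  shows "(\<Sum>i=0..q. bdf_alpha q i * real i ^ j) = bdf_beta q * (real j * real q ^ (j - 1))"
proof -
  have "j = 0 \<or> j = 1 \<or> j = 2 \<or> j = 3 \<or> j = 4" using assms by auto
  moreover have "q = 1 \<or> q = 2 \<or> q = 3 \<or> q = 4" using assms by auto
  ultimately show ?thesis using assms(2)
    by (elim disjE) (auto simp: bdf_sums bdf_alpha_values bdf_beta_values simp del: One_nat_def)
qed

lemma bdf_gamma_order:
  assumes "q \<in> {1, 2, 3, 4}" "j < q"
  shows "(\<Sum>i<q. bdf_gamma q i * real i ^ j) = bdf_beta q * real q ^ j"
proof -
  have "j = 0 \<or> j = 1 \<or> j = 2 \<or> j = 3" using assms by auto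
  moreover have "q = 1 \<or> q = 2 \<or> q = 3 \<or> q = 4" using assms by auto
  ultimately show ?thesis using assms(2)
    by (elim disjE) (auto simp: bdf_sums bdf_gamma_values bdf_beta_values simp del: One_nat_def)
qed

text \<open>
  A combination with vanishing coefficient sum annihilates constants and is therefore controlled
  by differences of neighbours.
\<close>
lemma sum_diff_bound:
  fixes v :: "nat \<Rightarrow> 'a :: real_normed_vector"
  assumes "(\<Sum>i=0..q. a i) = (0::real)"
  shows "(norm (\<Sum>i=0..q. a i *\<^sub>R v i))\<^sup>2
    \<le> (\<Sum>i=0..q. \<bar>a i\<bar>)\<^sup>2 * real q * (\<Sum>i<q. (norm (v (i + 1) - v i))\<^sup>2)"
proof -
  define s where "s = (\<Sum>i<q. norm (v (i + 1) - v i))"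
  have tele: "norm (v i - v 0) \<le> s" if "i \<le> q" for i
  proof -
    have "norm (v i - v 0) \<le> (\<Sum>j<i. norm (v (j + 1) - v j))"
      using norm_sum[of "\<lambda>j. v (j + 1) - v j" "{..<i}"] by (simp add: sum_lessThan_telescope)
    also have "\<dots> \<le> s"
      unfolding s_def using that by (intro sum_mono2) auto
    finally show ?thesis .
  qed
  have "(\<Sum>i=0..q. a i *\<^sub>R v i) = (\<Sum>i=0..q. a i *\<^sub>R (v i - v 0))"
    using assms by (simp add: scaleR_diff_right sum_subtractf flip: scaleR_left.sum)
  also have "norm \<dots> \<le> (\<Sum>i=0..q. \<bar>a i\<bar> * s)"
    by (intro order.trans[OF norm_sum] sum_mono) (simp add: mult_left_mono tele)
  finally have "norm (\<Sum>i=0..q. a i *\<^sub>R v i) \<le> (\<Sum>i=0..q. \<bar>a i\<bar>) * s"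
    by (simp add: sum_distrib_right)
  then have "(norm (\<Sum>i=0..q. a i *\<^sub>R v i))\<^sup>2 \<le> (\<Sum>i=0..q. \<bar>a i\<bar>)\<^sup>2 * s\<^sup>2"
    by (metis norm_ge_zero power_mono power_mult_distrib)
  also have "s\<^sup>2 \<le> real q * (\<Sum>i<q. (norm (v (i + 1) - v i))\<^sup>2)"
    using sum_squared_le_sum_of_squares[of "\<lambda>i. norm (v (i + 1) - v i)" "{..<q}"]
    by (simp add: s_def mult.commute)
  finally show ?thesis
    by (simp add: mult_left_mono mult.assoc)
qed

definition bdf_multiplier :: "nat \<Rightarrow> (nat \<Rightarrow> complex) \<Rightarrow> complex" where
  "bdf_multiplier q v = v q - v (q - 1) / 2"

text \<open>
  The factor \<open>2 \<beta>\<close> is forced: the extrapolation sends constants to \<open>\<beta>\<close> times themselves and the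
  multiplier halves them. The defect is then bounded by differences, which the BDF dissipation
  controls.
\<close>
lemma bdf_extrapolation_defect:
  assumes "q \<in> {1, 2, 3, 4}"
  obtains L where "L > 0" "\<And>v :: nat \<Rightarrow> complex.
    (cmod ((\<Sum>i<q. bdf_gamma q i *\<^sub>R v i) - 2 * bdf_beta q * bdf_multiplier q v))\<^sup>2
      \<le> L * (\<Sum>i<q. (cmod (v (i + 1) - v i))\<^sup>2)"
proof -
  have q: "q \<ge> 1" using assms by auto
  \<comment> \<open>The coefficients of the defect as a combination of all \<open>q + 1\<close> levels.\<close>
  define a where "a = (\<lambda>i. (if i < q then bdf_gamma q i else 0)
      - (if i = q then 2 * bdf_beta q else 0) + (if i = q - 1 then bdf_beta q else 0))"
  have eq: "(\<Sum>i<q. bdf_gamma q i *\<^sub>R v i) - 2 * bdf_beta q * bdf_multiplier q v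
      = (\<Sum>i=0..q. a i *\<^sub>R v i)" for v :: "nat \<Rightarrow> complex"
  proof -
    have "(\<Sum>i=0..q. a i *\<^sub>R v i) = (\<Sum>i=0..q. (if i < q then bdf_gamma q i *\<^sub>R v i else 0))
      - (\<Sum>i=0..q. (if i = q then (2 * bdf_beta q) *\<^sub>R v i else 0))
      + (\<Sum>i=0..q. (if i = q - 1 then bdf_beta q *\<^sub>R v i else 0))"
      unfolding a_def sum_subtractf[symmetric] sum.distrib[symmetric]
      by (intro sum.cong) (auto simp: algebra_simps)
    also have "(\<Sum>i=0..q. (if i < q then bdf_gamma q i *\<^sub>R v i else 0)) = (\<Sum>i<q. bdf_gamma q i *\<^sub>R v i)"
      by (intro sum.mono_neutral_cong_right) auto
    finally show ?thesis
      by (simp add: bdf_multiplier_def algebra_simps scaleR_conv_of_real)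
  qed
  have a0: "(\<Sum>i=0..q. a i) = 0"
  proof -
    have "(\<Sum>i=0..q. a i) = (\<Sum>i=0..q. (if i < q then bdf_gamma q i else 0))
      - (\<Sum>i=0..q. (if i = q then 2 * bdf_beta q else 0))
      + (\<Sum>i=0..q. (if i = q - 1 then bdf_beta q else 0))"
      unfolding a_def sum_subtractf sum.distrib ..
    also have "(\<Sum>i=0..q. (if i < q then bdf_gamma q i else 0)) = (\<Sum>i<q. bdf_gamma q i)"
      by (intro sum.mono_neutral_cong_right) auto
    also have "\<dots> = bdf_beta q"
      using bdf_gamma_order[OF assms, of 0] q by simp
    finally show ?thesis by simp
  qed
  show ?thesis
  proof
    show "0 < (\<Sum>i=0..q. \<bar>a i\<bar>)\<^sup>2 * real q + 1"
      by (intro add_nonneg_pos) auto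
    show "(cmod ((\<Sum>i<q. bdf_gamma q i *\<^sub>R v i) - 2 * bdf_beta q * bdf_multiplier q v))\<^sup>2
      \<le> ((\<Sum>i=0..q. \<bar>a i\<bar>)\<^sup>2 * real q + 1) * (\<Sum>i<q. (cmod (v (i + 1) - v i))\<^sup>2)"
      for v :: "nat \<Rightarrow> complex"
      unfolding eq using sum_diff_bound[OF a0, of v] sum_nonneg[of "{..<q}" "\<lambda>i. (cmod (v (i + 1) - v i))\<^sup>2"]
      by (simp add: distrib_right)
  qed
qed

definition bdf_energy :: "nat \<Rightarrow> (nat \<Rightarrow> complex) \<Rightarrow> real" where
  "bdf_energy q v = bdf_lyapunov q (\<lambda>i. Re (v i)) + bdf_lyapunov q (\<lambda>i. Im (v i))"

lemma bdf_energy_coercive: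
  assumes "q \<in> {1, 2, 3, 4}"
  shows "1/1000 * (\<Sum>i<q. (cmod (v i))\<^sup>2) \<le> bdf_energy q v"
  using bdf_lyapunov_coercive[OF assms, of "\<lambda>i. Re (v i)"] bdf_lyapunov_coercive[OF assms, of "\<lambda>i. Im (v i)"]
  by (simp add: bdf_energy_def cmod_power2 sum.distrib)

lemma bdf_energy_decay:
  assumes "q \<in> {1, 2, 3, 4}"
  shows "bdf_energy q (\<lambda>i. v (i + 1)) - bdf_energy q v + 1/250 * (\<Sum>i<q. (cmod (v (i + 1) - v i))\<^sup>2)
    \<le> Re ((\<Sum>i=0..q. bdf_alpha q i *\<^sub>R v i) * cnj (bdf_multiplier q v))"
  using bdf_multiplier_inequality[OF assms, of "\<lambda>i. Re (v i)"]
    bdf_multiplier_inequality[OF assms, of "\<lambda>i. Im (v i)"]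
  by (simp add: bdf_energy_def bdf_multiplier_def cmod_power2 sum.distrib algebra_simps add_divide_distrib)

text \<open>
  The implicit stiff term has a sign up to a telescoping term, uniformly in its size \<open>\<eta>\<close>.
\<close>
lemma relaxation_multiplier_bound:
  assumes "0 \<le> \<eta>"
  shows "\<eta> / 4 * ((cmod (v q))\<^sup>2 - (cmod (v (q - 1)))\<^sup>2) \<le> Re (\<eta> *\<^sub>R v q * cnj (bdf_multiplier q v))"
proof -
  have "Re (v q * cnj (v (q - 1))) \<le> cmod (v q) * cmod (v (q - 1))"
    by (metis complex_Re_le_cmod norm_mult complex_mod_cnj)
  also have "\<dots> \<le> ((cmod (v q))\<^sup>2 + (cmod (v (q - 1)))\<^sup>2) / 2"
    using sum_squares_bound[of "cmod (v q)" "cmod (v (q - 1))"] by simp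
  finally have *: "Re (v q * cnj (v (q - 1))) \<le> ((cmod (v q))\<^sup>2 + (cmod (v (q - 1)))\<^sup>2) / 2" .
  have arith: "(x - y) / 4 \<le> p" if "p = x - t / 2" "t \<le> (x + y) / 2" "0 \<le> x" for p x y t :: real
    using that by simp
  have "Re (v q * cnj (bdf_multiplier q v)) = (cmod (v q))\<^sup>2 - Re (v q * cnj (v (q - 1))) / 2"
    unfolding bdf_multiplier_def cmod_power2 by (simp add: algebra_simps power2_eq_square)
  then have "((cmod (v q))\<^sup>2 - (cmod (v (q - 1)))\<^sup>2) / 4 \<le> Re (v q * cnj (bdf_multiplier q v))"
    using * zero_le_power2[of "cmod (v q)"] arith by blast
  from mult_left_mono[OF this assms] show ?thesis
    by (simp add: algebra_simps)
qed

section \<open>Stability of the scheme in one Fourier mode\<close>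

lemma cmod_combination_le:
  fixes x y :: complex and s t :: real
  assumes "\<bar>s\<bar> \<le> 1" "\<bar>t\<bar> \<le> 1"
  shows "cmod (s * x + t * y) \<le> cmod x + cmod y"
proof -
  have "cmod (s * x + t * y) \<le> \<bar>s\<bar> * cmod x + \<bar>t\<bar> * cmod y"
    using norm_triangle_ineq[of "s * x" "t * y"] by (simp add: norm_mult)
  also have "\<dots> \<le> cmod x + cmod y"
    using mult_right_mono[OF assms(1), of "cmod x"] mult_right_mono[OF assms(2), of "cmod y"] by simp
  finally show ?thesis .
qed

text \<open>
  The explicit terms, tested with the multipliers and weighted by the symmetrizer \<open>a = 1 - b\<^sup>2\<close>.
  Their parts proportional to the multipliers contribute \<open>\<i>\<close> times a real number, so only the defects
  \<open>dE\<close> and \<open>dD\<close> survive in the real part.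
\<close>
lemma coupling_bound:
  fixes mE mD dE dD :: complex and a b r \<beta> :: real
  assumes a: "0 \<le> a" "a \<le> 1" and b: "\<bar>b\<bar> \<le> 1"
    and gE: "gE = of_real (2 * \<beta>) * mE + dE" and gD: "gD = of_real (2 * \<beta>) * mD + dD"
  shows "- Re (\<i> * of_real r * (of_real a * (of_real b * gE + gD) * cnj mE
        + (of_real a * gE - of_real b * gD) * cnj mD))
    \<le> \<bar>r\<bar> * ((cmod dE + cmod dD) * (cmod mE + cmod mD))"
proof -
  define z where "z = of_real a * (of_real b * dE + dD) * cnj mE + (of_real a * dE - of_real b * dD) * cnj mD"
  define y where "y = of_real (a * b) * (mE * cnj mE) + of_real a * (mD * cnj mE + mE * cnj mD)
    - of_real b * (mD * cnj mD)"
  have "of_real a * (of_real b * gE + gD) * cnj mE + (of_real a * gE - of_real b * gD) * cnj mD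
      = of_real (2 * \<beta>) * y + z"
    unfolding gE gD y_def z_def of_real_mult by (simp only: algebra_simps)
  moreover have "Im y = 0"
    unfolding y_def by simp
  ultimately have "- Re (\<i> * of_real r * (of_real a * (of_real b * gE + gD) * cnj mE
        + (of_real a * gE - of_real b * gD) * cnj mD)) = r * Im z"
    by (simp only: mult.assoc) simp
  also have "\<dots> \<le> \<bar>r\<bar> * \<bar>Im z\<bar>"
    by (simp flip: abs_mult)
  also have "\<dots> \<le> \<bar>r\<bar> * cmod z"
    by (intro mult_left_mono abs_Im_le_cmod) simp
  also have "cmod z \<le> (cmod dE + cmod dD) * (cmod mE + cmod mD)"
  proof -
    have ab: "\<bar>a * b\<bar> \<le> 1" using a b by (simp add: abs_mult mult_le_one)
    have "of_real a * (of_real b * dE + dD) = of_real (a * b) * dE + of_real a * dD"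
      by (simp add: algebra_simps)
    then have 1: "cmod (of_real a * (of_real b * dE + dD)) \<le> cmod dE + cmod dD"
      using cmod_combination_le[of "a * b" a dE dD] ab a by simp
    have 2: "cmod (of_real a * dE - of_real b * dD) \<le> cmod dE + cmod dD"
      using cmod_combination_le[of a "- b" dE dD] a b by simp
    have "cmod z \<le> cmod (of_real a * (of_real b * dE + dD)) * cmod mE
        + cmod (of_real a * dE - of_real b * dD) * cmod mD"
      unfolding z_def by (rule order_trans[OF norm_triangle_ineq]) (simp add: norm_mult)
    also have "\<dots> \<le> (cmod dE + cmod dD) * cmod mE + (cmod dE + cmod dD) * cmod mD"
      by (intro add_mono mult_right_mono 1 2) auto
    finally show ?thesis by (simp add: algebra_simps)
  qed
  then have "\<bar>r\<bar> * cmod z \<le> \<bar>r\<bar> * ((cmod dE + cmod dD) * (cmod mE + cmod mD))"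
    by (intro mult_left_mono) auto
  finally show ?thesis .
qed

lemma norm_weighted_sum_le:
  fixes v :: "'i \<Rightarrow> 'a :: real_normed_vector"
  assumes "finite I"
  shows "norm (\<Sum>i\<in>I. a i *\<^sub>R v i) \<le> (\<Sum>i\<in>I. \<bar>a i\<bar>) * (\<Sum>i\<in>I. norm (v i))"
proof -
  have "norm (\<Sum>i\<in>I. a i *\<^sub>R v i) \<le> (\<Sum>i\<in>I. \<bar>a i\<bar> * norm (v i))"
    using norm_sum[of "\<lambda>i. a i *\<^sub>R v i" I] by simp
  also have "\<dots> \<le> (\<Sum>i\<in>I. \<bar>a i\<bar> * (\<Sum>i\<in>I. norm (v i)))"
    using assms by (intro sum_mono mult_left_mono member_le_sum) auto
  finally show ?thesis by (simp add: sum_distrib_right)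
qed

text \<open>
  One step of the scheme in mode \<open>k\<close>, with \<open>r = k \<Delta>t\<close> and \<open>\<eta> = \<beta> \<Delta>t / \<epsilon>\<close>, for a window of \<open>q + 1\<close> time
  levels; \<open>\<tau>\<close> and \<open>\<sigma>\<close> are the residuals per unit of time.
\<close>
definition imex_mode_step ::
  "nat \<Rightarrow> real \<Rightarrow> real \<Rightarrow> real \<Rightarrow> real \<Rightarrow> (nat \<Rightarrow> complex) \<Rightarrow> (nat \<Rightarrow> complex) \<Rightarrow> complex \<Rightarrow> complex \<Rightarrow> bool"
  where "imex_mode_step q b r \<eta> h E D \<tau> \<sigma> \<longleftrightarrow>
    (let gE = \<Sum>i<q. bdf_gamma q i *\<^sub>R E i; gD = \<Sum>i<q. bdf_gamma q i *\<^sub>R D i in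
      (\<Sum>i=0..q. bdf_alpha q i *\<^sub>R E i) + \<i> * of_real r * (of_real b * gE + gD) = h *\<^sub>R \<tau> \<and>
      (\<Sum>i=0..q. bdf_alpha q i *\<^sub>R D i) + \<i> * of_real r * (of_real (1 - b\<^sup>2) * gE - of_real b * gD)
        + \<eta> *\<^sub>R D q = h *\<^sub>R \<sigma>)"

text \<open>
  The new level can be solved for directly. This replaces the smallness of \<open>\<Delta>t\<close> that a Gronwall
  argument would otherwise need because the multiplier contains the new level.
\<close>
lemma new_level_bound:
  assumes "q \<in> {1, 2, 3, 4}" "\<bar>b\<bar> \<le> 1"
  obtains M where "M \<ge> 0"
    "\<And>r \<eta> h E D \<tau> \<sigma>. \<lbrakk>\<bar>r\<bar> \<le> R; 0 \<le> \<eta>; 0 < h; h \<le> 1; imex_mode_step q b r \<eta> h E D \<tau> \<sigma>\<rbrakk> \<Longrightarrow>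
      (cmod (E q))\<^sup>2 + (cmod (D q))\<^sup>2
        \<le> M * ((\<Sum>i<q. (cmod (E i))\<^sup>2 + (cmod (D i))\<^sup>2) + (cmod \<tau>)\<^sup>2 + (cmod \<sigma>)\<^sup>2)"
proof -
  define A where "A = (\<Sum>i<q. \<bar>bdf_alpha q i\<bar>)"
  define \<Gamma> where "\<Gamma> = (\<Sum>i<q. \<bar>bdf_gamma q i\<bar>)"
  have A0: "A \<ge> 0" and G0: "\<Gamma> \<ge> 0" by (auto simp: A_def \<Gamma>_def intro: sum_nonneg)
  define B where "B = 1 + A + \<bar>R\<bar> * \<Gamma>"
  have B1: "B \<ge> 1" using A0 G0 by (simp add: B_def)
  show ?thesis
  proof
    show "0 \<le> 2 * B\<^sup>2 * (4 * real q + 4)" by simp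
    fix r \<eta> h :: real and E D :: "nat \<Rightarrow> complex" and \<tau> \<sigma> :: complex
    assume r: "\<bar>r\<bar> \<le> R" and \<eta>: "0 \<le> \<eta>" and h: "0 < h" "h \<le> 1"
      and st: "imex_mode_step q b r \<eta> h E D \<tau> \<sigma>"
    define a where "a = 1 - b\<^sup>2"
    have a: "0 \<le> a" "a \<le> 1" using assms(2) by (auto simp: a_def abs_square_le_1)
    define sE sD where "sE = (\<Sum>i<q. cmod (E i))" and "sD = (\<Sum>i<q. cmod (D i))"
    define gE gD where "gE = (\<Sum>i<q. bdf_gamma q i *\<^sub>R E i)" and "gD = (\<Sum>i<q. bdf_gamma q i *\<^sub>R D i)"
    define Z where "Z = sE + sD + cmod \<tau> + cmod \<sigma>"
    have s0: "sE \<ge> 0" "sD \<ge> 0" by (auto simp: sE_def sD_def intro: sum_nonneg)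
    have g: "cmod gE \<le> \<Gamma> * sE" "cmod gD \<le> \<Gamma> * sD"
      unfolding gE_def gD_def \<Gamma>_def sE_def sD_def by (rule norm_weighted_sum_le; simp)+
    have al: "cmod (\<Sum>i<q. bdf_alpha q i *\<^sub>R E i) \<le> A * sE" "cmod (\<Sum>i<q. bdf_alpha q i *\<^sub>R D i) \<le> A * sD"
      unfolding A_def sE_def sD_def by (rule norm_weighted_sum_le; simp)+
    have split: "(\<Sum>i=0..q. bdf_alpha q i *\<^sub>R v i) = (\<Sum>i<q. bdf_alpha q i *\<^sub>R v i) + v q" for v :: "nat \<Rightarrow> complex"
      using bdf_alpha_leading[OF assms(1)]
      by (simp add: atLeast0AtMost lessThan_Suc_atMost[symmetric])
    have gsum: "cmod gE + cmod gD \<le> \<Gamma> * (sE + sD)" using g by (simp add: algebra_simps)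
    have rG: "\<bar>r\<bar> * (cmod gE + cmod gD) \<le> (\<bar>R\<bar> * \<Gamma>) * Z"
    proof -
      have "\<bar>r\<bar> * (cmod gE + cmod gD) \<le> \<bar>R\<bar> * (\<Gamma> * (sE + sD))"
        using r gsum by (intro mult_mono) auto
      also have "\<dots> \<le> \<bar>R\<bar> * (\<Gamma> * Z)"
        using G0 by (intro mult_left_mono) (auto simp: Z_def)
      finally show ?thesis by (simp add: mult.assoc)
    qed
    have Z0: "Z \<ge> 0" "A * sE \<le> A * Z" "A * sD \<le> A * Z" "cmod \<tau> \<le> Z" "cmod \<sigma> \<le> Z"
      using s0 A0 by (auto simp: Z_def intro!: mult_left_mono)
    have hle: "cmod (h *\<^sub>R x) \<le> cmod x" for x :: complex
      using h mult_right_mono[of h 1 "cmod x"] by simp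
    have Eq: "cmod (E q) \<le> B * Z"
    proof -
      have "E q = h *\<^sub>R \<tau> - (\<Sum>i<q. bdf_alpha q i *\<^sub>R E i) - \<i> * of_real r * (of_real b * gE + gD)"
        using st unfolding imex_mode_step_def Let_def split gE_def[symmetric] gD_def[symmetric]
        by (auto simp: eq_diff_eq algebra_simps)
      then have "cmod (E q) \<le> cmod (h *\<^sub>R \<tau>) + cmod (\<Sum>i<q. bdf_alpha q i *\<^sub>R E i)
          + cmod (\<i> * of_real r * (of_real b * gE + gD))"
        by (simp only:) (rule order_trans[OF norm_triangle_ineq4 add_right_mono[OF norm_triangle_ineq4]])
      also have "cmod (\<i> * of_real r * (of_real b * gE + gD)) \<le> \<bar>r\<bar> * (cmod gE + cmod gD)"
        using cmod_combination_le[of b 1 gE gD] assms(2) by (simp add: norm_mult mult_left_mono)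
      finally show ?thesis
        using rG Z0 al(1) hle[of \<tau>] unfolding B_def distrib_right by linarith
    qed
    have Dq: "cmod (D q) \<le> B * Z"
    proof -
      have "(1 + \<eta>) *\<^sub>R D q = h *\<^sub>R \<sigma> - (\<Sum>i<q. bdf_alpha q i *\<^sub>R D i)
          - \<i> * of_real r * (of_real a * gE - of_real b * gD)"
        using st unfolding imex_mode_step_def Let_def split gE_def[symmetric] gD_def[symmetric] a_def[symmetric]
        by (auto simp: eq_diff_eq algebra_simps)
      then have "cmod ((1 + \<eta>) *\<^sub>R D q) \<le> cmod (h *\<^sub>R \<sigma>) + cmod (\<Sum>i<q. bdf_alpha q i *\<^sub>R D i)
          + cmod (\<i> * of_real r * (of_real a * gE - of_real b * gD))"
        by (simp only:) (rule order_trans[OF norm_triangle_ineq4 add_right_mono[OF norm_triangle_ineq4]])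
      also have "cmod (\<i> * of_real r * (of_real a * gE - of_real b * gD)) \<le> \<bar>r\<bar> * (cmod gE + cmod gD)"
        using cmod_combination_le[of a "- b" gE gD] assms(2) a by (simp add: norm_mult mult_left_mono)
      finally have "cmod ((1 + \<eta>) *\<^sub>R D q) \<le> B * Z"
        using rG Z0 al(2) hle[of \<sigma>] unfolding B_def distrib_right by linarith
      moreover have "cmod (D q) \<le> cmod ((1 + \<eta>) *\<^sub>R D q)"
        using \<eta> by (simp add: distrib_right)
      ultimately show ?thesis by linarith
    qed
    have Zsq: "Z\<^sup>2 \<le> (4 * real q + 4) * ((\<Sum>i<q. (cmod (E i))\<^sup>2 + (cmod (D i))\<^sup>2) + (cmod \<tau>)\<^sup>2 + (cmod \<sigma>)\<^sup>2)"
    proof -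
      have four: "(x + y + z + t)\<^sup>2 \<le> 4 * (x\<^sup>2 + y\<^sup>2 + z\<^sup>2 + t\<^sup>2)" for x y z t :: real
      proof -
        have "4 * (x\<^sup>2 + y\<^sup>2 + z\<^sup>2 + t\<^sup>2) - (x + y + z + t)\<^sup>2
            = (x - y)\<^sup>2 + (x - z)\<^sup>2 + (x - t)\<^sup>2 + (y - z)\<^sup>2 + (y - t)\<^sup>2 + (z - t)\<^sup>2"
          by algebra
        moreover have "0 \<le> (x - y)\<^sup>2 + (x - z)\<^sup>2 + (x - t)\<^sup>2 + (y - z)\<^sup>2 + (y - t)\<^sup>2 + (z - t)\<^sup>2"
          by (intro add_nonneg_nonneg) auto
        ultimately show ?thesis
          by linarith
      qed
      have f1: "Z\<^sup>2 \<le> 4 * (sE\<^sup>2 + sD\<^sup>2 + (cmod \<tau>)\<^sup>2 + (cmod \<sigma>)\<^sup>2)"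
        unfolding Z_def by (rule four)
      have f2: "sE\<^sup>2 \<le> real q * (\<Sum>i<q. (cmod (E i))\<^sup>2)" "sD\<^sup>2 \<le> real q * (\<Sum>i<q. (cmod (D i))\<^sup>2)"
        using sum_squared_le_sum_of_squares[of "\<lambda>i. cmod (E i)" "{..<q}"]
          sum_squared_le_sum_of_squares[of "\<lambda>i. cmod (D i)" "{..<q}"]
        by (simp_all add: sE_def sD_def mult.commute)
      have f3: "0 \<le> (\<Sum>i<q. (cmod (E i))\<^sup>2)" "0 \<le> (\<Sum>i<q. (cmod (D i))\<^sup>2)"
        by (auto intro: sum_nonneg)
      have f4: "0 \<le> real q * (cmod \<tau>)\<^sup>2" "0 \<le> real q * (cmod \<sigma>)\<^sup>2" by auto
      have arith: "Z' \<le> (4 * k + 4) * (x + y + t + u)"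
        if "Z' \<le> 4 * (x' + y' + t + u)" "x' \<le> k * x" "y' \<le> k * y"
          "0 \<le> x" "0 \<le> y" "0 \<le> k * t" "0 \<le> k * u" for Z' x' y' k x y t u :: real
        using that by (simp add: algebra_simps)
      show ?thesis
        unfolding sum.distrib by (rule arith[OF f1 f2 f3 f4])
    qed
    have "(cmod (E q))\<^sup>2 \<le> B\<^sup>2 * Z\<^sup>2" "(cmod (D q))\<^sup>2 \<le> B\<^sup>2 * Z\<^sup>2"
      using power_mono[OF Eq, of 2] power_mono[OF Dq, of 2] by (auto simp: power_mult_distrib)
    then have "(cmod (E q))\<^sup>2 + (cmod (D q))\<^sup>2 \<le> 2 * B\<^sup>2 * Z\<^sup>2" by simp
    also have "\<dots> \<le> 2 * B\<^sup>2 * ((4 * real q + 4) * ((\<Sum>i<q. (cmod (E i))\<^sup>2 + (cmod (D i))\<^sup>2) + (cmod \<tau>)\<^sup>2 + (cmod \<sigma>)\<^sup>2))"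
      by (intro mult_left_mono Zsq) auto
    finally show "(cmod (E q))\<^sup>2 + (cmod (D q))\<^sup>2
      \<le> 2 * B\<^sup>2 * (4 * real q + 4) * ((\<Sum>i<q. (cmod (E i))\<^sup>2 + (cmod (D i))\<^sup>2) + (cmod \<tau>)\<^sup>2 + (cmod \<sigma>)\<^sup>2)"
      by (simp only: mult.assoc)
  qed
qed

text \<open>
  The last term collects the telescoping contribution of the stiff implicit term.
\<close>
definition mode_energy :: "nat \<Rightarrow> real \<Rightarrow> real \<Rightarrow> (nat \<Rightarrow> complex) \<Rightarrow> (nat \<Rightarrow> complex) \<Rightarrow> real" where
  "mode_energy q b \<eta> E D =
     (1 - b\<^sup>2) * bdf_energy q E + bdf_energy q D + \<eta> / 4 * (cmod (D (q - 1)))\<^sup>2"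

lemma mode_energy_coercive:
  assumes "q \<in> {1, 2, 3, 4}" "\<bar>b\<bar> < 1" "0 \<le> \<eta>"
  shows "(1 - b\<^sup>2) / 1000 * (\<Sum>i<q. (cmod (E i))\<^sup>2 + (cmod (D i))\<^sup>2) \<le> mode_energy q b \<eta> E D"
proof -
  have a: "0 < 1 - b\<^sup>2" "1 - b\<^sup>2 \<le> 1" using assms(2) by (auto simp: abs_square_less_1)
  define sE sD where "sE = (\<Sum>i<q. (cmod (E i))\<^sup>2)" and "sD = (\<Sum>i<q. (cmod (D i))\<^sup>2)"
  have "0 \<le> sD" by (auto simp: sD_def intro: sum_nonneg)
  then have "(1 - b\<^sup>2) * sD \<le> sD" using a mult_right_mono[of "1 - b\<^sup>2" 1 sD] by simp
  moreover have "(1 - b\<^sup>2) * (1/1000 * sE) \<le> (1 - b\<^sup>2) * bdf_energy q E" "1/1000 * sD \<le> bdf_energy q D"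
    using bdf_energy_coercive[OF assms(1)] a by (auto simp: sE_def sD_def intro!: mult_left_mono)
  moreover have "0 \<le> \<eta> / 4 * (cmod (D (q - 1)))\<^sup>2" using assms(3) by simp
  ultimately have "(1 - b\<^sup>2) / 1000 * (sE + sD) \<le> mode_energy q b \<eta> E D"
    unfolding mode_energy_def by (simp add: distrib_left)
  then show ?thesis by (simp add: sum.distrib sE_def sD_def)
qed

lemma young_mult: "0 < l \<Longrightarrow> r * (x * y) \<le> l * x\<^sup>2 + r\<^sup>2 * y\<^sup>2 / (4 * l)" for l r x y :: real
proof -
  assume "0 < l"
  have "l * x\<^sup>2 + r\<^sup>2 * y\<^sup>2 / (4 * l) - r * (x * y) = l * (x - r * y / (2 * l))\<^sup>2"
    using \<open>0 < l\<close> by (simp add: power2_eq_square field_simps)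
  moreover have "0 \<le> l * (x - r * y / (2 * l))\<^sup>2" using \<open>0 < l\<close> by simp
  ultimately show ?thesis by linarith
qed

lemma power2_add_le: "(x + y)\<^sup>2 \<le> 2 * (x\<^sup>2 + y\<^sup>2)" for x y :: real
  using sum_squares_bound[of x y] by (simp add: power2_sum)

text \<open>
  The explicit terms are of size \<open>\<bar>r\<bar> = O(h\<^sup>1\<^sup>/\<^sup>2)\<close> only. Paired with the dissipation of the differences
  they cost \<open>r\<^sup>2 = O(h)\<close>, which is what makes the growth per step \<open>1 + O(h)\<close>.
\<close>
lemma mode_energy_step:
  assumes "q \<in> {1, 2, 3, 4}" "\<bar>b\<bar> < 1" "0 \<le> c"
  obtains C where "C \<ge> 0"
    "\<And>r \<eta> h E D \<tau> \<sigma>. \<lbrakk>r\<^sup>2 \<le> c * h; 0 \<le> \<eta>; 0 < h; h \<le> 1; imex_mode_step q b r \<eta> h E D \<tau> \<sigma>\<rbrakk> \<Longrightarrow>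
      mode_energy q b \<eta> (\<lambda>i. E (i + 1)) (\<lambda>i. D (i + 1))
        \<le> (1 + C * h) * mode_energy q b \<eta> E D + C * h * ((cmod \<tau>)\<^sup>2 + (cmod \<sigma>)\<^sup>2)"
proof -
  note q = assms(1)
  have q1: "q - 1 + 1 = q" using q by auto
  have b: "\<bar>b\<bar> \<le> 1" using assms by simp
  define a where "a = 1 - b\<^sup>2"
  have a: "0 < a" "a \<le> 1" using assms(2) by (auto simp: a_def abs_square_less_1)
  obtain L where L: "L > 0" "\<And>v :: nat \<Rightarrow> complex.
    (cmod ((\<Sum>i<q. bdf_gamma q i *\<^sub>R v i) - 2 * bdf_beta q * bdf_multiplier q v))\<^sup>2
      \<le> L * (\<Sum>i<q. (cmod (v (i + 1) - v i))\<^sup>2)"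
    using bdf_extrapolation_defect[OF q] by blast
  define R where "R = 1 + c"
  obtain M where M: "M \<ge> 0" "\<And>r \<eta> h E D \<tau> \<sigma>. \<lbrakk>\<bar>r\<bar> \<le> R; 0 \<le> \<eta>; 0 < h; h \<le> 1; imex_mode_step q b r \<eta> h E D \<tau> \<sigma>\<rbrakk> \<Longrightarrow>
      (cmod (E q))\<^sup>2 + (cmod (D q))\<^sup>2
        \<le> M * ((\<Sum>i<q. (cmod (E i))\<^sup>2 + (cmod (D i))\<^sup>2) + (cmod \<tau>)\<^sup>2 + (cmod \<sigma>)\<^sup>2)"
    using new_level_bound[OF q b, where R=R] by blast
  \<comment> \<open>The weight in Young's inequality: the squared sum of the defects is at most \<open>2 L\<close> times the sum
      of the squared differences, and \<open>2 L l = a / 250\<close> does not exceed the available dissipation.\<close>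
  define l where "l = a / (500 * L)"
  have l: "l > 0" using a L by (simp add: l_def)
  \<comment> \<open>Bounds what Young and the source terms leave, in units of \<open>h\<close> times the squared multipliers.\<close>
  define P where "P = c / (2 * l) + 1"
  have P: "P \<ge> 1" using l assms(3) by (simp add: P_def)
  define N where "N = 2 * (M + 1)"
  have N: "N \<ge> 2" using M by (simp add: N_def)
  define C where "C = P * N * (1000 / a) + P * N + 1"
  have C: "C \<ge> 0" "P * N * (1000 / a) \<le> C" "P * N + 1 \<le> C" using P N a by (auto simp: C_def)
  show ?thesis
  proof
    show "C \<ge> 0" by (rule C)
    fix r \<eta> h :: real and E D :: "nat \<Rightarrow> complex" and \<tau> \<sigma> :: complex
    assume r: "r\<^sup>2 \<le> c * h" and \<eta>: "0 \<le> \<eta>" and h: "0 < h" "h \<le> 1"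
      and st: "imex_mode_step q b r \<eta> h E D \<tau> \<sigma>"
    define mE mD where "mE = bdf_multiplier q E" and "mD = bdf_multiplier q D"
    define gE gD where "gE = (\<Sum>i<q. bdf_gamma q i *\<^sub>R E i)" and "gD = (\<Sum>i<q. bdf_gamma q i *\<^sub>R D i)"
    define dE dD where "dE = gE - 2 * bdf_beta q * mE" and "dD = gD - 2 * bdf_beta q * mD"
    define aE aD where "aE = (\<Sum>i=0..q. bdf_alpha q i *\<^sub>R E i)" and "aD = (\<Sum>i=0..q. bdf_alpha q i *\<^sub>R D i)"
    define SE SD where "SE = (\<Sum>i<q. (cmod (E (i + 1) - E i))\<^sup>2)" and "SD = (\<Sum>i<q. (cmod (D (i + 1) - D i))\<^sup>2)"
    define W where "W = (\<Sum>i<q. (cmod (E i))\<^sup>2 + (cmod (D i))\<^sup>2)"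
    define t where "t = (cmod \<tau>)\<^sup>2 + (cmod \<sigma>)\<^sup>2"
    define Q where "Q = (cmod mE)\<^sup>2 + (cmod mD)\<^sup>2"
    define F F' where "F = mode_energy q b \<eta> E D" and "F' = mode_energy q b \<eta> (\<lambda>i. E (i + 1)) (\<lambda>i. D (i + 1))"
    have nn: "SE \<ge> 0" "SD \<ge> 0" "W \<ge> 0" "t \<ge> 0" "Q \<ge> 0"
      by (auto simp: SE_def SD_def W_def t_def Q_def intro!: sum_nonneg)
    have eqE: "aE = h *\<^sub>R \<tau> - \<i> * of_real r * (of_real b * gE + gD)"
      and eqD: "aD + \<eta> *\<^sub>R D q = h *\<^sub>R \<sigma> - \<i> * of_real r * (of_real a * gE - of_real b * gD)"
      using st unfolding imex_mode_step_def Let_def aE_def[symmetric] aD_def[symmetric]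
        gE_def[symmetric] gD_def[symmetric] a_def[symmetric]
      by (auto simp: eq_diff_eq algebra_simps)
    have dis: "F' - F + 1/250 * (a * SE + SD) \<le> a * Re (aE * cnj mE) + Re (aD * cnj mD) + Re (\<eta> *\<^sub>R D q * cnj mD)"
    proof -
      have "a * (bdf_energy q (\<lambda>i. E (i + 1)) - bdf_energy q E + 1/250 * SE) \<le> a * Re (aE * cnj mE)"
        using bdf_energy_decay[OF q, of E] a unfolding SE_def aE_def mE_def by (intro mult_left_mono) auto
      moreover have "bdf_energy q (\<lambda>i. D (i + 1)) - bdf_energy q D + 1/250 * SD \<le> Re (aD * cnj mD)"
        using bdf_energy_decay[OF q, of D] unfolding SD_def aD_def mD_def .
      moreover have "\<eta> / 4 * ((cmod (D q))\<^sup>2 - (cmod (D (q - 1)))\<^sup>2) \<le> Re (\<eta> *\<^sub>R D q * cnj mD)"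
        unfolding mD_def by (rule relaxation_multiplier_bound[OF \<eta>])
      moreover have "(a * x' + y' + z') - (a * x + y + z) + 1/250 * (a * u + v) \<le> p + p' + p''"
        if "a * (x' - x + 1/250 * u) \<le> p" "y' - y + 1/250 * v \<le> p'" "z' - z \<le> p''"
        for x x' y y' z z' u v p p' p'' :: real
        using that by (simp add: algebra_simps add_divide_distrib)
      ultimately show ?thesis
        unfolding F_def F'_def mode_energy_def q1 a_def[symmetric] by (simp only: right_diff_distrib)
    qed
    also have "a * Re (aE * cnj mE) + Re (aD * cnj mD) + Re (\<eta> *\<^sub>R D q * cnj mD)
        = a * Re (aE * cnj mE) + Re ((aD + \<eta> *\<^sub>R D q) * cnj mD)"
      by (simp add: algebra_simps)
    also have "\<dots> = h * (a * Re (\<tau> * cnj mE) + Re (\<sigma> * cnj mD))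
        + - Re (\<i> * of_real r * (of_real a * (of_real b * gE + gD) * cnj mE
          + (of_real a * gE - of_real b * gD) * cnj mD))"
      unfolding eqE eqD
    proof -
      have "a * Re ((h *\<^sub>R t - \<i> * of_real r * p) * m) + Re ((h *\<^sub>R s - \<i> * of_real r * p') * m')
          = h * (a * Re (t * m) + Re (s * m')) + - Re (\<i> * of_real r * (of_real a * p * m + p' * m'))"
        for s t p p' m m' :: complex
        by (simp add: algebra_simps)
      then show "a * Re ((h *\<^sub>R \<tau> - \<i> * of_real r * (of_real b * gE + gD)) * cnj mE)
          + Re ((h *\<^sub>R \<sigma> - \<i> * of_real r * (of_real a * gE - of_real b * gD)) * cnj mD)
        = h * (a * Re (\<tau> * cnj mE) + Re (\<sigma> * cnj mD))
          + - Re (\<i> * of_real r * (of_real a * (of_real b * gE + gD) * cnj mE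
          + (of_real a * gE - of_real b * gD) * cnj mD))" .
    qed
    also have "\<dots> \<le> h * (t / 2 + Q / 2) + (1/250 * (a * SE + SD) + h * (P - 1) * Q)"
    proof (rule add_mono)
      have re: "Re (x * cnj y) \<le> ((cmod x)\<^sup>2 + (cmod y)\<^sup>2) / 2" for x y
      proof -
        have "Re (x * cnj y) \<le> cmod x * cmod y" using complex_Re_le_cmod[of "x * cnj y"] by (simp add: norm_mult)
        then show ?thesis using sum_squares_bound[of "cmod x" "cmod y"] by simp
      qed
      have "a * Re (\<tau> * cnj mE) \<le> 1 * (((cmod \<tau>)\<^sup>2 + (cmod mE)\<^sup>2) / 2)"
        by (rule order_trans[OF mult_left_mono[OF re] mult_right_mono]) (use a in auto)
      then show "h * (a * Re (\<tau> * cnj mE) + Re (\<sigma> * cnj mD)) \<le> h * (t / 2 + Q / 2)"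
        using re[of \<sigma> mD] h by (intro mult_left_mono) (auto simp: t_def Q_def field_simps)
      have "- Re (\<i> * of_real r * (of_real a * (of_real b * gE + gD) * cnj mE
          + (of_real a * gE - of_real b * gD) * cnj mD))
          \<le> \<bar>r\<bar> * ((cmod dE + cmod dD) * (cmod mE + cmod mD))"
        by (rule coupling_bound[OF _ a(2) b, where \<beta> = "bdf_beta q"]) (use a in \<open>auto simp: dE_def dD_def\<close>)
      also have "\<dots> \<le> l * (cmod dE + cmod dD)\<^sup>2 + \<bar>r\<bar>\<^sup>2 * (cmod mE + cmod mD)\<^sup>2 / (4 * l)"
        by (rule young_mult[OF l])
      also have "\<dots> \<le> 1/250 * (a * SE + SD) + h * (P - 1) * Q"
      proof (rule add_mono)
        have "l * (cmod dE + cmod dD)\<^sup>2 \<le> l * (2 * (L * SE + L * SD))"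
          using L(2)[of E] L(2)[of D] power2_add_le[of "cmod dE" "cmod dD"] l
          by (intro mult_left_mono) (auto simp: dE_def dD_def gE_def gD_def mE_def mD_def SE_def SD_def)
        also have "\<dots> = 1/250 * (a * SE + a * SD)"
          using L(1) by (simp add: l_def field_simps)
        also have "\<dots> \<le> 1/250 * (a * SE + SD)"
          using mult_right_mono[OF a(2) nn(2)] by simp
        finally show "l * (cmod dE + cmod dD)\<^sup>2 \<le> 1/250 * (a * SE + SD)" .
        have "\<bar>r\<bar>\<^sup>2 * (cmod mE + cmod mD)\<^sup>2 \<le> (c * h) * (2 * Q)"
          using r power2_add_le[of "cmod mE" "cmod mD"] assms(3) h by (intro mult_mono) (auto simp: Q_def)
        then have "\<bar>r\<bar>\<^sup>2 * (cmod mE + cmod mD)\<^sup>2 / (4 * l) \<le> (c * h) * (2 * Q) / (4 * l)"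
          using l by (intro divide_right_mono) auto
        also have "\<dots> = h * (P - 1) * Q" by (simp add: P_def)
        finally show "\<bar>r\<bar>\<^sup>2 * (cmod mE + cmod mD)\<^sup>2 / (4 * l) \<le> h * (P - 1) * Q" .
      qed
      finally show "- Re (\<i> * of_real r * (of_real a * (of_real b * gE + gD) * cnj mE
          + (of_real a * gE - of_real b * gD) * cnj mD))
          \<le> 1/250 * (a * SE + SD) + h * (P - 1) * Q" .
    qed
    finally have "F' - F \<le> h * (t / 2 + Q / 2) + h * (P - 1) * Q" by simp
    also have "\<dots> \<le> h * (t + P * Q)"
    proof -
      have "h * (t / 2 + Q / 2) + h * (P - 1) * Q = h * (t + P * Q) - h * (t / 2 + Q / 2)"
        by (simp add: field_simps)
      moreover have "0 \<le> h * (t / 2 + Q / 2)" using nn h by simp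
      ultimately show ?thesis by linarith
    qed
    finally have main: "F' \<le> F + h * (t + P * Q)" by simp
    \<comment> \<open>The multipliers contain the new level, which is bounded by the old levels and the residuals.\<close>
    have Q: "Q \<le> N * (W + t)"
    proof -
      have mb: "(cmod (bdf_multiplier q v))\<^sup>2 \<le> 2 * ((cmod (v q))\<^sup>2 + (cmod (v (q - 1)))\<^sup>2)" for v
      proof -
        have "cmod (bdf_multiplier q v) \<le> cmod (v q) + cmod (v (q - 1)) / 2"
          unfolding bdf_multiplier_def by (rule order_trans[OF norm_triangle_ineq4]) (simp add: norm_divide)
        also have "\<dots> \<le> cmod (v q) + cmod (v (q - 1))" by simp
        finally have "(cmod (bdf_multiplier q v))\<^sup>2 \<le> (cmod (v q) + cmod (v (q - 1)))\<^sup>2"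
          by (intro power_mono) auto
        then show ?thesis using power2_add_le[of "cmod (v q)" "cmod (v (q - 1))"] by linarith
      qed
      have "(cmod (E (q - 1)))\<^sup>2 + (cmod (D (q - 1)))\<^sup>2 \<le> W"
        unfolding W_def using q1 by (intro member_le_sum[of "q - 1" "{..<q}" "\<lambda>i. (cmod (E i))\<^sup>2 + (cmod (D i))\<^sup>2"]) auto
      moreover have "(cmod (E q))\<^sup>2 + (cmod (D q))\<^sup>2 \<le> M * (W + t)"
      proof -
        have "\<bar>r\<bar> \<le> R"
        proof -
          have "\<bar>r\<bar>\<^sup>2 \<le> c * h" using r by simp
          also have "\<dots> \<le> c * 1" using h assms(3) by (intro mult_left_mono) auto
          also have "\<dots> \<le> R\<^sup>2" using assms(3) by (simp add: R_def power2_eq_square algebra_simps)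
          finally have "\<bar>r\<bar> \<le> \<bar>R\<bar>" by (simp add: abs_le_square_iff)
          then show ?thesis using assms(3) by (simp add: R_def)
        qed
        then show ?thesis using M(2)[OF _ \<eta> h st] by (simp add: W_def t_def add.assoc)
      qed
      moreover have "x + y \<le> 2 * (m + w)"
        if "x' + y' \<le> w" "x'' + y'' \<le> m" "x \<le> 2 * (x'' + x')" "y \<le> 2 * (y'' + y')"
        for x x' x'' y y' y'' m w :: real
        using that by simp
      ultimately have "Q \<le> 2 * (M * (W + t) + W)"
        using mb[of E] mb[of D] unfolding Q_def mE_def mD_def by blast
      also have "\<dots> \<le> N * (W + t)" using nn by (simp add: N_def algebra_simps)
      finally show ?thesis .
    qed
    have coer: "a / 1000 * W \<le> F"
      unfolding a_def W_def F_def by (rule mode_energy_coercive[OF q assms(2) \<eta>])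
    have W: "W \<le> 1000 / a * F"
      using mult_left_mono[OF coer, of "1000 / a"] a by simp
    have F0: "F \<ge> 0"
      by (rule order_trans[OF _ coer]) (use nn a in simp)
    have "P * Q \<le> P * (N * (W + t))"
      using Q P by (intro mult_left_mono) auto
    then have "P * Q \<le> P * N * W + P * N * t"
      by (simp add: algebra_simps)
    also have "P * N * W \<le> P * N * (1000 / a * F)"
      using W P N by (intro mult_left_mono) auto
    also have "\<dots> \<le> C * F" using mult_right_mono[OF C(2) F0] by (simp only: mult.assoc)
    finally have PQ: "P * Q \<le> C * F + P * N * t" by simp
    have "h * (t + P * Q) \<le> h * (C * F + C * t)"
    proof (rule mult_left_mono)
      have "t + P * N * t \<le> C * t" using mult_right_mono[OF C(3) nn(4)] by (simp add: algebra_simps)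
      then show "t + P * Q \<le> C * F + C * t" using PQ by simp
    qed (use h in simp)
    then show "F' \<le> (1 + C * h) * F + C * h * t"
      using main by (simp add: algebra_simps)
  qed
qed

text \<open>
  The first \<open>q\<close> levels vanish because the starting values are projections of the exact solution.
\<close>
theorem imex_mode_stability:
  assumes "q \<in> {1, 2, 3, 4}" "\<bar>b\<bar> < 1" "0 \<le> c"
  obtains C where "C \<ge> 0"
    "\<And>r \<eta> h e d \<tau> \<sigma> \<rho> n. \<lbrakk>r\<^sup>2 \<le> c * h; 0 \<le> \<eta>; 0 < h; h \<le> 1; \<And>i. i < q \<Longrightarrow> e i = 0 \<and> d i = 0;
      \<And>n. imex_mode_step q b r \<eta> h (\<lambda>i. e (n + i)) (\<lambda>i. d (n + i)) (\<tau> n) (\<sigma> n);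
      \<And>n. (cmod (\<tau> n))\<^sup>2 + (cmod (\<sigma> n))\<^sup>2 \<le> \<rho>\<rbrakk> \<Longrightarrow>
      (cmod (e n))\<^sup>2 + (cmod (d n))\<^sup>2 \<le> C * exp (C * (h * real n)) * \<rho>"
proof -
  define a where "a = 1 - b\<^sup>2"
  have a: "0 < a" "a \<le> 1" using assms(2) by (auto simp: a_def abs_square_less_1)
  obtain C where C: "C \<ge> 0"
    "\<And>r \<eta> h E D \<tau> \<sigma>. \<lbrakk>r\<^sup>2 \<le> c * h; 0 \<le> \<eta>; 0 < h; h \<le> 1; imex_mode_step q b r \<eta> h E D \<tau> \<sigma>\<rbrakk> \<Longrightarrow>
      mode_energy q b \<eta> (\<lambda>i. E (i + 1)) (\<lambda>i. D (i + 1))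
        \<le> (1 + C * h) * mode_energy q b \<eta> E D + C * h * ((cmod \<tau>)\<^sup>2 + (cmod \<sigma>)\<^sup>2)"
    using mode_energy_step[OF assms] by blast
  define K where "K = C + 1000 / a"
  have K: "K \<ge> 0" "C \<le> K" "1000 / a \<le> K" using C a by (auto simp: K_def)
  show ?thesis
  proof
    show "K \<ge> 0" by (rule K)
    fix r \<eta> h :: real and e d \<tau> \<sigma> :: "nat \<Rightarrow> complex" and \<rho> :: real and n :: nat
    assume r: "r\<^sup>2 \<le> c * h" and \<eta>: "0 \<le> \<eta>" and h: "0 < h" "h \<le> 1"
      and z: "\<And>i. i < q \<Longrightarrow> e i = 0 \<and> d i = 0"
      and st: "\<And>n. imex_mode_step q b r \<eta> h (\<lambda>i. e (n + i)) (\<lambda>i. d (n + i)) (\<tau> n) (\<sigma> n)"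
      and \<rho>: "\<And>n. (cmod (\<tau> n))\<^sup>2 + (cmod (\<sigma> n))\<^sup>2 \<le> \<rho>"
    have \<rho>0: "\<rho> \<ge> 0" using order_trans[OF _ \<rho>[of 0], of 0] by simp
    define F where "F = (\<lambda>n. mode_energy q b \<eta> (\<lambda>i. e (n + i)) (\<lambda>i. d (n + i)))"
    have F0: "F 0 = 0"
    proof -
      have ly: "bdf_lyapunov q v = 0" if "\<And>i. i < q \<Longrightarrow> v i = 0" for v
        using that assms(1) by (auto simp: bdf_lyapunov_def)
      have "bdf_energy q e = 0" "bdf_energy q d = 0"
        by (simp_all add: bdf_energy_def ly z)
      moreover have "d (q - 1) = 0" using z[of "q - 1"] assms(1) by auto
      ultimately show ?thesis by (simp add: F_def mode_energy_def)
    qed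
    have step: "F (Suc n) \<le> (1 + C * h) * F n + C * h * \<rho>" for n
    proof -
      have "F (Suc n) \<le> (1 + C * h) * F n + C * h * ((cmod (\<tau> n))\<^sup>2 + (cmod (\<sigma> n))\<^sup>2)"
        using C(2)[OF r \<eta> h st[of n]] by (simp add: F_def)
      also have "\<dots> \<le> (1 + C * h) * F n + C * h * \<rho>"
        using C(1) h \<rho> by (intro add_left_mono mult_left_mono) auto
      finally show ?thesis .
    qed
    \<comment> \<open>Adding \<open>\<rho>\<close> turns the step estimate into a homogeneous recursion.\<close>
    have bnd: "F n + \<rho> \<le> (1 + C * h) ^ n * \<rho>" for n
    proof (induction n)
      case (Suc n)
      have "F (Suc n) + \<rho> \<le> (1 + C * h) * (F n + \<rho>)" using step[of n] by (simp add: algebra_simps)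
      also have "\<dots> \<le> (1 + C * h) * ((1 + C * h) ^ n * \<rho>)"
        using C(1) h by (intro mult_left_mono Suc.IH) auto
      finally show ?case by (simp add: mult.assoc)
    qed (simp add: F0)
    have "(1 + C * h) ^ n \<le> exp (C * h) ^ n"
      using C(1) h by (intro power_mono) auto
    also have "exp (C * h) ^ n = exp (C * (h * real n))"
      by (simp add: exp_of_nat_mult[symmetric] algebra_simps)
    also have "\<dots> \<le> exp (K * (h * real n))"
      using K h by (simp add: mult_right_mono)
    finally have growth: "(1 + C * h) ^ n \<le> exp (K * (h * real n))" .
    have "(cmod (e n))\<^sup>2 + (cmod (d n))\<^sup>2 \<le> (\<Sum>i<q. (cmod (e (n + i)))\<^sup>2 + (cmod (d (n + i)))\<^sup>2)"
      using member_le_sum[of 0 "{..<q}" "\<lambda>i. (cmod (e (n + i)))\<^sup>2 + (cmod (d (n + i)))\<^sup>2"] assms(1) by auto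
    also have "\<dots> \<le> 1000 / a * F n"
      using mult_left_mono[OF mode_energy_coercive[OF assms(1,2) \<eta>, of "\<lambda>i. e (n + i)" "\<lambda>i. d (n + i)"], of "1000 / a"] a
      by (simp add: F_def a_def[symmetric])
    also have "\<dots> \<le> 1000 / a * ((1 + C * h) ^ n * \<rho>)"
      using bnd[of n] \<rho>0 a by (intro mult_left_mono) auto
    also have "\<dots> \<le> 1000 / a * (exp (K * (h * real n)) * \<rho>)"
      using a \<rho>0 growth by (intro mult_left_mono mult_right_mono) auto
    also have "\<dots> \<le> K * (exp (K * (h * real n)) * \<rho>)"
      using K \<rho>0 by (intro mult_right_mono) auto
    finally show "(cmod (e n))\<^sup>2 + (cmod (d n))\<^sup>2 \<le> K * exp (K * (h * real n)) * \<rho>"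
      by (simp add: mult.assoc)
  qed
qed

section \<open>Truncation errors of the BDF operator and of the extrapolation\<close>

lemma taylor_bound:
  fixes Y :: "nat \<Rightarrow> real \<Rightarrow> 'a :: banach"
  assumes Y: "\<And>j t. j < m \<Longrightarrow> 0 \<le> t \<Longrightarrow> (Y j has_vector_derivative Y (Suc j) t) (at t within {0..})"
    and bound: "\<And>r. r \<ge> t \<Longrightarrow> norm (Y m r) \<le> M"
    and "0 < m" "0 \<le> t" "0 \<le> s"
  shows "norm (Y 0 (t + s) - (\<Sum>j<m. (s ^ j / fact j) *\<^sub>R Y j t)) \<le> M * s ^ m"
proof -
  define f where "f = (\<lambda>r. ((t + s - r) ^ (m - 1) / fact (m - 1)) *\<^sub>R Y m r)"
  have der: "(Y j has_vector_derivative Y (Suc j) r) (at r within {t..t + s})"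
    if "j < m" "t \<le> r" "r \<le> t + s" for j r
    using has_vector_derivative_within_subset[OF Y[of j r], of "{t..t + s}"] that assms(4) by auto
  have "(f has_integral Y 0 (t + s) - (\<Sum>j<m. ((t + s - t) ^ j / fact j) *\<^sub>R Y j t)) {t..t + s}"
    unfolding f_def by (rule Taylor_has_integral[where Df = Y and f = "Y 0"]) (use der \<open>0 < m\<close> \<open>0 \<le> s\<close> in auto)
  then have int: "(f has_integral Y 0 (t + s) - (\<Sum>j<m. (s ^ j / fact j) *\<^sub>R Y j t)) (cbox t (t + s))"
    by simp
  have M0: "0 \<le> M" using order_trans[OF norm_ge_zero bound[of t]] by simp
  have "norm (Y 0 (t + s) - (\<Sum>j<m. (s ^ j / fact j) *\<^sub>R Y j t)) \<le> (s ^ (m - 1) * M) * measure lborel (cbox t (t + s))"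
  proof (rule has_integral_bound[OF _ int])
    fix r assume "r \<in> cbox t (t + s)"
    then have r: "t \<le> r" "r \<le> t + s" by auto
    have "(t + s - r) ^ (m - 1) / fact (m - 1) \<le> s ^ (m - 1) / 1"
      using r by (intro frac_le power_mono) (auto simp: fact_ge_1)
    then have "(t + s - r) ^ (m - 1) / fact (m - 1) * norm (Y m r) \<le> s ^ (m - 1) * M"
      using r bound[of r] \<open>0 \<le> s\<close> by (intro mult_mono) auto
    then show "norm (f r) \<le> s ^ (m - 1) * M"
      using r by (simp add: f_def abs_mult)
  qed (use M0 \<open>0 \<le> s\<close> in auto)
  also have "\<dots> = M * s ^ m"
    using \<open>0 < m\<close> \<open>0 \<le> s\<close> by (cases m) auto
  finally show ?thesis .
qed

lemma norm_weighted_sum_bound: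
  fixes v :: "'i \<Rightarrow> 'a :: real_normed_vector"
  assumes "\<And>i. i \<in> I \<Longrightarrow> norm (v i) \<le> B"
  shows "norm (\<Sum>i\<in>I. a i *\<^sub>R v i) \<le> (\<Sum>i\<in>I. \<bar>a i\<bar>) * B"
proof -
  have "norm (\<Sum>i\<in>I. a i *\<^sub>R v i) \<le> (\<Sum>i\<in>I. \<bar>a i\<bar> * B)"
    by (rule sum_norm_le) (simp add: assms mult_left_mono)
  then show ?thesis by (simp add: sum_distrib_right)
qed

text \<open>
  The order conditions make the BDF operator exact on the Taylor polynomial of degree \<open>q\<close>, so only
  Taylor remainders are left.
\<close>
lemma bdf_derivative_truncation:
  assumes "q \<in> {1, 2, 3, 4}"
  obtains C where "C \<ge> 0"
    "\<And>(Y :: nat \<Rightarrow> real \<Rightarrow> complex) t h M.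
      \<lbrakk>\<And>j t. 0 \<le> t \<Longrightarrow> (Y j has_vector_derivative Y (Suc j) t) (at t within {0..});
       \<And>r. r \<ge> t \<Longrightarrow> cmod (Y (q + 1) r) \<le> M; 0 \<le> t; 0 \<le> h\<rbrakk> \<Longrightarrow>
      cmod ((\<Sum>i=0..q. bdf_alpha q i *\<^sub>R Y 0 (t + real i * h)) - (bdf_beta q * h) *\<^sub>R Y 1 (t + real q * h))
        \<le> C * (h ^ (q + 1) * M)"
proof -
  have q: "q > 0" and b0: "bdf_beta q > 0" using assms bdf_beta_pos by auto
  define C where "C = (\<Sum>i=0..q. \<bar>bdf_alpha q i\<bar>) * real q ^ (q + 1) + bdf_beta q * real q ^ q"
  show ?thesis
  proof
    show "C \<ge> 0" using b0 by (auto simp: C_def intro!: add_nonneg_nonneg mult_nonneg_nonneg sum_nonneg)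
    fix Y :: "nat \<Rightarrow> real \<Rightarrow> complex" and t h M :: real
    assume Y: "\<And>j t. 0 \<le> t \<Longrightarrow> (Y j has_vector_derivative Y (Suc j) t) (at t within {0..})"
      and M: "\<And>r. r \<ge> t \<Longrightarrow> cmod (Y (q + 1) r) \<le> M" and t: "0 \<le> t" and h: "0 \<le> h"
    have M0: "0 \<le> M" using order_trans[OF norm_ge_zero M[of t]] by simp
    define R where "R = (\<lambda>i. Y 0 (t + real i * h) - (\<Sum>j<q + 1. ((real i * h) ^ j / fact j) *\<^sub>R Y j t))"
    define R' where "R' = Y 1 (t + real q * h) - (\<Sum>j<q. ((real q * h) ^ j / fact j) *\<^sub>R Y (Suc j) t)"
    have R: "cmod (R i) \<le> M * (real q * h) ^ (q + 1)" if "i \<le> q" for i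
    proof -
      have "cmod (R i) \<le> M * (real i * h) ^ (q + 1)"
        unfolding R_def by (rule taylor_bound[OF Y M]) (use t h in auto)
      also have "\<dots> \<le> M * (real q * h) ^ (q + 1)"
        using that h M0 by (intro mult_left_mono power_mono mult_right_mono) auto
      finally show ?thesis .
    qed
    have R': "cmod R' \<le> M * (real q * h) ^ q"
      unfolding R'_def using taylor_bound[of q "\<lambda>j. Y (Suc j)" t M "real q * h"] Y M t h q by auto
    have "(\<Sum>i=0..q. bdf_alpha q i *\<^sub>R (\<Sum>j<q + 1. ((real i * h) ^ j / fact j) *\<^sub>R Y j t))
        = (\<Sum>j<q + 1. (\<Sum>i=0..q. bdf_alpha q i *\<^sub>R ((real i * h) ^ j / fact j) *\<^sub>R Y j t))"
      unfolding scaleR_sum_right by (rule sum.swap)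
    also have "\<dots> = (\<Sum>j<q + 1. (h ^ j / fact j * (\<Sum>i=0..q. bdf_alpha q i * real i ^ j)) *\<^sub>R Y j t)"
      by (intro sum.cong refl) (simp add: sum_distrib_left scaleR_sum_left power_mult_distrib mult_ac)
    also have "\<dots> = (\<Sum>j<q + 1. (h ^ j / fact j * (bdf_beta q * (real j * real q ^ (j - 1)))) *\<^sub>R Y j t)"
      by (intro sum.cong refl) (simp add: bdf_alpha_order[OF assms])
    also have "\<dots> = (\<Sum>j<q. (h ^ (Suc j) / fact (Suc j) * (bdf_beta q * (real (Suc j) * real q ^ j))) *\<^sub>R Y (Suc j) t)"
      by (simp only: Suc_eq_plus1[symmetric] sum.lessThan_Suc_shift) simp
    also have "\<dots> = (bdf_beta q * h) *\<^sub>R (\<Sum>j<q. ((real q * h) ^ j / fact j) *\<^sub>R Y (Suc j) t)"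
      unfolding scaleR_sum_right
      by (intro sum.cong refl) (simp add: power_mult_distrib field_simps del: of_nat_Suc)
    finally have poly: "(\<Sum>i=0..q. bdf_alpha q i *\<^sub>R (\<Sum>j<q + 1. ((real i * h) ^ j / fact j) *\<^sub>R Y j t))
      = (bdf_beta q * h) *\<^sub>R (\<Sum>j<q. ((real q * h) ^ j / fact j) *\<^sub>R Y (Suc j) t)" .
    have "(\<Sum>i=0..q. bdf_alpha q i *\<^sub>R Y 0 (t + real i * h)) - (bdf_beta q * h) *\<^sub>R Y 1 (t + real q * h)
        = (\<Sum>i=0..q. bdf_alpha q i *\<^sub>R R i) - (bdf_beta q * h) *\<^sub>R R'"
      using poly by (simp add: R_def R'_def scaleR_diff_right sum_subtractf del: sum.lessThan_Suc)
    also have "cmod \<dots> \<le> (\<Sum>i=0..q. \<bar>bdf_alpha q i\<bar>) * (M * (real q * h) ^ (q + 1)) + bdf_beta q * h * (M * (real q * h) ^ q)"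
    proof (rule order_trans[OF norm_triangle_ineq4 add_mono])
      show "cmod (\<Sum>i=0..q. bdf_alpha q i *\<^sub>R R i) \<le> (\<Sum>i=0..q. \<bar>bdf_alpha q i\<bar>) * (M * (real q * h) ^ (q + 1))"
        by (rule norm_weighted_sum_bound) (use R in auto)
      show "cmod ((bdf_beta q * h) *\<^sub>R R') \<le> bdf_beta q * h * (M * (real q * h) ^ q)"
        using mult_left_mono[OF R', of "bdf_beta q * h"] b0 h by simp
    qed
    also have "\<dots> = C * (h ^ (q + 1) * M)"
      by (simp add: C_def power_mult_distrib algebra_simps)
    finally show "cmod ((\<Sum>i=0..q. bdf_alpha q i *\<^sub>R Y 0 (t + real i * h)) - (bdf_beta q * h) *\<^sub>R Y 1 (t + real q * h))
        \<le> C * (h ^ (q + 1) * M)" .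
  qed
qed

text \<open>
  The extrapolation is exact only up to degree \<open>q - 1\<close>. This is why the consistency error involves
  \<open>k\<close> times the \<open>q\<close>-th derivatives besides the derivatives of order \<open>q + 1\<close>.
\<close>
lemma bdf_extrapolation_truncation:
  assumes "q \<in> {1, 2, 3, 4}"
  obtains C where "C \<ge> 0"
    "\<And>(Y :: nat \<Rightarrow> real \<Rightarrow> complex) t h M.
      \<lbrakk>\<And>j t. 0 \<le> t \<Longrightarrow> (Y j has_vector_derivative Y (Suc j) t) (at t within {0..});
       \<And>r. r \<ge> t \<Longrightarrow> cmod (Y q r) \<le> M; 0 \<le> t; 0 \<le> h\<rbrakk> \<Longrightarrow>
      cmod ((\<Sum>i<q. bdf_gamma q i *\<^sub>R Y 0 (t + real i * h)) - bdf_beta q *\<^sub>R Y 0 (t + real q * h))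
        \<le> C * (h ^ q * M)"
proof -
  have q: "q > 0" and b0: "bdf_beta q > 0" using assms bdf_beta_pos by auto
  define C where "C = ((\<Sum>i<q. \<bar>bdf_gamma q i\<bar>) + bdf_beta q) * real q ^ q"
  show ?thesis
  proof
    show "C \<ge> 0" using b0 by (auto simp: C_def intro!: add_nonneg_nonneg mult_nonneg_nonneg sum_nonneg)
    fix Y :: "nat \<Rightarrow> real \<Rightarrow> complex" and t h M :: real
    assume Y: "\<And>j t. 0 \<le> t \<Longrightarrow> (Y j has_vector_derivative Y (Suc j) t) (at t within {0..})"
      and M: "\<And>r. r \<ge> t \<Longrightarrow> cmod (Y q r) \<le> M" and t: "0 \<le> t" and h: "0 \<le> h"
    have M0: "0 \<le> M" using order_trans[OF norm_ge_zero M[of t]] by simp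
    define R where "R = (\<lambda>i. Y 0 (t + real i * h) - (\<Sum>j<q. ((real i * h) ^ j / fact j) *\<^sub>R Y j t))"
    have R: "cmod (R i) \<le> M * (real q * h) ^ q" if "i \<le> q" for i
    proof -
      have "cmod (R i) \<le> M * (real i * h) ^ q"
        unfolding R_def by (rule taylor_bound[OF Y M]) (use t h q in auto)
      also have "\<dots> \<le> M * (real q * h) ^ q"
        using that h M0 by (intro mult_left_mono power_mono mult_right_mono) auto
      finally show ?thesis .
    qed
    have "(\<Sum>i<q. bdf_gamma q i *\<^sub>R (\<Sum>j<q. ((real i * h) ^ j / fact j) *\<^sub>R Y j t))
        = (\<Sum>j<q. (\<Sum>i<q. bdf_gamma q i *\<^sub>R ((real i * h) ^ j / fact j) *\<^sub>R Y j t))"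
      unfolding scaleR_sum_right by (rule sum.swap)
    also have "\<dots> = (\<Sum>j<q. (h ^ j / fact j * (\<Sum>i<q. bdf_gamma q i * real i ^ j)) *\<^sub>R Y j t)"
      by (intro sum.cong refl) (simp add: sum_distrib_left scaleR_sum_left power_mult_distrib mult_ac)
    also have "\<dots> = bdf_beta q *\<^sub>R (\<Sum>j<q. ((real q * h) ^ j / fact j) *\<^sub>R Y j t)"
      unfolding scaleR_sum_right
      by (intro sum.cong refl) (simp add: bdf_gamma_order[OF assms] power_mult_distrib mult_ac)
    finally have poly: "(\<Sum>i<q. bdf_gamma q i *\<^sub>R (\<Sum>j<q. ((real i * h) ^ j / fact j) *\<^sub>R Y j t))
      = bdf_beta q *\<^sub>R (\<Sum>j<q. ((real q * h) ^ j / fact j) *\<^sub>R Y j t)" .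
    have "(\<Sum>i<q. bdf_gamma q i *\<^sub>R Y 0 (t + real i * h)) - bdf_beta q *\<^sub>R Y 0 (t + real q * h)
        = (\<Sum>i<q. bdf_gamma q i *\<^sub>R R i) - bdf_beta q *\<^sub>R R q"
      using poly by (simp add: R_def scaleR_diff_right sum_subtractf)
    also have "cmod \<dots> \<le> (\<Sum>i<q. \<bar>bdf_gamma q i\<bar>) * (M * (real q * h) ^ q) + bdf_beta q * (M * (real q * h) ^ q)"
    proof (rule order_trans[OF norm_triangle_ineq4 add_mono])
      show "cmod (\<Sum>i<q. bdf_gamma q i *\<^sub>R R i) \<le> (\<Sum>i<q. \<bar>bdf_gamma q i\<bar>) * (M * (real q * h) ^ q)"
        by (rule norm_weighted_sum_bound) (use R in auto)
      show "cmod (bdf_beta q *\<^sub>R R q) \<le> bdf_beta q * (M * (real q * h) ^ q)"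
        using mult_left_mono[OF R[of q], of "bdf_beta q"] b0 by simp
    qed
    also have "\<dots> = C * (h ^ q * M)"
      by (simp add: C_def power_mult_distrib algebra_simps)
    finally show "cmod ((\<Sum>i<q. bdf_gamma q i *\<^sub>R Y 0 (t + real i * h)) - bdf_beta q *\<^sub>R Y 0 (t + real q * h))
        \<le> C * (h ^ q * M)" .
  qed
qed

section \<open>The relaxation system in one Fourier mode\<close>

lemma nonincreasing_if_derivative_nonpos:
  fixes f :: "real \<Rightarrow> real"
  assumes f: "\<And>t. 0 \<le> t \<Longrightarrow> (f has_vector_derivative f' t) (at t within {0..})"
    and f': "\<And>t. 0 \<le> t \<Longrightarrow> f' t \<le> 0" and st: "0 \<le> s" "s \<le> t"
  shows "f t \<le> f s"
proof (rule DERIV_nonpos_imp_decreasing_open[OF st(2)])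
  fix x assume x: "s < x" "x < t"
  then have "at x within {0..} = at x"
    using st by (intro at_within_interior) auto
  then show "\<exists>y. DERIV f x :> y \<and> y \<le> 0"
    using f[of x] f'[of x] x st by (auto simp: has_real_derivative_iff_has_vector_derivative)
next
  have "continuous_on {0..} f"
    by (rule continuous_on_vector_derivative) (use f in auto)
  then show "continuous_on {s..t} f"
    by (rule continuous_on_subset) (use st in auto)
qed

text \<open>
  The Fourier symbol of the system: the \<open>m\<close>-th time derivative of mode \<open>\<kappa>\<close> is the \<open>m\<close>-th iterate of this
  map. Time derivatives of the modes of all orders thus exist even if the solution itself is only
  continuously differentiable.
\<close>
definition relax_gen :: "real \<Rightarrow> real \<Rightarrow> real \<Rightarrow> complex \<times> complex \<Rightarrow> complex \<times> complex" where
  "relax_gen b \<epsilon> \<kappa> = (\<lambda>(x, y). (- (\<i> * of_real \<kappa> * (of_real b * x + y)),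
     - (\<i> * of_real \<kappa> * (of_real (1 - b\<^sup>2) * x - of_real b * y)) - y / of_real \<epsilon>))"

definition cscale :: "complex \<Rightarrow> complex \<times> complex \<Rightarrow> complex \<times> complex" where
  "cscale c = (\<lambda>(x, y). (c * x, c * y))"

definition mode_solution :: "real \<Rightarrow> real \<Rightarrow> real \<Rightarrow> (real \<Rightarrow> complex \<times> complex) \<Rightarrow> bool" where
  "mode_solution b \<epsilon> \<kappa> y \<longleftrightarrow>
     (\<forall>t\<ge>0. (y has_vector_derivative relax_gen b \<epsilon> \<kappa> (y t)) (at t within {0..}))"

lemma norm_pair_le: "norm (p :: complex \<times> complex) \<le> cmod (fst p) + cmod (snd p)"
  by (metis norm_Pair_le prod.collapse)

lemma norm_cscale: "norm (cscale c p) = cmod c * norm p"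
  by (cases p) (simp add: cscale_def norm_Pair norm_mult power_mult_distrib real_sqrt_mult flip: distrib_left)

lemma relax_gen_add: "relax_gen b \<epsilon> \<kappa> (p + p') = relax_gen b \<epsilon> \<kappa> p + relax_gen b \<epsilon> \<kappa> p'"
  by (cases p; cases p') (simp add: relax_gen_def algebra_simps add_divide_distrib)

lemma relax_gen_cscale: "relax_gen b \<epsilon> \<kappa> (cscale c p) = cscale c (relax_gen b \<epsilon> \<kappa> p)"
  by (cases p) (simp add: relax_gen_def cscale_def algebra_simps)

lemma norm_relax_gen_le:
  assumes "\<bar>b\<bar> \<le> 1" "0 < \<epsilon>"
  shows "norm (relax_gen b \<epsilon> \<kappa> p) \<le> (4 * \<bar>\<kappa>\<bar> + 1 / \<epsilon>) * norm p"
proof (cases p)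
  case (Pair x y)
  have xy: "cmod x \<le> norm p" "cmod y \<le> norm p"
    using Pair by (auto simp: norm_Pair real_le_rsqrt)
  have a: "\<bar>1 - b\<^sup>2\<bar> \<le> 1" using assms(1) by (auto simp: abs_square_le_1)
  have "cmod (of_real b * x + y) \<le> cmod x + cmod y"
    using cmod_combination_le[of b 1 x y] assms(1) by simp
  then have 1: "cmod (of_real b * x + y) \<le> 2 * norm p" using xy by linarith
  have "cmod (of_real (1 - b\<^sup>2) * x - of_real b * y) \<le> cmod x + cmod y"
    using cmod_combination_le[of "1 - b\<^sup>2" "- b" x y] assms(1) a by simp
  then have 2: "cmod (of_real (1 - b\<^sup>2) * x - of_real b * y) \<le> 2 * norm p" using xy by linarith
  have "norm (relax_gen b \<epsilon> \<kappa> p) \<le> cmod (\<i> * of_real \<kappa> * (of_real b * x + y))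
      + cmod (- (\<i> * of_real \<kappa> * (of_real (1 - b\<^sup>2) * x - of_real b * y)) - y / of_real \<epsilon>)"
    using norm_pair_le[of "relax_gen b \<epsilon> \<kappa> p"] unfolding Pair relax_gen_def by simp
  also have "\<dots> \<le> cmod (\<i> * of_real \<kappa> * (of_real b * x + y))
      + (cmod (\<i> * of_real \<kappa> * (of_real (1 - b\<^sup>2) * x - of_real b * y)) + cmod (y / of_real \<epsilon>))"
    by (intro add_left_mono order_trans[OF norm_triangle_ineq4]) simp
  also have "\<dots> = \<bar>\<kappa>\<bar> * cmod (of_real b * x + y)
      + (\<bar>\<kappa>\<bar> * cmod (of_real (1 - b\<^sup>2) * x - of_real b * y) + cmod y / \<epsilon>)"
    using assms(2) by (simp add: norm_mult norm_divide)
  also have "\<dots> \<le> \<bar>\<kappa>\<bar> * (2 * norm p) + (\<bar>\<kappa>\<bar> * (2 * norm p) + norm p / \<epsilon>)"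
    using 1 2 xy assms(2) by (intro add_mono mult_left_mono divide_right_mono) auto
  also have "\<dots> = (4 * \<bar>\<kappa>\<bar> + 1 / \<epsilon>) * norm p"
    by (simp add: algebra_simps)
  finally show ?thesis .
qed

lemma linear_relax_gen: "linear (relax_gen b \<epsilon> \<kappa>)"
proof (rule linearI)
  show "relax_gen b \<epsilon> \<kappa> (r *\<^sub>R p) = r *\<^sub>R relax_gen b \<epsilon> \<kappa> p" for r p
    by (cases p) (simp add: relax_gen_def scaleR_conv_of_real algebra_simps)
qed (rule relax_gen_add)

lemma linear_relax_gen_pow: "linear (relax_gen b \<epsilon> \<kappa> ^^ m)"
proof (induction m)
  case 0
  show ?case by (simp only: funpow.simps linear_id)
next
  case (Suc m)
  then show ?case by (simp only: funpow.simps linear_compose linear_relax_gen)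
qed

lemma relax_gen_pow_cscale: "(relax_gen b \<epsilon> \<kappa> ^^ m) (cscale c p) = cscale c ((relax_gen b \<epsilon> \<kappa> ^^ m) p)"
  by (induction m) (simp_all add: relax_gen_cscale)

lemma mode_solution_derivatives:
  assumes "mode_solution b \<epsilon> \<kappa> y" "0 \<le> t"
  shows "((\<lambda>t. (relax_gen b \<epsilon> \<kappa> ^^ m) (y t)) has_vector_derivative (relax_gen b \<epsilon> \<kappa> ^^ Suc m) (y t)) (at t within {0..})"
proof -
  have "bounded_linear (relax_gen b \<epsilon> \<kappa> ^^ m)"
    using linear_relax_gen_pow by (rule linear_conv_bounded_linear[THEN iffD1])
  from bounded_linear.has_vector_derivative[OF this] assms show ?thesis
    by (simp add: mode_solution_def funpow_swap1)
qed

lemma mode_solution_pow: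
  assumes "mode_solution b \<epsilon> \<kappa> y"
  shows "mode_solution b \<epsilon> \<kappa> (\<lambda>t. (relax_gen b \<epsilon> \<kappa> ^^ m) (y t))"
  using mode_solution_derivatives[OF assms, of _ m] by (simp add: mode_solution_def)

definition energy :: "real \<Rightarrow> complex \<times> complex \<Rightarrow> real" where
  "energy b p = (1 - b\<^sup>2) * (cmod (fst p))\<^sup>2 + (cmod (snd p))\<^sup>2"

text \<open>
  The factor \<open>1 - b\<^sup>2\<close> symmetrizes the hyperbolic part, so that only relaxation changes the energy.
\<close>
lemma energy_has_derivative:
  assumes y: "mode_solution b \<epsilon> \<kappa> y" and "0 \<le> t"
  shows "((\<lambda>t. energy b (y t)) has_vector_derivative - (2 / \<epsilon>) * (cmod (snd (y t)))\<^sup>2) (at t within {0..})"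
proof -
  have D: "(y has_vector_derivative relax_gen b \<epsilon> \<kappa> (y t)) (at t within {0..})"
    using y \<open>0 \<le> t\<close> by (simp add: mode_solution_def)
  have D1: "((\<lambda>t. fst (y t)) has_vector_derivative fst (relax_gen b \<epsilon> \<kappa> (y t))) (at t within {0..})"
    by (rule bounded_linear.has_vector_derivative[OF bounded_linear_fst D])
  have D2: "((\<lambda>t. snd (y t)) has_vector_derivative snd (relax_gen b \<epsilon> \<kappa> (y t))) (at t within {0..})"
    by (rule bounded_linear.has_vector_derivative[OF bounded_linear_snd D])
  have E: "energy b p = (1 - b\<^sup>2) * (fst p \<bullet> fst p) + snd p \<bullet> snd p" for p
    by (simp add: energy_def dot_square_norm)
  have "((\<lambda>t. energy b (y t)) has_vector_derivative
      (1 - b\<^sup>2) * (fst (y t) \<bullet> fst (relax_gen b \<epsilon> \<kappa> (y t)) + fst (relax_gen b \<epsilon> \<kappa> (y t)) \<bullet> fst (y t))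
      + (snd (y t) \<bullet> snd (relax_gen b \<epsilon> \<kappa> (y t)) + snd (relax_gen b \<epsilon> \<kappa> (y t)) \<bullet> snd (y t))) (at t within {0..})"
    unfolding E
    by (intro has_vector_derivative_add bounded_linear.has_vector_derivative[OF bounded_linear_mult_right]
        bounded_bilinear.has_vector_derivative[OF bounded_bilinear_inner] D1 D2)
  also have "(1 - b\<^sup>2) * (fst (y t) \<bullet> fst (relax_gen b \<epsilon> \<kappa> (y t)) + fst (relax_gen b \<epsilon> \<kappa> (y t)) \<bullet> fst (y t))
      + (snd (y t) \<bullet> snd (relax_gen b \<epsilon> \<kappa> (y t)) + snd (relax_gen b \<epsilon> \<kappa> (y t)) \<bullet> snd (y t))
    = - (2 / \<epsilon>) * (cmod (snd (y t)))\<^sup>2"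
    unfolding cmod_power2
    by (cases "y t") (simp add: relax_gen_def inner_complex_def power2_eq_square
        algebra_simps Re_divide_of_real Im_divide_of_real flip: of_real_power of_real_diff of_real_mult)
  finally show ?thesis .
qed

lemma energy_nonincreasing:
  assumes "mode_solution b \<epsilon> \<kappa> y" "0 < \<epsilon>" "0 \<le> s" "s \<le> t"
  shows "energy b (y t) \<le> energy b (y s)"
  by (rule nonincreasing_if_derivative_nonpos[OF energy_has_derivative[OF assms(1)]]) (use assms in auto)

lemma energy_le_norm: "\<bar>b\<bar> \<le> 1 \<Longrightarrow> energy b p \<le> (norm p)\<^sup>2"
  by (cases p) (auto simp: energy_def norm_Pair mult_left_le_one_le abs_square_le_1)

lemma norm_le_energy: "(1 - b\<^sup>2) * (norm p)\<^sup>2 \<le> energy b p"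
  by (cases p) (auto simp: energy_def norm_Pair algebra_simps)

lemma mode_solution_norm_le:
  assumes "mode_solution b \<epsilon> \<kappa> y" "\<bar>b\<bar> < 1" "0 < \<epsilon>" "0 \<le> s" "s \<le> t"
  shows "norm (y t) \<le> norm (y s) / (1 - b\<^sup>2)"
proof -
  define a where "a = 1 - b\<^sup>2"
  have a: "0 < a" "a \<le> 1" using assms(2) by (auto simp: a_def abs_square_less_1)
  have "a * (norm (y t))\<^sup>2 \<le> (norm (y s))\<^sup>2"
    using norm_le_energy[of b "y t"] energy_nonincreasing[OF assms(1,3,4,5)] energy_le_norm[of b "y s"] assms(2)
    by (simp add: a_def)
  then have "a * (a * (norm (y t))\<^sup>2) \<le> 1 * (norm (y s))\<^sup>2"
    using a by (intro mult_mono) auto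
  then have "(a * norm (y t))\<^sup>2 \<le> (norm (y s))\<^sup>2"
    by (simp add: power2_eq_square mult_ac)
  then have "a * norm (y t) \<le> norm (y s)"
    by (rule power2_le_imp_le) simp
  then show ?thesis using a by (simp add: a_def[symmetric] field_simps)
qed

section \<open>Time derivatives of a mode after the initial layer\<close>

text \<open>
  The eigenvalues of the generator are \<open>\<mu> / \<epsilon>\<close> with \<open>\<mu>\<close> a root of this polynomial, where \<open>k\<close> stands for
  \<open>\<epsilon> \<kappa>\<close>. The small root belongs to the slow eigenvalue, which is \<open>O(\<kappa>)\<close> without any \<open>1 / \<epsilon>\<close>.
\<close>
lemma small_characteristic_root:
  fixes k b :: real
  assumes "\<bar>k\<bar> \<le> 1 / 24" "\<bar>b\<bar> \<le> 1"
  obtains \<mu> where "\<mu>\<^sup>2 + \<mu> + (of_real (k\<^sup>2) + \<i> * of_real (k * b)) = 0" "cmod \<mu> \<le> 4 * \<bar>k\<bar>"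
proof -
  define p where "p = of_real (k\<^sup>2) + \<i> * of_real (k * b)"
  define s where "s = csqrt (1 - 4 * p)"
  define \<mu> where "\<mu> = (s - 1) / 2"
  define \<nu> where "\<nu> = (- 1 - s) / 2"
  have s2: "s\<^sup>2 = 1 - 4 * p" by (simp add: s_def)
  have prod: "\<mu> * \<nu> = p"
  proof -
    have "\<mu> * \<nu> = (1 - s\<^sup>2) / 4"
      by (simp add: \<mu>_def \<nu>_def field_simps power2_eq_square)
    then show ?thesis by (simp add: s2)
  qed
  have "\<mu>\<^sup>2 + \<mu> = (s\<^sup>2 - 1) / 4"
    by (simp add: \<mu>_def field_simps power2_eq_square)
  then have root: "\<mu>\<^sup>2 + \<mu> + p = 0" by (simp add: s2)
  have "0 \<le> Re s" using csqrt_principal[of "1 - 4 * p"] by (auto simp: s_def)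
  then have "1 / 2 \<le> \<bar>Re \<nu>\<bar>" by (simp add: \<nu>_def)
  \<comment> \<open>The other root stays away from zero, and the product of both roots is \<open>p = O(k)\<close>.\<close>
  then have \<nu>: "1 / 2 \<le> cmod \<nu>" using abs_Re_le_cmod[of \<nu>] by linarith
  have "cmod p \<le> \<bar>k\<bar> * \<bar>k\<bar> + \<bar>k\<bar> * \<bar>b\<bar>"
    unfolding p_def by (rule order_trans[OF norm_triangle_ineq]) (simp add: norm_mult norm_power abs_mult power2_eq_square)
  also have "\<dots> \<le> \<bar>k\<bar> * 1 + \<bar>k\<bar> * 1"
    using assms by (intro add_mono mult_left_mono) auto
  finally have p: "cmod p \<le> 2 * \<bar>k\<bar>" by simp
  have "cmod \<mu> * (1 / 2) \<le> cmod \<mu> * cmod \<nu>"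
    using \<nu> by (intro mult_left_mono) auto
  then have "cmod \<mu> \<le> 4 * \<bar>k\<bar>"
    using p by (simp flip: norm_mult add: prod)
  then show ?thesis using that root by (simp add: p_def)
qed

text \<open>
  By the Cayley-Hamilton theorem, subtracting the slow eigenvalue from the generator projects onto
  the eigenspace of the fast eigenvalue, because the two eigenvalues sum to \<open>- 1 / \<epsilon>\<close>.
\<close>
lemma relax_gen_eigen:
  assumes "0 < \<epsilon>" and root: "\<mu>\<^sup>2 + \<mu> + (of_real ((\<epsilon> * \<kappa>)\<^sup>2) + \<i> * of_real (\<epsilon> * \<kappa> * b)) = 0"
  defines "z \<equiv> \<lambda>p. relax_gen b \<epsilon> \<kappa> p - cscale (\<mu> / of_real \<epsilon>) p"
  shows "relax_gen b \<epsilon> \<kappa> (z p) = cscale ((- 1 - \<mu>) / of_real \<epsilon>) (z p)"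
proof (cases p)
  case (Pair x y)
  define e where "e = complex_of_real \<epsilon>"
  have e: "e \<noteq> 0" using assms(1) by (simp add: e_def)
  define k where "k = complex_of_real \<kappa>"
  define c where "c = complex_of_real b"
  define l where "l = \<mu> / e"
  have "\<mu> = e * l" using e by (simp add: l_def)
  have "e * (e * l\<^sup>2 + l + e * k\<^sup>2 + \<i> * k * c) = 0"
    using root unfolding \<open>\<mu> = e * l\<close> by (simp add: e_def k_def c_def power2_eq_square algebra_simps)
  then have r: "e * l\<^sup>2 + l + e * k\<^sup>2 + \<i> * k * c = 0" using e by simp
  define f where "f = 1 / e"
  have ef: "e * f = 1" using e by (simp add: f_def)
  have r': "l\<^sup>2 + l * f + k\<^sup>2 + \<i> * k * c * f = 0"
  proof -
    have "l\<^sup>2 + l * f + k\<^sup>2 + \<i> * k * c * f = f * (e * l\<^sup>2 + l + e * k\<^sup>2 + \<i> * k * c)"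
      using ef by algebra
    then show ?thesis by (simp add: r)
  qed
  have ii: "\<i> * \<i> = - 1" by simp
  have lf: "(- 1 - \<mu>) / of_real \<epsilon> = - f - l"
    using e by (simp add: f_def l_def e_def field_simps)
  have z: "z p = (- (\<i> * k * (c * x + y)) - l * x, - (\<i> * k * ((1 - c\<^sup>2) * x - c * y)) - f * y - l * y)"
    unfolding z_def Pair by (simp add: relax_gen_def cscale_def e_def k_def c_def l_def f_def)
  have gen: "relax_gen b \<epsilon> \<kappa> (u, v) = (- (\<i> * k * (c * u + v)), - (\<i> * k * ((1 - c\<^sup>2) * u - c * v)) - f * v)" for u v
    by (simp add: relax_gen_def e_def k_def c_def f_def)
  have "- (\<i> * k * (c * (- (\<i> * k * (c * x + y)) - l * x) + (- (\<i> * k * ((1 - c\<^sup>2) * x - c * y)) - f * y - l * y)))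
      = (- f - l) * (- (\<i> * k * (c * x + y)) - l * x)"
    using r' ii by algebra
  moreover have "- (\<i> * k * ((1 - c\<^sup>2) * (- (\<i> * k * (c * x + y)) - l * x) - c * (- (\<i> * k * ((1 - c\<^sup>2) * x - c * y)) - f * y - l * y)))
      - f * (- (\<i> * k * ((1 - c\<^sup>2) * x - c * y)) - f * y - l * y)
      = (- f - l) * (- (\<i> * k * ((1 - c\<^sup>2) * x - c * y)) - f * y - l * y)"
    using r' ii by algebra
  ultimately show ?thesis
    unfolding lf z gen by (simp add: cscale_def)
qed

lemma norm_decay:
  fixes z :: "real \<Rightarrow> complex \<times> complex"
  assumes z: "\<And>t. 0 \<le> t \<Longrightarrow> (z has_vector_derivative cscale l (z t)) (at t within {0..})"
    and l: "Re l \<le> - r" and "0 \<le> t"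
  shows "norm (z t) \<le> exp (- (r * t)) * norm (z 0)"
proof -
  \<comment> \<open>The integrating factor compensates the decay rate, so that \<open>f\<close> is nonincreasing.\<close>
  define f where "f = (\<lambda>t. exp (2 * r * t) * (z t \<bullet> z t))"
  have in_cs: "p \<bullet> cscale l p = Re l * (p \<bullet> p)" for p
    by (cases p) (simp add: cscale_def inner_complex_def algebra_simps)
  have "(f has_vector_derivative exp (2 * r * t) * (z t \<bullet> cscale l (z t) + cscale l (z t) \<bullet> z t)
      + (2 * r * exp (2 * r * t)) * (z t \<bullet> z t)) (at t within {0..})" if "0 \<le> t" for t
    unfolding f_def
    by (intro has_vector_derivative_mult bounded_bilinear.has_vector_derivative[OF bounded_bilinear_inner] z that)
      (auto intro!: derivative_eq_intros simp flip: has_real_derivative_iff_has_vector_derivative)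
  then have "f t \<le> f 0"
  proof (rule nonincreasing_if_derivative_nonpos)
    fix t
    have "exp (2 * r * t) * (z t \<bullet> cscale l (z t) + cscale l (z t) \<bullet> z t) + (2 * r * exp (2 * r * t)) * (z t \<bullet> z t)
      = 2 * exp (2 * r * t) * ((Re l + r) * (z t \<bullet> z t))"
      by (simp add: in_cs inner_commute[of "cscale l (z t)"] algebra_simps)
    also have "\<dots> \<le> 0"
      using l by (intro mult_nonneg_nonpos mult_nonpos_nonneg) auto
    finally show "exp (2 * r * t) * (z t \<bullet> cscale l (z t) + cscale l (z t) \<bullet> z t) + (2 * r * exp (2 * r * t)) * (z t \<bullet> z t) \<le> 0" .
  qed (use \<open>0 \<le> t\<close> in auto)
  then have "(exp (r * t) * norm (z t))\<^sup>2 \<le> (norm (z 0))\<^sup>2"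
    by (simp add: f_def dot_square_norm power_mult_distrib exp_double[symmetric] mult.assoc)
  then have "exp (r * t) * norm (z t) \<le> norm (z 0)"
    by (rule power2_le_imp_le) simp
  then have "exp (- (r * t)) * (exp (r * t) * norm (z t)) \<le> exp (- (r * t)) * norm (z 0)"
    by (intro mult_left_mono) auto
  then show ?thesis by (simp flip: mult.assoc exp_add)
qed

text \<open>
  The bound contains no negative power of \<open>\<epsilon>\<close>. If \<open>\<epsilon>\<close> or \<open>\<epsilon> \<bar>\<kappa>\<bar>\<close> is not small, then \<open>1 / \<epsilon> = O(1 + \<bar>\<kappa>\<bar>)\<close>
  and the norm of the generator suffices. Otherwise let \<open>z\<close> be the time derivative minus the slow
  eigenvalue times the mode, which retains only the fast part. Each further derivative multiplies
  the mode by the slow eigenvalue and adds a power of the fast eigenvalue times \<open>z\<close>, and \<open>z\<close> is of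
  size \<open>\<epsilon>\<^sup>q\<close> after the layer.
\<close>
lemma mode_derivative_bound_after_layer:
  assumes y: "mode_solution b \<epsilon> \<kappa> y" and b: "\<bar>b\<bar> < 1" and \<epsilon>: "0 < \<epsilon>" and q: "q \<le> 4"
    and t: "0 \<le> t" "real (q + 2) * \<epsilon> * ln (1 / \<epsilon>) \<le> t" and m: "m \<le> q + 1"
  shows "norm ((relax_gen b \<epsilon> \<kappa> ^^ m) (y t)) \<le> (1 / (1 - b\<^sup>2) + 1) * 28 ^ 5 * (1 + \<bar>\<kappa>\<bar>) ^ m * norm (y 0)"
proof -
  let ?A = "relax_gen b \<epsilon> \<kappa>"
  define S where "S = 1 / (1 - b\<^sup>2) + 1"
  define k where "k = 1 + \<bar>\<kappa>\<bar>"
  have k: "k \<ge> 1" "\<bar>\<kappa>\<bar> \<le> k" by (auto simp: k_def)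
  have S: "S \<ge> 1" using b by (simp add: S_def abs_square_le_1)
  have yS: "norm (y t) \<le> S * norm (y 0)"
    using mode_solution_norm_le[OF y b \<epsilon> _ t(1)] by (simp add: S_def distrib_right add_increasing2)
  \<comment> \<open>With \<open>\<epsilon> \<bar>\<kappa>\<bar> \<le> 1 / 24\<close> the small root has modulus at most \<open>1 / 6\<close>, so the fast decay rate is at least
      \<open>5 / (6 \<epsilon>)\<close>, and \<open>5 (q + 2) / 6 \<ge> q + 1\<close> holds for \<open>q \<le> 4\<close>.\<close>
  consider "1 / \<epsilon> \<le> 24 * k" | "\<epsilon> < 1" "\<epsilon> * \<bar>\<kappa>\<bar> \<le> 1 / 24"
  proof (cases "\<epsilon> < 1 \<and> \<epsilon> * \<bar>\<kappa>\<bar> \<le> 1 / 24")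
    case False
    then have "1 / \<epsilon> \<le> 24 * k"
    proof (cases "\<epsilon> < 1")
      case True
      then have "1 / 24 \<le> \<epsilon> * \<bar>\<kappa>\<bar>" using False by auto
      then have "1 / \<epsilon> \<le> 24 * \<bar>\<kappa>\<bar>" using \<epsilon> by (simp add: field_simps)
      then show ?thesis by (simp add: k_def)
    next
      case False
      then have "1 / \<epsilon> \<le> 1" by simp
      then show ?thesis using k by linarith
    qed
    then show ?thesis using that by blast
  qed (use that in auto)
  then have "norm ((?A ^^ m) (y t)) \<le> S * 28 ^ 5 * k ^ m * norm (y 0)"
  proof cases
    case 1
    have "4 * \<bar>\<kappa>\<bar> + 1 / \<epsilon> \<le> 28 * k" using 1 k by linarith
    then have A: "norm (?A p) \<le> 28 * k * norm p" for p
      using norm_relax_gen_le[of b \<epsilon> \<kappa> p] b \<epsilon> by (meson less_imp_le mult_right_mono norm_ge_zero order_trans)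
    have "norm ((?A ^^ m) p) \<le> (28 * k) ^ m * norm p" for p
    proof (induction m)
      case (Suc m)
      have "norm ((?A ^^ Suc m) p) \<le> 28 * k * norm ((?A ^^ m) p)" using A by simp
      also have "\<dots> \<le> 28 * k * ((28 * k) ^ m * norm p)" using k by (intro mult_left_mono Suc) auto
      finally show ?case by (simp add: mult.assoc)
    qed simp
    from this[of "y t"] have "norm ((?A ^^ m) (y t)) \<le> 28 ^ m * k ^ m * (S * norm (y 0))"
      using yS k by (elim order_trans) (simp add: power_mult_distrib mult_left_mono)
    also have "\<dots> \<le> 28 ^ 5 * k ^ m * (S * norm (y 0))"
      using k S m q by (intro mult_right_mono power_increasing) auto
    finally show ?thesis by (simp add: mult_ac)
  next
    case 2
    have ek: "\<bar>\<epsilon> * \<kappa>\<bar> \<le> 1 / 24" using 2 \<epsilon> by (simp add: abs_mult)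
    obtain \<mu> where root: "\<mu>\<^sup>2 + \<mu> + (of_real ((\<epsilon> * \<kappa>)\<^sup>2) + \<i> * of_real (\<epsilon> * \<kappa> * b)) = 0"
      and \<mu>: "cmod \<mu> \<le> 4 * \<bar>\<epsilon> * \<kappa>\<bar>"
      using small_characteristic_root[OF ek] b by (metis less_imp_le)
    define ls lf where "ls = \<mu> / of_real \<epsilon>" and "lf = (- 1 - \<mu>) / of_real \<epsilon>"
    have \<mu>6: "cmod \<mu> \<le> 1 / 6" using \<mu> ek by linarith
    have ls: "cmod ls \<le> 4 * \<bar>\<kappa>\<bar>"
      using \<mu> \<epsilon> by (simp add: ls_def norm_divide abs_mult field_simps)
    have lf: "cmod lf \<le> 2 / \<epsilon>"
    proof -
      have "cmod (- 1 - \<mu>) \<le> 2" using norm_triangle_ineq4[of "- 1" \<mu>] \<mu>6 by simp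
      then show ?thesis using \<epsilon> by (simp add: lf_def norm_divide divide_right_mono)
    qed
    have Relf: "Re lf \<le> - (5 / 6 / \<epsilon>)"
    proof -
      have "Re (- 1 - \<mu>) \<le> - (5 / 6)" using \<mu>6 abs_Re_le_cmod[of \<mu>] by simp
      then show ?thesis using \<epsilon> divide_right_mono[of "Re (- 1 - \<mu>)" "- (5 / 6)" \<epsilon>]
        unfolding lf_def by (simp add: Re_divide_of_real)
    qed
    define z where "z = (\<lambda>t. ?A (y t) - cscale ls (y t))"
    have Az: "?A (z s) = cscale lf (z s)" for s
      unfolding z_def ls_def lf_def by (rule relax_gen_eigen[OF \<epsilon> root])
    have dz: "(z has_vector_derivative cscale lf (z s)) (at s within {0..})" if "0 \<le> s" for s
    proof -
      have lin: "bounded_linear (\<lambda>p. ?A p - cscale ls p)"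
      proof (rule linear_conv_bounded_linear[THEN iffD1], rule linear_compose_sub[OF linear_relax_gen])
        show "linear (cscale ls)"
          by (rule linearI) (auto simp: cscale_def algebra_simps split: prod.splits)
      qed
      have "(z has_vector_derivative (?A (?A (y s)) - cscale ls (?A (y s)))) (at s within {0..})"
        unfolding z_def using bounded_linear.has_vector_derivative[OF lin] y that by (simp add: mode_solution_def)
      also have "?A (?A (y s)) - cscale ls (?A (y s)) = ?A (z s)"
        unfolding z_def linear_diff[OF linear_relax_gen] relax_gen_cscale ..
      finally show ?thesis by (simp add: Az)
    qed
    have z0: "norm (z 0) \<le> 2 / \<epsilon> * norm (y 0)"
    proof -
      have "norm (z 0) \<le> (4 * \<bar>\<kappa>\<bar> + 1 / \<epsilon>) * norm (y 0) + 4 * \<bar>\<kappa>\<bar> * norm (y 0)"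
        unfolding z_def using norm_relax_gen_le[of b \<epsilon> \<kappa> "y 0"] b \<epsilon> ls
        by (intro order_trans[OF norm_triangle_ineq4] add_mono) (auto simp: norm_cscale mult_right_mono)
      also have "\<dots> = (8 * \<bar>\<kappa>\<bar> + 1 / \<epsilon>) * norm (y 0)" by (simp add: algebra_simps)
      also have "\<dots> \<le> 2 / \<epsilon> * norm (y 0)"
        using 2(2) \<epsilon> by (intro mult_right_mono) (auto simp: field_simps)
      finally show ?thesis .
    qed
    have "norm (z t) \<le> exp (- (5 / 6 / \<epsilon> * t)) * norm (z 0)"
      by (rule norm_decay[OF dz Relf t(1)])
    also have "exp (- (5 / 6 / \<epsilon> * t)) \<le> \<epsilon> ^ (q + 1)"
    proof -
      have L: "0 \<le> ln (1 / \<epsilon>)" using 2 \<epsilon> by simp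
      have "real (q + 1) * ln (1 / \<epsilon>) \<le> 5 / 6 * real (q + 2) * ln (1 / \<epsilon>)"
        using L q by (intro mult_right_mono) auto
      also have "\<dots> = 5 / 6 / \<epsilon> * (real (q + 2) * \<epsilon> * ln (1 / \<epsilon>))"
        using \<epsilon> by simp
      also have "\<dots> \<le> 5 / 6 / \<epsilon> * t" using t(2) \<epsilon> by (intro mult_left_mono) auto
      finally have "exp (- (5 / 6 / \<epsilon> * t)) \<le> exp (real (q + 1) * ln \<epsilon>)"
        using \<epsilon> by (simp add: ln_div)
      also have "\<dots> = \<epsilon> ^ (q + 1)"
        using \<epsilon> by (simp only: exp_of_nat_mult exp_ln)
      finally show ?thesis .
    qed
    finally have "norm (z t) \<le> \<epsilon> ^ (q + 1) * norm (z 0)" by (simp add: mult_right_mono)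
    also have "\<dots> \<le> \<epsilon> ^ (q + 1) * (2 / \<epsilon> * norm (y 0))"
      using z0 \<epsilon> by (intro mult_left_mono) auto
    also have "\<dots> = 2 * \<epsilon> ^ q * norm (y 0)" using \<epsilon> by simp
    finally have zt: "norm (z t) \<le> 2 * \<epsilon> ^ q * norm (y 0)" .
    have Amz: "(?A ^^ j) (z t) = cscale (lf ^ j) (z t)" for j
      by (induction j) (simp_all add: Az relax_gen_cscale, simp_all add: cscale_def mult_ac split: prod.splits)
    \<comment> \<open>The slow eigenvalue costs a factor \<open>4 k\<close>; the fast component, multiplied by at most \<open>(2 / \<epsilon>)\<^sup>j\<close> with
        \<open>j \<le> q\<close>, stays bounded. The base \<open>8\<close> leaves room for both.\<close>
    have "norm ((?A ^^ m) (y t)) \<le> S * 8 ^ m * k ^ m * norm (y 0)"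
      using m
    proof (induction m)
      case 0
      then show ?case using yS by simp
    next
      case (Suc j)
      have "(?A ^^ Suc j) (y t) = (?A ^^ j) (cscale ls (y t) + z t)"
        unfolding z_def by (simp add: funpow_swap1)
      also have "\<dots> = cscale ls ((?A ^^ j) (y t)) + cscale (lf ^ j) (z t)"
        by (simp only: linear_add[OF linear_relax_gen_pow] relax_gen_pow_cscale Amz)
      finally have "norm ((?A ^^ Suc j) (y t)) \<le> cmod ls * norm ((?A ^^ j) (y t)) + cmod lf ^ j * norm (z t)"
        by (metis norm_triangle_ineq norm_cscale norm_power)
      also have "\<dots> \<le> (4 * k) * (S * 8 ^ j * k ^ j * norm (y 0)) + 4 * (S * 8 ^ j * k ^ Suc j * norm (y 0))"
      proof (rule add_mono)
        show "cmod ls * norm ((?A ^^ j) (y t)) \<le> (4 * k) * (S * 8 ^ j * k ^ j * norm (y 0))"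
          using Suc ls k by (intro mult_mono) auto
        have "cmod lf ^ j * norm (z t) \<le> (2 / \<epsilon>) ^ j * (2 * \<epsilon> ^ q * norm (y 0))"
          using lf zt \<epsilon> by (intro mult_mono power_mono) auto
        also have "\<dots> = 2 * 2 ^ j * \<epsilon> ^ (q - j) * norm (y 0)"
        proof -
          have "\<epsilon> ^ q = \<epsilon> ^ j * \<epsilon> ^ (q - j)" using Suc.prems by (simp flip: power_add)
          then show ?thesis using \<epsilon> by (simp add: power_divide)
        qed
        also have "\<dots> \<le> 2 * 2 ^ j * 1 * norm (y 0)"
          using \<epsilon> 2(1) by (intro mult_right_mono mult_left_mono power_le_one) auto
        also have "\<dots> \<le> 4 * (S * 8 ^ j * k ^ Suc j) * norm (y 0)"
        proof (rule mult_right_mono)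
          have "(2::real) ^ j \<le> 8 ^ j" by (intro power_mono) auto
          moreover have "1 \<le> S * k ^ Suc j"
            using mult_mono[OF S one_le_power[OF k(1), of "Suc j"]] S by simp
          ultimately have "1 * (2::real) ^ j \<le> (S * k ^ Suc j) * 8 ^ j"
            using S k by (intro mult_mono) auto
          then have "2 * (2::real) ^ j \<le> 4 * ((S * k ^ Suc j) * 8 ^ j)"
            using S k by (intro mult_mono) auto
          then show "2 * 2 ^ j * 1 \<le> 4 * (S * 8 ^ j * k ^ Suc j)" by (simp add: mult_ac)
        qed simp
        finally show "cmod lf ^ j * norm (z t) \<le> 4 * (S * 8 ^ j * k ^ Suc j * norm (y 0))" by (simp only: mult.assoc)
      qed
      also have "\<dots> = S * 8 ^ Suc j * k ^ Suc j * norm (y 0)" by simp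
      finally show ?case .
    qed
    also have "\<dots> \<le> S * 28 ^ 5 * k ^ m * norm (y 0)"
    proof -
      have "(8::real) ^ m \<le> 28 ^ 5"
        using power_mono[of "8::real" 28 m] power_increasing[of m 5 "28::real"] m q by linarith
      then show ?thesis using S k by (intro mult_right_mono mult_left_mono) auto
    qed
    finally show ?thesis .
  qed
  then show ?thesis by (simp add: S_def k_def)
qed

section \<open>Fourier coefficients of continuous functions\<close>

lemma continuous_slice:
  assumes "continuous_on ({0..} \<times> UNIV) (\<lambda>(t, x). g t x)" "0 \<le> t"
  shows "continuous_on S (g t)"
proof -
  have "continuous_on S ((\<lambda>(t, x). g t x) \<circ> (\<lambda>x. (t, x)))"
    by (intro continuous_on_compose continuous_on_subset[OF assms(1)] continuous_intros) (use assms(2) in auto)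
  then show ?thesis by (simp add: o_def)
qed

lemma cis_has_vector_derivative:
  "((\<lambda>x. cis (c * x)) has_vector_derivative \<i> * of_real c * cis (c * x)) (at x within S)"
  by (auto simp: cis.ctr has_vector_derivative_complex_iff field_simps intro!: derivative_eq_intros)

lemma integral_cis:
  "((\<lambda>x. cis (of_int m * x)) has_integral (if m = 0 then 2 * pi else 0)) {0..2 * pi}"
proof (cases "m = 0")
  case True
  then show ?thesis using has_integral_const_real[of "1::complex" 0 "2 * pi"] by (simp add: scaleR_conv_of_real)
next
  case False
  define f where "f = (\<lambda>x. cis (of_int m * x) / (\<i> * of_int m))"
  have "((\<lambda>x. cis (of_int m * x)) has_integral f (2 * pi) - f 0) {0..2 * pi}"
  proof (rule fundamental_theorem_of_calculus)
    fix x assume "x \<in> {0..2 * pi}"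
    have "(f has_vector_derivative \<i> * of_real (of_int m) * cis (of_int m * x) / (\<i> * of_int m)) (at x within {0..2 * pi})"
      unfolding f_def by (intro has_vector_derivative_divide cis_has_vector_derivative)
    then show "(f has_vector_derivative cis (of_int m * x)) (at x within {0..2 * pi})"
      using False by simp
  qed simp
  moreover have "f (2 * pi) = f 0"
    using cis_multiple_2pi[of "of_int m"] by (simp add: f_def mult.commute)
  ultimately show ?thesis using False by simp
qed

lemma fourier_integrable:
  assumes "continuous_on {0..2 * pi} f"
  shows "(\<lambda>x. f x * cis (- (of_int k * x))) integrable_on {0..2 * pi}"
  using assms by (intro integrable_continuous_interval continuous_intros) auto

lemma fourier_coeff_integral:
  assumes "continuous_on {0..2 * pi} f"
  shows "((\<lambda>x. f x * cis (- (of_int k * x))) has_integral 2 * pi * fourier_coeff f k) {0..2 * pi}"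
  using integrable_integral[OF fourier_integrable[OF assms]] by (simp add: fourier_coeff_def)

lemma fourier_coeffI:
  fixes c :: complex
  assumes "((\<lambda>x. f x * cis (- (of_int k * x))) has_integral 2 * pi * c) {0..2 * pi}"
  shows "fourier_coeff f k = c"
  using integral_unique[OF assms] by (simp add: fourier_coeff_def)

lemma fourier_coeff_add:
  assumes "continuous_on {0..2 * pi} f" "continuous_on {0..2 * pi} g"
  shows "fourier_coeff (\<lambda>x. f x + g x) k = fourier_coeff f k + fourier_coeff g k"
  using has_integral_add[OF fourier_coeff_integral[OF assms(1)] fourier_coeff_integral[OF assms(2)]]
  by (intro fourier_coeffI) (simp add: algebra_simps)

lemma fourier_coeff_mult:
  assumes "continuous_on {0..2 * pi} f"
  shows "fourier_coeff (\<lambda>x. c * f x) k = c * fourier_coeff f k"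
  using has_integral_mult_right[OF fourier_coeff_integral[OF assms], of c]
  by (intro fourier_coeffI) (simp add: mult_ac)

lemma fourier_coeff_scaleR:
  assumes "continuous_on {0..2 * pi} f"
  shows "fourier_coeff (\<lambda>x. c *\<^sub>R f x) k = c *\<^sub>R fourier_coeff f k"
  using fourier_coeff_mult[OF assms, of "of_real c"] by (simp add: scaleR_conv_of_real)

definition trig_sum :: "nat \<Rightarrow> (int \<Rightarrow> complex) \<Rightarrow> real \<Rightarrow> complex" where
  "trig_sum N c x = (\<Sum>k\<in>{- int N..int N}. c k * cis (of_int k * x))"

lemma continuous_trig_sum: "continuous_on S (trig_sum N c)"
  unfolding trig_sum_def by (intro continuous_intros)

lemma fourier_coeff_trig_sum:
  assumes "k \<in> {- int N..int N}"
  shows "fourier_coeff (trig_sum N c) k = c k"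
proof (rule fourier_coeffI)
  have "((\<lambda>x. \<Sum>j\<in>{- int N..int N}. c j * cis (of_int (j - k) * x)) has_integral
      (\<Sum>j\<in>{- int N..int N}. c j * (if j - k = 0 then 2 * pi else 0))) {0..2 * pi}"
    by (intro has_integral_sum has_integral_mult_right integral_cis) auto
  also have "(\<Sum>j\<in>{- int N..int N}. c j * (if j - k = 0 then 2 * pi else 0)) = (\<Sum>j\<in>{- int N..int N}. if k = j then 2 * pi * c j else 0)"
    by (intro sum.cong) auto
  also have "\<dots> = 2 * pi * c k"
    using assms by simp
  also have "(\<lambda>x. \<Sum>j\<in>{- int N..int N}. c j * cis (of_int (j - k) * x)) = (\<lambda>x. trig_sum N c x * cis (- (of_int k * x)))"
    unfolding trig_sum_def sum_distrib_right mult.assoc cis_mult by (simp add: left_diff_distrib)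
  finally show "((\<lambda>x. trig_sum N c x * cis (- (of_int k * x))) has_integral 2 * pi * c k) {0..2 * pi}"
    by simp
qed

lemma integral_mult_cnj_trig_sum:
  assumes "continuous_on {0..2 * pi} f"
  shows "((\<lambda>x. f x * cnj (trig_sum N c x)) has_integral
    2 * pi * (\<Sum>k\<in>{- int N..int N}. cnj (c k) * fourier_coeff f k)) {0..2 * pi}"
proof -
  have "((\<lambda>x. \<Sum>k\<in>{- int N..int N}. cnj (c k) * (f x * cis (- (of_int k * x)))) has_integral
      (\<Sum>k\<in>{- int N..int N}. cnj (c k) * (2 * pi * fourier_coeff f k))) {0..2 * pi}"
    by (intro has_integral_sum has_integral_mult_right fourier_coeff_integral assms) auto
  moreover have "(\<Sum>k\<in>{- int N..int N}. cnj (c k) * (f x * cis (- (of_int k * x)))) = f x * cnj (trig_sum N c x)" for x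
    by (simp add: trig_sum_def sum_distrib_left cis_cnj mult_ac)
  moreover have "(\<Sum>k\<in>{- int N..int N}. cnj (c k) * (2 * pi * fourier_coeff f k))
      = 2 * pi * (\<Sum>k\<in>{- int N..int N}. cnj (c k) * fourier_coeff f k)"
    by (simp add: sum_distrib_left mult_ac)
  ultimately show ?thesis by simp
qed

lemma L2_norm_sq: "(L2_norm f)\<^sup>2 = integral {0..2 * pi} (\<lambda>x. (cmod (f x))\<^sup>2)"
proof -
  have "0 \<le> integral {0..2 * pi} (\<lambda>x. (cmod (f x))\<^sup>2)"
    by (cases "(\<lambda>x. (cmod (f x))\<^sup>2) integrable_on {0..2 * pi}")
      (auto intro: Henstock_Kurzweil_Integration.integral_nonneg simp: not_integrable_integral)
  then show ?thesis by (simp add: L2_norm_def)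
qed

text \<open>
  The exponentials are orthogonal, so the cross terms see only the coefficients of \<open>f\<close> up to \<open>N\<close>,
  and completing the square separates the best approximation from the distance to it.
\<close>
lemma L2_dist_trig_sum:
  assumes f: "continuous_on {0..2 * pi} f"
  shows "(L2_norm (\<lambda>x. f x - trig_sum N c x))\<^sup>2
    = integral {0..2 * pi} (\<lambda>x. (cmod (f x))\<^sup>2) - 2 * pi * (\<Sum>k\<in>{- int N..int N}. (cmod (fourier_coeff f k))\<^sup>2)
      + 2 * pi * (\<Sum>k\<in>{- int N..int N}. (cmod (fourier_coeff f k - c k))\<^sup>2)"
proof -
  let ?I = "{- int N..int N}"
  let ?g = "trig_sum N c"
  have int2: "((\<lambda>x. (cmod (f x))\<^sup>2) has_integral integral {0..2 * pi} (\<lambda>x. (cmod (f x))\<^sup>2)) {0..2 * pi}"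
    using f by (intro integrable_integral integrable_continuous_interval continuous_intros)
  have fg: "((\<lambda>x. Re (f x * cnj (?g x))) has_integral Re (2 * pi * (\<Sum>k\<in>?I. cnj (c k) * fourier_coeff f k))) {0..2 * pi}"
    by (rule has_integral_Re[OF integral_mult_cnj_trig_sum[OF f]])
  have gg: "((\<lambda>x. Re (?g x * cnj (?g x))) has_integral Re (2 * pi * (\<Sum>k\<in>?I. cnj (c k) * fourier_coeff ?g k))) {0..2 * pi}"
    by (rule has_integral_Re[OF integral_mult_cnj_trig_sum[OF continuous_trig_sum]])
  have "((\<lambda>x. (cmod (f x))\<^sup>2 - 2 * Re (f x * cnj (?g x)) + Re (?g x * cnj (?g x))) has_integral
      integral {0..2 * pi} (\<lambda>x. (cmod (f x))\<^sup>2) - 2 * Re (2 * pi * (\<Sum>k\<in>?I. cnj (c k) * fourier_coeff f k))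
      + Re (2 * pi * (\<Sum>k\<in>?I. cnj (c k) * fourier_coeff ?g k))) {0..2 * pi}"
    by (intro has_integral_add has_integral_diff has_integral_mult_right int2 fg gg)
  moreover have "(cmod (f x))\<^sup>2 - 2 * Re (f x * cnj (?g x)) + Re (?g x * cnj (?g x)) = (cmod (f x - ?g x))\<^sup>2" for x
    unfolding cmod_power2 by (simp add: power2_eq_square algebra_simps)
  ultimately have "(L2_norm (\<lambda>x. f x - ?g x))\<^sup>2 =
      integral {0..2 * pi} (\<lambda>x. (cmod (f x))\<^sup>2) - 2 * Re (2 * pi * (\<Sum>k\<in>?I. cnj (c k) * fourier_coeff f k))
      + Re (2 * pi * (\<Sum>k\<in>?I. cnj (c k) * fourier_coeff ?g k))"
    unfolding L2_norm_sq by (simp add: integral_unique)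
  also have "Re (2 * pi * (\<Sum>k\<in>?I. cnj (c k) * fourier_coeff f k)) = 2 * pi * (\<Sum>k\<in>?I. Re (cnj (c k) * fourier_coeff f k))"
    by simp
  also have "Re (2 * pi * (\<Sum>k\<in>?I. cnj (c k) * fourier_coeff ?g k)) = 2 * pi * (\<Sum>k\<in>?I. (cmod (c k))\<^sup>2)"
  proof -
    have "(\<Sum>k\<in>?I. cnj (c k) * fourier_coeff ?g k) = (\<Sum>k\<in>?I. of_real ((cmod (c k))\<^sup>2))"
      by (intro sum.cong refl) (simp add: fourier_coeff_trig_sum complex_norm_square mult.commute del: of_real_power)
    then show ?thesis by (simp flip: of_real_sum)
  qed
  also have "(\<Sum>k\<in>?I. (cmod (c k))\<^sup>2) = (\<Sum>k\<in>?I. (cmod (fourier_coeff f k - c k))\<^sup>2)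
      - (\<Sum>k\<in>?I. (cmod (fourier_coeff f k))\<^sup>2) + 2 * (\<Sum>k\<in>?I. Re (cnj (c k) * fourier_coeff f k))"
    unfolding sum_distrib_left sum_subtractf[symmetric] sum.distrib[symmetric] cmod_power2
    by (intro sum.cong refl) (simp add: power2_eq_square algebra_simps)
  finally show ?thesis by (simp add: algebra_simps)
qed

lemma fourier_proj_eq_trig_sum: "fourier_proj N f = trig_sum N (fourier_coeff f)"
  by (simp add: fourier_proj_def trig_sum_def fun_eq_iff)

lemma proj_error_sq_eq:
  assumes f: "continuous_on {0..2 * pi} f"
  shows "proj_error_sq N f = integral {0..2 * pi} (\<lambda>x. (cmod (f x))\<^sup>2)
    - 2 * pi * (\<Sum>k\<in>{- int N..int N}. (cmod (fourier_coeff f k))\<^sup>2)"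
  unfolding proj_error_sq_def fourier_proj_eq_trig_sum L2_dist_trig_sum[OF f] by simp

lemma L2_dist_trig_sum_split:
  assumes f: "continuous_on {0..2 * pi} f"
  shows "(L2_norm (\<lambda>x. f x - trig_sum N c x))\<^sup>2
    = proj_error_sq N f + 2 * pi * (\<Sum>k\<in>{- int N..int N}. (cmod (fourier_coeff f k - c k))\<^sup>2)"
  unfolding L2_dist_trig_sum[OF f] proj_error_sq_eq[OF f] ..

lemma fourier_coeff_dx:
  assumes per: "\<And>x. f (x + 2 * pi) = f x" and diff: "\<And>x. f differentiable (at x)"
    and cont: "continuous_on {0..2 * pi} (dx f)"
  shows "fourier_coeff (dx f) k = \<i> * of_int k * fourier_coeff f k"
proof -
  have D: "(f has_vector_derivative dx f x) (at x within S)" for x S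
    using diff[of x] unfolding dx_def by (simp add: vector_derivative_works has_vector_derivative_at_within)
  have cf: "continuous_on {0..2 * pi} f"
    by (rule continuous_on_vector_derivative) (rule D)
  define e where "e = (\<lambda>x. cis (- (of_int k * x)))"
  have De: "(e has_vector_derivative - (\<i> * of_int k) * e x) (at x within S)" for x S
    using cis_has_vector_derivative[of "- of_int k"] by (simp add: e_def)
  have "((\<lambda>x. f x * (- (\<i> * of_int k) * e x) + dx f x * e x) has_integral f (2 * pi) * e (2 * pi) - f 0 * e 0) {0..2 * pi}"
    by (rule fundamental_theorem_of_calculus, simp) (rule has_vector_derivative_mult[OF D De])
  also have "f (2 * pi) * e (2 * pi) - f 0 * e 0 = 0"
    using per[of 0] cis_multiple_2pi[of "- of_int k"] by (simp add: e_def mult.commute)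
  finally have 0: "((\<lambda>x. f x * (- (\<i> * of_int k) * e x) + dx f x * e x) has_integral 0) {0..2 * pi}" .
  have "((\<lambda>x. (\<i> * of_int k) * (f x * e x)) has_integral (\<i> * of_int k) * (2 * pi * fourier_coeff f k)) {0..2 * pi}"
    unfolding e_def by (intro has_integral_mult_right fourier_coeff_integral cf)
  from has_integral_add[OF 0 this] have "((\<lambda>x. dx f x * e x) has_integral 2 * pi * (\<i> * of_int k * fourier_coeff f k)) {0..2 * pi}"
    by (simp add: algebra_simps)
  then show ?thesis unfolding e_def by (rule fourier_coeffI)
qed

lemma dt_works:
  assumes "(\<lambda>s. u s x) differentiable (at t within {0..})"
  shows "((\<lambda>s. u s x) has_vector_derivative dt u t x) (at t within {0..})"
  using assms by (simp add: dt_def vector_derivative_works)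

lemma fourier_coeff_has_vector_derivative:
  assumes diff: "\<And>t x. 0 \<le> t \<Longrightarrow> (\<lambda>s. u s x) differentiable (at t within {0..})"
    and cu: "continuous_on ({0..} \<times> UNIV) (\<lambda>(t, x). u t x)"
    and cont: "continuous_on ({0..} \<times> UNIV) (\<lambda>(t, x). dt u t x)" and t: "0 \<le> t"
  shows "((\<lambda>t. fourier_coeff (u t) k) has_vector_derivative fourier_coeff (dt u t) k) (at t within {0..})"
proof -
  define e where "e = (\<lambda>x. cis (- (of_int k * x)))"
  have "((\<lambda>s. integral (cbox 0 (2 * pi)) (\<lambda>x. u s x * e x)) has_vector_derivative
      integral (cbox 0 (2 * pi)) (\<lambda>x. dt u t x * e x)) (at t within {0..})"
  proof (rule leibniz_rule_vector_derivative[where U = "{0..}"])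
    show "((\<lambda>s. u s x * e x) has_vector_derivative dt u s x * e x) (at s within {0..})" if "s \<in> {0..}" for s x
      using that by (intro has_vector_derivative_mult_left dt_works diff) auto
    show "(\<lambda>x. u s x * e x) integrable_on cbox 0 (2 * pi)" if "s \<in> {0..}" for s
      using that unfolding e_def by (auto intro!: integrable_continuous_interval continuous_intros continuous_slice[OF cu])
    have "continuous_on ({0..} \<times> cbox 0 (2 * pi)) (\<lambda>p. (case p of (t, x) \<Rightarrow> dt u t x) * e (snd p))"
      unfolding e_def by (intro continuous_intros continuous_on_subset[OF cont]) auto
    then show "continuous_on ({0..} \<times> cbox 0 (2 * pi)) (\<lambda>(s, x). dt u s x * e x)"
      by (simp add: case_prod_unfold)
  qed (use t in auto)
  from has_vector_derivative_mult_right[OF this, of "1 / (2 * pi)"] show ?thesis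
    by (simp add: fourier_coeff_def e_def)
qed

section \<open>Fourier modes and projection errors of a solution\<close>

lemma C1_periodicD:
  assumes "C1_periodic u"
  shows "\<And>t x. 0 \<le> t \<Longrightarrow> u t (x + 2 * pi) = u t x"
    and "\<And>t x. 0 \<le> t \<Longrightarrow> (\<lambda>s. u s x) differentiable (at t within {0..})"
    and "continuous_on ({0..} \<times> UNIV) (\<lambda>(t, x). u t x)"
    and "continuous_on ({0..} \<times> UNIV) (\<lambda>(t, x). dt u t x)"
    and "\<And>t x. 0 \<le> t \<Longrightarrow> (u t) differentiable (at x)"
    and "continuous_on ({0..} \<times> UNIV) (\<lambda>(t, x). dx (u t) x)"
proof -
  show "\<And>t x. 0 \<le> t \<Longrightarrow> u t (x + 2 * pi) = u t x" "\<And>t x. 0 \<le> t \<Longrightarrow> (u t) differentiable (at x)"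
    "continuous_on ({0..} \<times> UNIV) (\<lambda>(t, x). dx (u t) x)"
    using assms by (auto simp: C1_periodic_def)
  have "time_smooth 1 u" using assms by (simp add: C1_periodic_def)
  then have d: "\<forall>j<1. \<forall>t\<ge>0. \<forall>x. (\<lambda>s. (dt ^^ j) u s x) differentiable (at t within {0..})"
    and c: "\<forall>j\<le>1. continuous_on ({0..} \<times> UNIV) (\<lambda>(t, x). (dt ^^ j) u t x)"
    unfolding time_smooth_def by blast+
  show "(\<lambda>s. u s x) differentiable (at t within {0..})" if "0 \<le> t" for t x
    using d that by simp
  show "continuous_on ({0..} \<times> UNIV) (\<lambda>(t, x). u t x)"
    using spec[OF c, of 0] by simp
  show "continuous_on ({0..} \<times> UNIV) (\<lambda>(t, x). dt u t x)"
    using spec[OF c, of 1] by simp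
qed

lemma dx_works:
  "f differentiable (at x) \<Longrightarrow> (f has_vector_derivative dx f x) (at x within S)"
  unfolding dx_def by (simp add: vector_derivative_works has_vector_derivative_at_within)

lemma dx_combination:
  assumes "f differentiable (at x)" "g differentiable (at x)"
  shows "dx (\<lambda>y. c *\<^sub>R f y + d *\<^sub>R g y) x = c *\<^sub>R dx f x + d *\<^sub>R dx g x"
  unfolding dx_def[of "\<lambda>y. c *\<^sub>R f y + d *\<^sub>R g y"]
  by (intro vector_derivative_at has_vector_derivative_add bounded_linear.has_vector_derivative[OF bounded_linear_scaleR_right]
      dx_works assms)

lemma is_solution_equations:
  assumes sol: "is_solution b \<epsilon> u w" and t: "0 \<le> t"
  shows "dt u t x = - (b *\<^sub>R dx (u t) x + dx (w t) x)"
    and "dt w t x = - ((1 - b\<^sup>2) *\<^sub>R dx (u t) x - b *\<^sub>R dx (w t) x) - (1 / \<epsilon>) *\<^sub>R w t x"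
proof -
  have "(u t) differentiable (at x)" "(w t) differentiable (at x)"
    using sol C1_periodicD(5) t by (auto simp: is_solution_def)
  then have "dx (\<lambda>y. b *\<^sub>R u t y + w t y) x = b *\<^sub>R dx (u t) x + dx (w t) x"
    "dx (\<lambda>y. (1 - b\<^sup>2) *\<^sub>R u t y - b *\<^sub>R w t y) x = (1 - b\<^sup>2) *\<^sub>R dx (u t) x - b *\<^sub>R dx (w t) x"
    using dx_combination[of "u t" x "w t" b 1] dx_combination[of "u t" x "w t" "1 - b\<^sup>2" "- b"] by simp_all
  moreover have "dt u t x + dx (\<lambda>y. b *\<^sub>R u t y + w t y) x = 0"
    "dt w t x + dx (\<lambda>y. (1 - b\<^sup>2) *\<^sub>R u t y - b *\<^sub>R w t y) x = - (1 / \<epsilon>) *\<^sub>R w t x"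
    using sol t by (auto simp: is_solution_def)
  moreover have "p = - z" if "p + z = 0" for p z :: complex
    using that by (simp add: eq_neg_iff_add_eq_0)
  moreover have "p = - z - r *\<^sub>R v" if "p + z = - r *\<^sub>R v" for p z v :: complex and r :: real
  proof -
    have "p = p + z - z" by simp
    then show ?thesis unfolding that by simp
  qed
  ultimately show "dt u t x = - (b *\<^sub>R dx (u t) x + dx (w t) x)"
    "dt w t x = - ((1 - b\<^sup>2) *\<^sub>R dx (u t) x - b *\<^sub>R dx (w t) x) - (1 / \<epsilon>) *\<^sub>R w t x"
    by (simp_all only:)
qed

definition fourier_mode :: "(real \<Rightarrow> complex) \<Rightarrow> (real \<Rightarrow> complex) \<Rightarrow> int \<Rightarrow> complex \<times> complex" where
  "fourier_mode f g k = (fourier_coeff f k, fourier_coeff g k)"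

lemma fourier_mode_solution:
  assumes sol: "is_solution b \<epsilon> u w"
  shows "mode_solution b \<epsilon> (of_int k) (\<lambda>t. fourier_mode (u t) (w t) k)"
  unfolding mode_solution_def
proof (intro allI impI)
  fix t :: real assume t: "0 \<le> t"
  have U: "C1_periodic u" and W: "C1_periodic w" using sol by (auto simp: is_solution_def)
  note u = C1_periodicD[OF U] and w = C1_periodicD[OF W]
  note cs = continuous_slice[OF u(3) t] continuous_slice[OF w(3) t] continuous_slice[OF u(6) t] continuous_slice[OF w(6) t]
  have fu: "fourier_coeff (dx (u t)) k = \<i> * of_int k * fourier_coeff (u t) k"
    by (rule fourier_coeff_dx[OF u(1)[OF t] u(5)[OF t] cs(3)])
  have fw: "fourier_coeff (dx (w t)) k = \<i> * of_int k * fourier_coeff (w t) k"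
    by (rule fourier_coeff_dx[OF w(1)[OF t] w(5)[OF t] cs(4)])
  have 1: "fourier_coeff (dt u t) k = (- b) *\<^sub>R fourier_coeff (dx (u t)) k + (- 1) *\<^sub>R fourier_coeff (dx (w t)) k"
  proof -
    have "dt u t = (\<lambda>x. (- b) *\<^sub>R dx (u t) x + (- 1) *\<^sub>R dx (w t) x)"
      using is_solution_equations(1)[OF sol t] by auto
    then show ?thesis
      by (simp only:) (subst fourier_coeff_add, intro continuous_intros cs, intro continuous_intros cs,
        simp only: fourier_coeff_scaleR cs)
  qed
  have 2: "fourier_coeff (dt w t) k = (- (1 - b\<^sup>2)) *\<^sub>R fourier_coeff (dx (u t)) k
      + (b *\<^sub>R fourier_coeff (dx (w t)) k + (- (1 / \<epsilon>)) *\<^sub>R fourier_coeff (w t) k)"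
  proof -
    have "dt w t = (\<lambda>x. (- (1 - b\<^sup>2)) *\<^sub>R dx (u t) x + (b *\<^sub>R dx (w t) x + (- (1 / \<epsilon>)) *\<^sub>R w t x))"
      using is_solution_equations(2)[OF sol t] by (auto simp: algebra_simps)
    then show ?thesis
      by (simp only:) (subst fourier_coeff_add, intro continuous_intros cs, intro continuous_intros cs,
        subst fourier_coeff_add, intro continuous_intros cs, intro continuous_intros cs,
        simp only: fourier_coeff_scaleR cs)
  qed
  have "((\<lambda>t. fourier_mode (u t) (w t) k) has_vector_derivative (fourier_coeff (dt u t) k, fourier_coeff (dt w t) k)) (at t within {0..})"
    unfolding fourier_mode_def
    by (intro has_vector_derivative_Pair fourier_coeff_has_vector_derivative u w t)
  also have "(fourier_coeff (dt u t) k, fourier_coeff (dt w t) k) = relax_gen b \<epsilon> (of_int k) (fourier_mode (u t) (w t) k)"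
    unfolding 1 2 fu fw by (simp add: relax_gen_def fourier_mode_def scaleR_conv_of_real algebra_simps)
  finally show "((\<lambda>t. fourier_mode (u t) (w t) k) has_vector_derivative
      relax_gen b \<epsilon> (of_int k) (fourier_mode (u t) (w t) k)) (at t within {0..})" .
qed

text \<open>
  Both sides are the derivative of the same function of time at order \<open>j - 1\<close>, and
  derivatives relative to \<open>[0, \<infinity>)\<close> are unique.
\<close>
lemma fourier_mode_time_derivatives:
  assumes sol: "is_solution b \<epsilon> u w" and sm: "time_smooth m u" "time_smooth m w" and j: "j \<le> m" and t: "0 \<le> t"
  shows "fourier_mode ((dt ^^ j) u t) ((dt ^^ j) w t) k = (relax_gen b \<epsilon> (of_int k) ^^ j) (fourier_mode (u t) (w t) k)"
  using j t
proof (induction j arbitrary: t)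
  case (Suc j)
  let ?y = "\<lambda>t. fourier_mode (u t) (w t) k"
  let ?A = "relax_gen b \<epsilon> (of_int k)"
  have d: "((\<lambda>t. fourier_coeff ((dt ^^ j) v t) k) has_vector_derivative fourier_coeff ((dt ^^ Suc j) v t) k) (at t within {0..})"
    if sv: "time_smooth m v" for v
  proof -
    have df: "(\<lambda>s. (dt ^^ j) v s x) differentiable (at t within {0..})" if "0 \<le> t" for t x
      using sv that Suc.prems(1) unfolding time_smooth_def by (simp add: Suc_le_eq)
    have c: "continuous_on ({0..} \<times> UNIV) (\<lambda>(t, x). (dt ^^ j) v t x)"
      "continuous_on ({0..} \<times> UNIV) (\<lambda>(t, x). dt ((dt ^^ j) v) t x)"
    proof -
      have c: "\<forall>j\<le>m. continuous_on ({0..} \<times> UNIV) (\<lambda>(t, x). (dt ^^ j) v t x)"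
        using sv unfolding time_smooth_def by blast
      show "continuous_on ({0..} \<times> UNIV) (\<lambda>(t, x). (dt ^^ j) v t x)"
        using c Suc.prems(1) by simp
      show "continuous_on ({0..} \<times> UNIV) (\<lambda>(t, x). dt ((dt ^^ j) v) t x)"
        using spec[OF c, of "Suc j"] Suc.prems(1) by simp
    qed
    show ?thesis
      using fourier_coeff_has_vector_derivative[OF df c Suc.prems(2), of k] by simp
  qed
  have 1: "((\<lambda>t. fourier_mode ((dt ^^ j) u t) ((dt ^^ j) w t) k) has_vector_derivative
      fourier_mode ((dt ^^ Suc j) u t) ((dt ^^ Suc j) w t) k) (at t within {0..})"
    unfolding fourier_mode_def by (intro has_vector_derivative_Pair d sm)
  have 2: "((\<lambda>t. fourier_mode ((dt ^^ j) u t) ((dt ^^ j) w t) k) has_vector_derivative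
      (?A ^^ Suc j) (?y t)) (at t within {0..})"
    by (rule has_vector_derivative_transform[OF _ _ mode_solution_derivatives[OF fourier_mode_solution[OF sol] Suc.prems(2), of j]])
      (use Suc in auto)
  have "at t within {0..} \<noteq> bot"
  proof -
    have "({0..} :: real set) \<noteq> {x}" for x
    proof -
      have "(0::real) \<in> {0..}" "(1::real) \<in> {0..}" by auto
      then show ?thesis by (metis singletonD zero_neq_one)
    qed
    then show ?thesis
      using connected_imp_perfect[of "{0..}" t] Suc.prems(2) by (auto simp: trivial_limit_within)
  qed
  then show ?case
    using 1 2 by (rule vector_derivative_unique_within)
qed simp

lemma physical_energy_has_derivative:
  assumes sol: "is_solution b \<epsilon> u w" and t: "0 \<le> t"
  shows "((\<lambda>t. integral {0..2 * pi} (\<lambda>x. (1 - b\<^sup>2) * (cmod (u t x))\<^sup>2 + (cmod (w t x))\<^sup>2)) has_vector_derivative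
    - (2 / \<epsilon>) * integral {0..2 * pi} (\<lambda>x. (cmod (w t x))\<^sup>2)) (at t within {0..})"
proof -
  have U: "C1_periodic u" and W: "C1_periodic w" using sol by (auto simp: is_solution_def)
  note u = C1_periodicD[OF U] and w = C1_periodicD[OF W]
  define a where "a = 1 - b\<^sup>2"
  define g where "g = (\<lambda>t x. a * (u t x \<bullet> u t x) + w t x \<bullet> w t x)"
  define g' where "g' = (\<lambda>t x. a * (u t x \<bullet> dt u t x + dt u t x \<bullet> u t x) + (w t x \<bullet> dt w t x + dt w t x \<bullet> w t x))"
  note inner_deriv = bounded_bilinear.has_vector_derivative[OF bounded_bilinear_inner]
  have "((\<lambda>t. integral (cbox 0 (2 * pi)) (g t)) has_vector_derivative integral (cbox 0 (2 * pi)) (g' t)) (at t within {0..})"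
  proof (rule leibniz_rule_vector_derivative[where U = "{0..}"])
    show "((\<lambda>s. g s x) has_vector_derivative g' s x) (at s within {0..})" if "s \<in> {0..}" for s x
      unfolding g_def g'_def using that
      by (intro has_vector_derivative_add bounded_linear.has_vector_derivative[OF bounded_linear_mult_right]
        inner_deriv dt_works u w) auto
    show "g s integrable_on cbox 0 (2 * pi)" if "s \<in> {0..}" for s
      using that unfolding g_def
      by (auto intro!: integrable_continuous_interval continuous_intros continuous_slice[OF u(3)] continuous_slice[OF w(3)])
    have sub: "({0..} :: real set) \<times> cbox 0 (2 * pi) \<subseteq> {0..} \<times> UNIV" by auto
    show "continuous_on ({0..} \<times> cbox 0 (2 * pi)) (\<lambda>(s, x). g' s x)"
      unfolding g'_def case_prod_unfold
      by (intro continuous_intros continuous_on_subset[OF u(3)[unfolded case_prod_unfold] sub]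
        continuous_on_subset[OF u(4)[unfolded case_prod_unfold] sub]
        continuous_on_subset[OF w(3)[unfolded case_prod_unfold] sub]
        continuous_on_subset[OF w(4)[unfolded case_prod_unfold] sub])
  qed (use t in auto)
  moreover have "integral {0..2 * pi} (g' t) = - (2 / \<epsilon>) * integral {0..2 * pi} (\<lambda>x. (cmod (w t x))\<^sup>2)"
  proof -
    \<comment> \<open>The energy flux: the integral of its derivative over a period vanishes.\<close>
    define \<Phi> where "\<Phi> = (\<lambda>x. (a * b) * (u t x \<bullet> u t x) + (2 * a) * (u t x \<bullet> w t x) - b * (w t x \<bullet> w t x))"
    define \<Phi>' where "\<Phi>' = (\<lambda>x. (a * b) * (u t x \<bullet> dx (u t) x + dx (u t) x \<bullet> u t x)
      + (2 * a) * (u t x \<bullet> dx (w t) x + dx (u t) x \<bullet> w t x) - b * (w t x \<bullet> dx (w t) x + dx (w t) x \<bullet> w t x))"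
    have D: "(\<Phi>' has_integral \<Phi> (2 * pi) - \<Phi> 0) {0..2 * pi}"
    proof (rule fundamental_theorem_of_calculus)
      show "(\<Phi> has_vector_derivative \<Phi>' x) (at x within {0..2 * pi})" for x
        unfolding \<Phi>_def \<Phi>'_def
        by (intro has_vector_derivative_add has_vector_derivative_diff inner_deriv dx_works u(5) w(5) t
          bounded_linear.has_vector_derivative[OF bounded_linear_mult_right])
    qed simp
    have "\<Phi> (2 * pi) = \<Phi> 0"
      using u(1)[OF t, of 0] w(1)[OF t, of 0] by (simp add: \<Phi>_def)
    then have 0: "(\<Phi>' has_integral 0) {0..2 * pi}" using D by simp
    have 1: "((\<lambda>x. (2 / \<epsilon>) * (cmod (w t x))\<^sup>2) has_integral (2 / \<epsilon>) * integral {0..2 * pi} (\<lambda>x. (cmod (w t x))\<^sup>2)) {0..2 * pi}"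
      by (intro has_integral_mult_right integrable_integral integrable_continuous_interval continuous_intros
        continuous_slice[OF w(3) t])
    have "g' t x = - (\<Phi>' x + (2 / \<epsilon>) * (cmod (w t x))\<^sup>2)" for x
      unfolding g'_def \<Phi>'_def is_solution_equations[OF sol t] a_def[symmetric] dot_square_norm[symmetric]
      by (simp add: inner_complex_def algebra_simps add_divide_distrib)
    then have "g' t = (\<lambda>x. - (\<Phi>' x + (2 / \<epsilon>) * (cmod (w t x))\<^sup>2))" by auto
    then show ?thesis
      using has_integral_neg[OF has_integral_add[OF 0 1]] by (simp add: integral_unique)
  qed
  ultimately show ?thesis
    by (simp add: g_def a_def dot_square_norm)
qed

text \<open>
  The projection error energy is the total energy minus the energies of the modes up to \<open>N\<close>.
  Each dissipates at the rate \<open>2 / \<epsilon>\<close> times its \<open>w\<close>-part, so the difference dissipates at the rate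
  \<open>2 / \<epsilon>\<close> times the projection error of \<open>w\<close>, which is nonnegative.
\<close>
lemma projection_error_nonincreasing:
  assumes sol: "is_solution b \<epsilon> u w" and \<epsilon>: "0 < \<epsilon>" and st: "0 \<le> s" "s \<le> t"
  shows "(1 - b\<^sup>2) * proj_error_sq N (u t) + proj_error_sq N (w t)
    \<le> (1 - b\<^sup>2) * proj_error_sq N (u s) + proj_error_sq N (w s)"
proof -
  have U: "C1_periodic u" and W: "C1_periodic w" using sol by (auto simp: is_solution_def)
  note u = C1_periodicD[OF U] and w = C1_periodicD[OF W]
  define y where "y = (\<lambda>k t. fourier_mode (u t) (w t) k)"
  have y: "mode_solution b \<epsilon> (of_int k) (y k)" for k
    unfolding y_def by (rule fourier_mode_solution[OF sol])
  define f where "f = (\<lambda>t. integral {0..2 * pi} (\<lambda>x. (1 - b\<^sup>2) * (cmod (u t x))\<^sup>2 + (cmod (w t x))\<^sup>2)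
    - 2 * pi * (\<Sum>k\<in>{- int N..int N}. energy b (y k t)))"
  have f: "f t = (1 - b\<^sup>2) * proj_error_sq N (u t) + proj_error_sq N (w t)" if "0 \<le> t" for t
  proof -
    note cs = continuous_slice[OF u(3) that] continuous_slice[OF w(3) that]
    have "integral {0..2 * pi} (\<lambda>x. (1 - b\<^sup>2) * (cmod (u t x))\<^sup>2 + (cmod (w t x))\<^sup>2)
        = (1 - b\<^sup>2) * integral {0..2 * pi} (\<lambda>x. (cmod (u t x))\<^sup>2) + integral {0..2 * pi} (\<lambda>x. (cmod (w t x))\<^sup>2)"
      by (intro integral_unique has_integral_add has_integral_mult_right integrable_integral
        integrable_continuous_interval continuous_intros cs)
    moreover have "(\<Sum>k\<in>{- int N..int N}. energy b (y k t))
        = (1 - b\<^sup>2) * (\<Sum>k\<in>{- int N..int N}. (cmod (fourier_coeff (u t) k))\<^sup>2)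
          + (\<Sum>k\<in>{- int N..int N}. (cmod (fourier_coeff (w t) k))\<^sup>2)"
      by (simp add: y_def fourier_mode_def energy_def sum.distrib sum_distrib_left)
    moreover have "a * p + p' - r * (a * z + z') = a * (p - r * z) + (p' - r * z')" for a p p' r z z' :: real
      by (simp add: algebra_simps)
    ultimately show ?thesis
      unfolding f_def proj_error_sq_eq[OF cs(1)] proj_error_sq_eq[OF cs(2)] by (simp only:)
  qed
  have "f t \<le> f s"
  proof (rule nonincreasing_if_derivative_nonpos[OF _ _ st])
    fix r :: real assume r: "0 \<le> r"
    show "(f has_vector_derivative - (2 / \<epsilon>) * integral {0..2 * pi} (\<lambda>x. (cmod (w r x))\<^sup>2)
        - 2 * pi * (\<Sum>k\<in>{- int N..int N}. - (2 / \<epsilon>) * (cmod (snd (y k r)))\<^sup>2)) (at r within {0..})"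
      unfolding f_def
      by (intro has_vector_derivative_diff physical_energy_has_derivative[OF sol r]
        bounded_linear.has_vector_derivative[OF bounded_linear_mult_right] has_vector_derivative_sum
        energy_has_derivative[OF y r])
    have "- (2 / \<epsilon>) * integral {0..2 * pi} (\<lambda>x. (cmod (w r x))\<^sup>2)
        - 2 * pi * (\<Sum>k\<in>{- int N..int N}. - (2 / \<epsilon>) * (cmod (snd (y k r)))\<^sup>2)
      = - (2 / \<epsilon>) * proj_error_sq N (w r)"
      unfolding proj_error_sq_eq[OF continuous_slice[OF w(3) r]] sum_distrib_left[symmetric]
      by (simp add: y_def fourier_mode_def algebra_simps)
    also have "\<dots> \<le> 0" using \<epsilon> by (simp add: proj_error_sq_def)
    finally show "- (2 / \<epsilon>) * integral {0..2 * pi} (\<lambda>x. (cmod (w r x))\<^sup>2)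
        - 2 * pi * (\<Sum>k\<in>{- int N..int N}. - (2 / \<epsilon>) * (cmod (snd (y k r)))\<^sup>2) \<le> 0" .
  qed
  then show ?thesis using f st by simp
qed

section \<open>The scheme in Fourier modes and its consistency\<close>

lemma trig_sum_add: "trig_sum N c x + trig_sum N d x = trig_sum N (\<lambda>k. c k + d k) x"
  by (simp add: trig_sum_def sum.distrib distrib_right)

lemma trig_sum_diff: "trig_sum N c x - trig_sum N d x = trig_sum N (\<lambda>k. c k - d k) x"
  by (simp add: trig_sum_def sum_subtractf left_diff_distrib)

lemma trig_sum_scaleR: "r *\<^sub>R trig_sum N c x = trig_sum N (\<lambda>k. r *\<^sub>R c k) x"
  by (simp add: trig_sum_def scaleR_sum_right)

lemma trig_sum_sum: "(\<Sum>i\<in>I. trig_sum N (c i) x) = trig_sum N (\<lambda>k. \<Sum>i\<in>I. c i k) x"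
  unfolding trig_sum_def sum_distrib_right by (rule sum.swap)

lemma trig_sum_eq_zeroD:
  assumes "\<And>x. trig_sum N c x = 0" "k \<in> {- int N..int N}"
  shows "c k = 0"
proof -
  have "trig_sum N c = (\<lambda>_. 0)" using assms(1) by auto
  then show ?thesis
    using fourier_coeff_trig_sum[OF assms(2), of c] by (simp add: fourier_coeff_def)
qed

lemma trig_sum_has_vector_derivative:
  "(trig_sum N c has_vector_derivative trig_sum N (\<lambda>k. \<i> * of_int k * c k) x) (at x)"
proof -
  have "((\<lambda>x. \<Sum>k\<in>{- int N..int N}. c k * cis (of_int k * x)) has_vector_derivative
      (\<Sum>k\<in>{- int N..int N}. c k * (\<i> * of_real (of_int k) * cis (of_int k * x)))) (at x)"
    by (intro has_vector_derivative_sum has_vector_derivative_mult_right cis_has_vector_derivative)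
  then show ?thesis
    unfolding trig_sum_def[abs_def] by (simp add: mult_ac)
qed

lemma trig_polys_eq_trig_sum:
  assumes "f \<in> trig_polys N"
  shows "f = trig_sum N (fourier_coeff f)"
proof -
  obtain c where c: "f = trig_sum N c"
    using assms by (auto simp: trig_polys_def trig_sum_def[abs_def])
  have "trig_sum N (fourier_coeff (trig_sum N c)) = trig_sum N c"
    unfolding trig_sum_def[of N "fourier_coeff _"] trig_sum_def[of N c, abs_def, symmetric]
    by (rule ext) (simp add: fourier_coeff_trig_sum trig_sum_def)
  then show ?thesis by (simp add: c)
qed

lemma dx_trig_combination:
  "dx (\<lambda>y. r *\<^sub>R trig_sum N c y + s *\<^sub>R trig_sum N d y) x
    = trig_sum N (\<lambda>k. \<i> * of_int k * (r *\<^sub>R c k + s *\<^sub>R d k)) x"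
proof -
  have "(\<lambda>y. r *\<^sub>R trig_sum N c y + s *\<^sub>R trig_sum N d y) = trig_sum N (\<lambda>k. r *\<^sub>R c k + s *\<^sub>R d k)"
    by (rule ext) (simp only: trig_sum_scaleR trig_sum_add)
  then show ?thesis
    unfolding dx_def by (simp only: vector_derivative_at[OF trig_sum_has_vector_derivative])
qed

lemma imex_bdf_modes:
  assumes sch: "imex_bdf q b \<epsilon> N h U W" and k: "k \<in> {- int N..int N}"
  shows "imex_mode_step q b (h * of_int k) (bdf_beta q * h / \<epsilon>) h
    (\<lambda>i. fourier_coeff (U (n + i)) k) (\<lambda>i. fourier_coeff (W (n + i)) k) 0 0"
proof -
  define Uc Wc where "Uc = (\<lambda>n. fourier_coeff (U n))" and "Wc = (\<lambda>n. fourier_coeff (W n))"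
  have U: "U n = trig_sum N (Uc n)" and W: "W n = trig_sum N (Wc n)" for n
    using sch trig_polys_eq_trig_sum by (auto simp: imex_bdf_def Uc_def Wc_def)
  have dU: "dx (\<lambda>y. b *\<^sub>R U n y + W n y) x = trig_sum N (\<lambda>k. \<i> * of_int k * (b *\<^sub>R Uc n k + 1 *\<^sub>R Wc n k)) x" for n x
    using dx_trig_combination[of b N "Uc n" 1 "Wc n" x] by (simp add: U W)
  have dW: "dx (\<lambda>y. (1 - b\<^sup>2) *\<^sub>R U n y - b *\<^sub>R W n y) x
      = trig_sum N (\<lambda>k. \<i> * of_int k * ((1 - b\<^sup>2) *\<^sub>R Uc n k + (- b) *\<^sub>R Wc n k)) x" for n x
    using dx_trig_combination[of "1 - b\<^sup>2" N "Uc n" "- b" "Wc n" x] by (simp add: U W)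
  have s: "(\<Sum>i=0..q. bdf_alpha q i *\<^sub>R U (n + i) x)
      + h *\<^sub>R (\<Sum>i<q. bdf_gamma q i *\<^sub>R dx (\<lambda>y. b *\<^sub>R U (n + i) y + W (n + i) y) x) = 0"
    "(\<Sum>i=0..q. bdf_alpha q i *\<^sub>R W (n + i) x)
      + h *\<^sub>R (\<Sum>i<q. bdf_gamma q i *\<^sub>R dx (\<lambda>y. (1 - b\<^sup>2) *\<^sub>R U (n + i) y - b *\<^sub>R W (n + i) y) x)
      = - (bdf_beta q * h / \<epsilon>) *\<^sub>R W (n + q) x" for x
    using sch by (auto simp: imex_bdf_def)
  have 1: "trig_sum N (\<lambda>k. (\<Sum>i=0..q. bdf_alpha q i *\<^sub>R Uc (n + i) k)
      + h *\<^sub>R (\<Sum>i<q. bdf_gamma q i *\<^sub>R (\<i> * of_int k * (b *\<^sub>R Uc (n + i) k + 1 *\<^sub>R Wc (n + i) k)))) x = 0" for x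
    using s(1)[of x] unfolding dU unfolding U by (simp only: trig_sum_add trig_sum_scaleR trig_sum_sum)
  have 2: "trig_sum N (\<lambda>k. (\<Sum>i=0..q. bdf_alpha q i *\<^sub>R Wc (n + i) k)
      + h *\<^sub>R (\<Sum>i<q. bdf_gamma q i *\<^sub>R (\<i> * of_int k * ((1 - b\<^sup>2) *\<^sub>R Uc (n + i) k + (- b) *\<^sub>R Wc (n + i) k)))
      - (- (bdf_beta q * h / \<epsilon>)) *\<^sub>R Wc (n + q) k) x = 0" for x
  proof -
    have "(\<Sum>i=0..q. bdf_alpha q i *\<^sub>R W (n + i) x)
      + h *\<^sub>R (\<Sum>i<q. bdf_gamma q i *\<^sub>R dx (\<lambda>y. (1 - b\<^sup>2) *\<^sub>R U (n + i) y - b *\<^sub>R W (n + i) y) x)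
      - (- (bdf_beta q * h / \<epsilon>)) *\<^sub>R W (n + q) x = 0"
      using s(2)[of x] by simp
    then show ?thesis
      unfolding dW unfolding W by (simp only: trig_sum_add trig_sum_diff trig_sum_scaleR trig_sum_sum)
  qed
  have lin: "h *\<^sub>R (\<Sum>i<q. bdf_gamma q i *\<^sub>R (\<i> * of_int k * (r *\<^sub>R f i + s *\<^sub>R g i)))
      = \<i> * of_real (h * of_int k) * (of_real r * (\<Sum>i<q. bdf_gamma q i *\<^sub>R f i) + of_real s * (\<Sum>i<q. bdf_gamma q i *\<^sub>R g i))"
    for r s :: real and f g :: "nat \<Rightarrow> complex"
    by (simp add: sum_distrib_left sum.distrib scaleR_conv_of_real algebra_simps)
  show ?thesis
    using trig_sum_eq_zeroD[OF 1 k] trig_sum_eq_zeroD[OF 2 k]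
    unfolding lin imex_mode_step_def Let_def Uc_def Wc_def by simp
qed

lemma imex_mode_step_diff:
  assumes "imex_mode_step q b r \<eta> h E D \<tau> \<sigma>" "imex_mode_step q b r \<eta> h E' D' 0 0"
  shows "imex_mode_step q b r \<eta> h (\<lambda>i. E i - E' i) (\<lambda>i. D i - D' i) \<tau> \<sigma>"
proof -
  have lin: "(X - X') + \<i> * of_real r * (s * (Y - Y') + (Z - Z')) = P"
    if "X + \<i> * of_real r * (s * Y + Z) = P" "X' + \<i> * of_real r * (s * Y' + Z') = h *\<^sub>R 0"
    for X X' Y Y' Z Z' s P :: complex
  proof -
    have "(X - X') + \<i> * of_real r * (s * (Y - Y') + (Z - Z'))
        = (X + \<i> * of_real r * (s * Y + Z)) - (X' + \<i> * of_real r * (s * Y' + Z'))"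
      by (simp add: algebra_simps)
    then show ?thesis using that by simp
  qed
  have lin2: "(X - X') + \<i> * of_real r * (s * (Y - Y') - u * (Z - Z')) + (\<eta> *\<^sub>R V - \<eta> *\<^sub>R V') = P"
    if "X + \<i> * of_real r * (s * Y - u * Z) + \<eta> *\<^sub>R V = P" "X' + \<i> * of_real r * (s * Y' - u * Z') + \<eta> *\<^sub>R V' = h *\<^sub>R 0"
    for X X' Y Y' Z Z' s u V V' P :: complex
  proof -
    have "(X - X') + \<i> * of_real r * (s * (Y - Y') - u * (Z - Z')) + (\<eta> *\<^sub>R V - \<eta> *\<^sub>R V')
        = (X + \<i> * of_real r * (s * Y - u * Z) + \<eta> *\<^sub>R V) - (X' + \<i> * of_real r * (s * Y' - u * Z') + \<eta> *\<^sub>R V')"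
      by (simp add: algebra_simps)
    then show ?thesis using that by simp
  qed
  show ?thesis
    using assms unfolding imex_mode_step_def Let_def scaleR_diff_right sum_subtractf
    by (intro conjI lin lin2) blast+
qed

text \<open>
  The residual is split into the truncation error of the BDF operator and \<open>k\<close> times that of the
  extrapolation by inserting the equation at the new time level. In the second component this
  removes the stiff term exactly, so that \<open>C\<close> is independent of \<open>\<epsilon>\<close>.
\<close>
lemma mode_consistency:
  assumes q: "q \<in> {1, 2, 3, 4}" and b: "\<bar>b\<bar> \<le> 1"
  obtains C where "C \<ge> 0"
    "\<And>\<epsilon> \<kappa> y h T0 D. \<lbrakk>0 < \<epsilon>; mode_solution b \<epsilon> \<kappa> y; 0 < h; 0 \<le> T0;
      \<And>r. T0 \<le> r \<Longrightarrow> norm ((relax_gen b \<epsilon> \<kappa> ^^ (q + 1)) (y r)) \<le> D \<and> \<bar>\<kappa>\<bar> * norm ((relax_gen b \<epsilon> \<kappa> ^^ q) (y r)) \<le> D\<rbrakk> \<Longrightarrow>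
      \<exists>\<tau> \<sigma>. \<forall>n. imex_mode_step q b (h * \<kappa>) (bdf_beta q * h / \<epsilon>) h
          (\<lambda>i. fst (y (T0 + real (n + i) * h))) (\<lambda>i. snd (y (T0 + real (n + i) * h))) (\<tau> n) (\<sigma> n) \<and>
        (cmod (\<tau> n))\<^sup>2 + (cmod (\<sigma> n))\<^sup>2 \<le> C * (h ^ (2 * q) * D\<^sup>2)"
proof -
  obtain C1 where C1: "C1 \<ge> 0"
    "\<And>(Y :: nat \<Rightarrow> real \<Rightarrow> complex) t h M.
      \<lbrakk>\<And>j t. 0 \<le> t \<Longrightarrow> (Y j has_vector_derivative Y (Suc j) t) (at t within {0..});
       \<And>r. r \<ge> t \<Longrightarrow> cmod (Y (q + 1) r) \<le> M; 0 \<le> t; 0 \<le> h\<rbrakk> \<Longrightarrow>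
      cmod ((\<Sum>i=0..q. bdf_alpha q i *\<^sub>R Y 0 (t + real i * h)) - (bdf_beta q * h) *\<^sub>R Y 1 (t + real q * h))
        \<le> C1 * (h ^ (q + 1) * M)"
    using bdf_derivative_truncation[OF q] by blast
  obtain C2 where C2: "C2 \<ge> 0"
    "\<And>(Y :: nat \<Rightarrow> real \<Rightarrow> complex) t h M.
      \<lbrakk>\<And>j t. 0 \<le> t \<Longrightarrow> (Y j has_vector_derivative Y (Suc j) t) (at t within {0..});
       \<And>r. r \<ge> t \<Longrightarrow> cmod (Y q r) \<le> M; 0 \<le> t; 0 \<le> h\<rbrakk> \<Longrightarrow>
      cmod ((\<Sum>i<q. bdf_gamma q i *\<^sub>R Y 0 (t + real i * h)) - bdf_beta q *\<^sub>R Y 0 (t + real q * h))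
        \<le> C2 * (h ^ q * M)"
    using bdf_extrapolation_truncation[OF q] by blast
  define C where "C = C1 + 2 * C2"
  have C: "C \<ge> 0" using C1 C2 by (simp add: C_def)
  show ?thesis
  proof
    show "0 \<le> 2 * C\<^sup>2" by simp
    fix \<epsilon> \<kappa> h T0 D :: real and y :: "real \<Rightarrow> complex \<times> complex"
    assume \<epsilon>: "0 < \<epsilon>" and y: "mode_solution b \<epsilon> \<kappa> y" and h: "0 < h" and T0: "0 \<le> T0"
      and D: "\<And>r. T0 \<le> r \<Longrightarrow> norm ((relax_gen b \<epsilon> \<kappa> ^^ (q + 1)) (y r)) \<le> D \<and> \<bar>\<kappa>\<bar> * norm ((relax_gen b \<epsilon> \<kappa> ^^ q) (y r)) \<le> D"
    let ?A = "relax_gen b \<epsilon> \<kappa>"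
    define X where "X = (\<lambda>j t. fst ((?A ^^ j) (y t)))"
    define Z where "Z = (\<lambda>j t. snd ((?A ^^ j) (y t)))"
    have dX: "(X j has_vector_derivative X (Suc j) t) (at t within {0..})" if "0 \<le> t" for j t
      unfolding X_def by (rule bounded_linear.has_vector_derivative[OF bounded_linear_fst mode_solution_derivatives[OF y that]])
    have dZ: "(Z j has_vector_derivative Z (Suc j) t) (at t within {0..})" if "0 \<le> t" for j t
      unfolding Z_def by (rule bounded_linear.has_vector_derivative[OF bounded_linear_snd mode_solution_derivatives[OF y that]])
    have X1: "X 1 t = - (\<i> * of_real \<kappa> * (of_real b * X 0 t + Z 0 t))" for t
      by (simp add: X_def Z_def relax_gen_def split: prod.splits)
    have Z1: "Z 1 t = - (\<i> * of_real \<kappa> * (of_real (1 - b\<^sup>2) * X 0 t - of_real b * Z 0 t)) - Z 0 t / of_real \<epsilon>" for t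
      by (simp add: X_def Z_def relax_gen_def split: prod.splits)
    have nX: "cmod (X j t) \<le> norm ((?A ^^ j) (y t))" and nZ: "cmod (Z j t) \<le> norm ((?A ^^ j) (y t))" for j t
      unfolding X_def Z_def using norm_fst_le[of "fst ((?A ^^ j) (y t))" "snd ((?A ^^ j) (y t))"]
        norm_snd_le[of "snd ((?A ^^ j) (y t))" "fst ((?A ^^ j) (y t))"] by simp_all
    have D0: "0 \<le> D" using D[of T0] norm_ge_zero order_trans by blast
    define \<eta> where "\<eta> = bdf_beta q * h / \<epsilon>"
    define t where "t = (\<lambda>n. T0 + real n * h)"
    have tq: "t (n + i) = t n + real i * h" for n i by (simp add: t_def algebra_simps)
    have t0: "T0 \<le> t n" "0 \<le> t n" for n using T0 h by (auto simp: t_def)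
    \<comment> \<open>The hypotheses bound \<open>\<kappa>\<close> times the \<open>q\<close>-th derivatives, so the mode \<open>\<kappa> = 0\<close>, where they say nothing
        about these derivatives, is treated separately.\<close>
    have coup: "\<bar>\<kappa>\<bar> * cmod ((\<Sum>i<q. bdf_gamma q i *\<^sub>R (of_real s * X 0 (t (n + i)) + of_real s' * Z 0 (t (n + i))))
        - bdf_beta q *\<^sub>R (of_real s * X 0 (t (n + q)) + of_real s' * Z 0 (t (n + q)))) \<le> 2 * C2 * (h ^ q * D)"
      if s: "\<bar>s\<bar> \<le> 1" "\<bar>s'\<bar> \<le> 1" for s s' :: real and n
    proof (cases "\<kappa> = 0")
      case False
      define F where "F = (\<lambda>j t. of_real s * X j t + of_real s' * Z j t)"
      have "cmod ((\<Sum>i<q. bdf_gamma q i *\<^sub>R F 0 (t n + real i * h)) - bdf_beta q *\<^sub>R F 0 (t n + real q * h))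
          \<le> C2 * (h ^ q * (2 * D / \<bar>\<kappa>\<bar>))"
      proof (rule C2(2)[OF _ _ t0(2)])
        show "(F j has_vector_derivative F (Suc j) t) (at t within {0..})" if "0 \<le> t" for j t
          unfolding F_def by (intro has_vector_derivative_add has_vector_derivative_mult_right dX dZ that)
        show "cmod (F q r) \<le> 2 * D / \<bar>\<kappa>\<bar>" if "t n \<le> r" for r
        proof -
          have "cmod (F q r) \<le> cmod (X q r) + cmod (Z q r)"
            unfolding F_def by (rule cmod_combination_le[OF s])
          also have "\<dots> \<le> 2 * norm ((?A ^^ q) (y r))" using nX[of q r] nZ[of q r] by simp
          finally have "\<bar>\<kappa>\<bar> * cmod (F q r) \<le> \<bar>\<kappa>\<bar> * (2 * norm ((?A ^^ q) (y r)))"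
            by (intro mult_left_mono) auto
          also have "\<dots> \<le> 2 * D" using D[of r] t0(1)[of n] that by auto
          finally show ?thesis using False by (simp add: field_simps)
        qed
      qed (use h in simp)
      then have "\<bar>\<kappa>\<bar> * cmod ((\<Sum>i<q. bdf_gamma q i *\<^sub>R F 0 (t n + real i * h)) - bdf_beta q *\<^sub>R F 0 (t n + real q * h))
          \<le> \<bar>\<kappa>\<bar> * (C2 * (h ^ q * (2 * D / \<bar>\<kappa>\<bar>)))"
        by (intro mult_left_mono) auto
      also have "\<dots> = 2 * C2 * (h ^ q * D)" using False by simp
      finally show ?thesis by (simp add: F_def tq)
    qed (use C2(1) h D0 in simp)
    have trX: "cmod ((\<Sum>i=0..q. bdf_alpha q i *\<^sub>R X 0 (t n + real i * h)) - (bdf_beta q * h) *\<^sub>R X 1 (t n + real q * h))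
        \<le> C1 * (h ^ (q + 1) * D)" for n
    proof (rule C1(2)[where Y = X and t = "t n" and h = h and M = D])
      show "cmod (X (q + 1) r) \<le> D" if "t n \<le> r" for r
        using nX[of "q + 1" r] D[of r] t0(1)[of n] that by (meson order_trans)
    qed (use h t0 dX in auto)
    have trZ: "cmod ((\<Sum>i=0..q. bdf_alpha q i *\<^sub>R Z 0 (t n + real i * h)) - (bdf_beta q * h) *\<^sub>R Z 1 (t n + real q * h))
        \<le> C1 * (h ^ (q + 1) * D)" for n
    proof (rule C1(2)[where Y = Z and t = "t n" and h = h and M = D])
      show "cmod (Z (q + 1) r) \<le> D" if "t n \<le> r" for r
        using nZ[of "q + 1" r] D[of r] t0(1)[of n] that by (meson order_trans)
    qed (use h t0 dZ in auto)
    define \<rho>1 where "\<rho>1 = (\<lambda>n. (\<Sum>i=0..q. bdf_alpha q i *\<^sub>R X 0 (t (n + i)))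
      + \<i> * of_real (h * \<kappa>) * (of_real b * (\<Sum>i<q. bdf_gamma q i *\<^sub>R X 0 (t (n + i))) + (\<Sum>i<q. bdf_gamma q i *\<^sub>R Z 0 (t (n + i)))))"
    define \<rho>2 where "\<rho>2 = (\<lambda>n. (\<Sum>i=0..q. bdf_alpha q i *\<^sub>R Z 0 (t (n + i)))
      + \<i> * of_real (h * \<kappa>) * (of_real (1 - b\<^sup>2) * (\<Sum>i<q. bdf_gamma q i *\<^sub>R X 0 (t (n + i))) - of_real b * (\<Sum>i<q. bdf_gamma q i *\<^sub>R Z 0 (t (n + i))))
      + \<eta> *\<^sub>R Z 0 (t (n + q)))"
    have split: "(\<Sum>i<q. bdf_gamma q i *\<^sub>R (of_real s * f i + of_real s' * g i))
        = of_real s * (\<Sum>i<q. bdf_gamma q i *\<^sub>R f i) + of_real s' * (\<Sum>i<q. bdf_gamma q i *\<^sub>R g i)"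
      for s s' :: real and f g :: "nat \<Rightarrow> complex"
      by (simp add: sum_distrib_left sum.distrib scaleR_conv_of_real algebra_simps)
    have comb: "cmod (a + \<i> * of_real (h * \<kappa>) * p) \<le> h * (C * (h ^ q * D))"
      if "cmod a \<le> C1 * (h ^ (q + 1) * D)" "\<bar>\<kappa>\<bar> * cmod p \<le> 2 * C2 * (h ^ q * D)" for a p :: complex
    proof -
      have "cmod (a + \<i> * of_real (h * \<kappa>) * p) \<le> cmod a + h * (\<bar>\<kappa>\<bar> * cmod p)"
        using norm_triangle_ineq[of a "\<i> * of_real (h * \<kappa>) * p"] h by (simp add: norm_mult abs_mult)
      also have "\<dots> \<le> C1 * (h ^ (q + 1) * D) + h * (2 * C2 * (h ^ q * D))"
        using that h by (intro add_mono mult_left_mono) auto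
      also have "\<dots> = h * (C * (h ^ q * D))" by (simp add: C_def algebra_simps)
      finally show ?thesis .
    qed
    have \<rho>1: "cmod (\<rho>1 n) \<le> h * (C * (h ^ q * D))" for n
    proof -
      have "\<rho>1 n = ((\<Sum>i=0..q. bdf_alpha q i *\<^sub>R X 0 (t n + real i * h)) - (bdf_beta q * h) *\<^sub>R X 1 (t n + real q * h))
        + \<i> * of_real (h * \<kappa>) * ((\<Sum>i<q. bdf_gamma q i *\<^sub>R (of_real b * X 0 (t (n + i)) + of_real 1 * Z 0 (t (n + i))))
        - bdf_beta q *\<^sub>R (of_real b * X 0 (t (n + q)) + of_real 1 * Z 0 (t (n + q))))"
        unfolding split X1 \<rho>1_def tq[symmetric] by (simp add: scaleR_conv_of_real algebra_simps)
      also have "cmod \<dots> \<le> h * (C * (h ^ q * D))"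
        by (rule comb[OF trX coup]) (use b in auto)
      finally show ?thesis .
    qed
    have \<rho>2: "cmod (\<rho>2 n) \<le> h * (C * (h ^ q * D))" for n
    proof -
      have "\<rho>2 n = ((\<Sum>i=0..q. bdf_alpha q i *\<^sub>R Z 0 (t n + real i * h)) - (bdf_beta q * h) *\<^sub>R Z 1 (t n + real q * h))
        + \<i> * of_real (h * \<kappa>) * ((\<Sum>i<q. bdf_gamma q i *\<^sub>R (of_real (1 - b\<^sup>2) * X 0 (t (n + i)) + of_real (- b) * Z 0 (t (n + i))))
        - bdf_beta q *\<^sub>R (of_real (1 - b\<^sup>2) * X 0 (t (n + q)) + of_real (- b) * Z 0 (t (n + q))))"
        unfolding split Z1 \<rho>2_def tq[symmetric] \<eta>_def using \<epsilon> by (simp add: scaleR_conv_of_real algebra_simps)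
      also have "cmod \<dots> \<le> h * (C * (h ^ q * D))"
        by (rule comb[OF trZ coup]) (use b in \<open>auto simp: abs_square_le_1\<close>)
      finally show ?thesis .
    qed
    define \<tau> \<sigma> where "\<tau> = (\<lambda>n. (1 / h) *\<^sub>R \<rho>1 n)" and "\<sigma> = (\<lambda>n. (1 / h) *\<^sub>R \<rho>2 n)"
    have "imex_mode_step q b (h * \<kappa>) \<eta> h (\<lambda>i. X 0 (t (n + i))) (\<lambda>i. Z 0 (t (n + i))) (\<tau> n) (\<sigma> n)" for n
      using h by (simp add: imex_mode_step_def Let_def \<tau>_def \<sigma>_def \<rho>1_def \<rho>2_def)
    moreover have "(cmod (\<tau> n))\<^sup>2 + (cmod (\<sigma> n))\<^sup>2 \<le> 2 * C\<^sup>2 * (h ^ (2 * q) * D\<^sup>2)" for n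
    proof -
      have "cmod (\<tau> n) \<le> C * (h ^ q * D)" "cmod (\<sigma> n) \<le> C * (h ^ q * D)"
        using \<rho>1[of n] \<rho>2[of n] h by (simp_all add: \<tau>_def \<sigma>_def field_simps)
      then have "(cmod (\<tau> n))\<^sup>2 + (cmod (\<sigma> n))\<^sup>2 \<le> (C * (h ^ q * D))\<^sup>2 + (C * (h ^ q * D))\<^sup>2"
        by (intro add_mono power_mono) auto
      also have "\<dots> = 2 * C\<^sup>2 * (h ^ (2 * q) * D\<^sup>2)"
        by (simp add: power_mult_distrib power_mult[symmetric] mult.commute[of q])
      finally show ?thesis .
    qed
    ultimately show "\<exists>\<tau> \<sigma>. \<forall>n. imex_mode_step q b (h * \<kappa>) (bdf_beta q * h / \<epsilon>) h
          (\<lambda>i. fst (y (T0 + real (n + i) * h))) (\<lambda>i. snd (y (T0 + real (n + i) * h))) (\<tau> n) (\<sigma> n) \<and>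
        (cmod (\<tau> n))\<^sup>2 + (cmod (\<sigma> n))\<^sup>2 \<le> 2 * C\<^sup>2 * (h ^ (2 * q) * D\<^sup>2)"
      by (intro exI[of _ \<tau>] exI[of _ \<sigma>]) (simp add: X_def Z_def t_def \<eta>_def)
  qed
qed

section \<open>Bounds on the data and the error estimate\<close>

lemma sobolev_finite_sum_le:
  assumes "f \<in> sobolev s" "finite F"
  shows "(\<Sum>k\<in>F. (1 + (of_int k)\<^sup>2) ^ s * (cmod (fourier_coeff f k))\<^sup>2) \<le> (sobolev_norm s f)\<^sup>2"
proof -
  let ?g = "\<lambda>k :: int. (1 + (of_int k)\<^sup>2) ^ s * (cmod (fourier_coeff f k))\<^sup>2 :: real"
  have nn: "0 \<le> ?g k" for k by (intro mult_nonneg_nonneg zero_le_power) auto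
  have "sum ?g F \<le> infsum ?g UNIV"
    using assms nn by (intro finite_sum_le_infsum) (auto simp: sobolev_def)
  also have "\<dots> \<le> 2 * pi * infsum ?g UNIV"
  proof -
    have "1 * infsum ?g UNIV \<le> (2 * pi) * infsum ?g UNIV"
      using pi_gt3 nn by (intro mult_right_mono infsum_nonneg) auto
    then show ?thesis by simp
  qed
  also have "\<dots> = (sobolev_norm s f)\<^sup>2"
    unfolding sobolev_norm_def using nn
    by (intro real_sqrt_pow2[symmetric] mult_nonneg_nonneg infsum_nonneg) auto
  finally show ?thesis .
qed

lemma sobolev_norm_nonneg: "0 \<le> sobolev_norm s f"
proof -
  have "0 \<le> (\<Sum>\<^sub>\<infinity>k :: int. (1 + (of_int k)\<^sup>2) ^ s * (cmod (fourier_coeff f k))\<^sup>2 :: real)"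
    by (intro infsum_nonneg mult_nonneg_nonneg zero_le_power) auto
  then show ?thesis by (simp add: sobolev_norm_def)
qed

text \<open>
  The two quantities that the consistency error of one mode requires from time \<open>T0\<close> on.
\<close>
definition derivative_bounds ::
  "nat \<Rightarrow> real \<Rightarrow> real \<Rightarrow> real \<Rightarrow> (real \<Rightarrow> complex \<times> complex) \<Rightarrow> real \<Rightarrow> real \<Rightarrow> bool" where
  "derivative_bounds q b \<epsilon> \<kappa> y T0 D \<longleftrightarrow>
    (\<forall>r\<ge>T0. norm ((relax_gen b \<epsilon> \<kappa> ^^ (q + 1)) (y r)) \<le> D \<and> \<bar>\<kappa>\<bar> * norm ((relax_gen b \<epsilon> \<kappa> ^^ q) (y r)) \<le> D)"

lemma power2_norm_fourier_mode: "(norm (fourier_mode f g k))\<^sup>2 = (cmod (fourier_coeff f k))\<^sup>2 + (cmod (fourier_coeff g k))\<^sup>2"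
  by (simp add: fourier_mode_def norm_Pair)

lemma sobolev_mode_sum_le:
  assumes "f \<in> sobolev s" "g \<in> sobolev s" "finite F"
  shows "(\<Sum>k\<in>F. (1 + (of_int k)\<^sup>2) ^ s * (norm (fourier_mode f g k))\<^sup>2) \<le> (sobolev_norm s f)\<^sup>2 + (sobolev_norm s g)\<^sup>2"
  using sobolev_finite_sum_le[OF assms(1,3)] sobolev_finite_sum_le[OF assms(2,3)]
  by (simp add: power2_norm_fourier_mode distrib_left sum.distrib)

text \<open>
  The time derivatives of a mode solve the same ODE, so the energy bounds them for all times by
  their values at time zero.
\<close>
lemma derivative_bounds_of_time_derivatives:
  assumes sol: "is_solution b \<epsilon> u w" and b: "\<bar>b\<bar> < 1" and \<epsilon>: "0 < \<epsilon>" and T0: "0 \<le> T0"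
    and B: "bounded_time_derivs q K u w"
  shows "\<exists>D. (\<forall>k :: int. derivative_bounds q b \<epsilon> k (\<lambda>t. fourier_mode (u t) (w t) k) T0 (D k)) \<and>
    (\<forall>N. (\<Sum>k\<in>{- int N..int N}. (D k)\<^sup>2) \<le> 4 / (1 - b\<^sup>2)\<^sup>2 * K\<^sup>2)"
proof -
  define a where "a = 1 - b\<^sup>2"
  have a: "0 < a" using b by (auto simp: a_def abs_square_less_1)
  define p where "p = (\<lambda>k. fourier_mode ((dt ^^ (q + 1)) u 0) ((dt ^^ (q + 1)) w 0) k)"
  define p' where "p' = (\<lambda>k. fourier_mode ((dt ^^ q) u 0) ((dt ^^ q) w 0) k)"
  have sm: "time_smooth (q + 1) u" "time_smooth (q + 1) w"
    and s1: "(dt ^^ (q + 1)) u 0 \<in> sobolev 1" "(dt ^^ (q + 1)) w 0 \<in> sobolev 1"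
    and n1: "sobolev_norm 1 ((dt ^^ (q + 1)) u 0) + sobolev_norm 1 ((dt ^^ (q + 1)) w 0) \<le> K"
    and s2: "(dt ^^ q) u 0 \<in> sobolev 2" "(dt ^^ q) w 0 \<in> sobolev 2"
    and n2: "sobolev_norm 2 ((dt ^^ q) u 0) + sobolev_norm 2 ((dt ^^ q) w 0) \<le> K"
    using B unfolding bounded_time_derivs_def by blast+
  have sq: "x\<^sup>2 + z\<^sup>2 \<le> K\<^sup>2" if "x + z \<le> K" "0 \<le> x" "0 \<le> z" for x z :: real
  proof -
    have "x\<^sup>2 + z\<^sup>2 \<le> (x + z)\<^sup>2" using that by (simp add: power2_sum)
    also have "\<dots> \<le> K\<^sup>2" using that by (intro power_mono) auto
    finally show ?thesis .
  qed
  define D where "D = (\<lambda>k. (norm (p k) + \<bar>of_int k\<bar> * norm (p' k)) / a)"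
  have "derivative_bounds q b \<epsilon> k (\<lambda>t. fourier_mode (u t) (w t) k) T0 (D k)" for k :: int
    unfolding derivative_bounds_def
  proof (intro allI impI conjI)
    fix r assume r: "T0 \<le> r"
    let ?A = "relax_gen b \<epsilon> (of_int k)"
    let ?y = "\<lambda>t. fourier_mode (u t) (w t) k"
    have bd: "norm ((?A ^^ j) (?y r)) \<le> norm ((?A ^^ j) (?y 0)) / a" for j
      unfolding a_def
      by (rule mode_solution_norm_le[OF mode_solution_pow[OF fourier_mode_solution[OF sol]] b \<epsilon>]) (use r T0 in auto)
    have "(?A ^^ (q + 1)) (?y 0) = p k" "(?A ^^ q) (?y 0) = p' k"
      unfolding p_def p'_def by (rule fourier_mode_time_derivatives[OF sol sm, symmetric]; simp)+
    then have 1: "norm ((?A ^^ (q + 1)) (?y r)) \<le> norm (p k) / a" and 2: "norm ((?A ^^ q) (?y r)) \<le> norm (p' k) / a"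
      using bd[of "q + 1"] bd[of q] by simp_all
    have "norm (p k) / a \<le> D k" unfolding D_def using a by (intro divide_right_mono) auto
    then show "norm ((?A ^^ (q + 1)) (?y r)) \<le> D k" using 1 by linarith
    have "\<bar>of_int k\<bar> * norm ((?A ^^ q) (?y r)) \<le> \<bar>of_int k\<bar> * (norm (p' k) / a)"
      using 2 by (intro mult_left_mono) auto
    also have "\<dots> \<le> D k" unfolding D_def using a by (simp add: add_divide_distrib)
    finally show "\<bar>real_of_int k\<bar> * norm ((?A ^^ q) (?y r)) \<le> D k" .
  qed
  moreover have "(\<Sum>k\<in>{- int N..int N}. (D k)\<^sup>2) \<le> 4 / a\<^sup>2 * K\<^sup>2" for N
  proof -
    have "(D k)\<^sup>2 \<le> 2 / a\<^sup>2 * ((1 + (of_int k)\<^sup>2) ^ 1 * (norm (p k))\<^sup>2 + (1 + (of_int k)\<^sup>2) ^ 2 * (norm (p' k))\<^sup>2)" for k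
    proof -
      have "(norm (p k) + \<bar>of_int k\<bar> * norm (p' k))\<^sup>2 \<le> 2 * ((norm (p k))\<^sup>2 + (\<bar>of_int k\<bar> * norm (p' k))\<^sup>2)"
        by (rule power2_add_le)
      also have "\<dots> = 2 * (1 * (norm (p k))\<^sup>2 + (of_int k)\<^sup>2 * (norm (p' k))\<^sup>2)"
        by (simp add: power_mult_distrib)
      also have "\<dots> \<le> 2 * ((1 + (of_int k)\<^sup>2) ^ 1 * (norm (p k))\<^sup>2 + (1 + (of_int k)\<^sup>2) ^ 2 * (norm (p' k))\<^sup>2)"
      proof (intro mult_left_mono add_mono mult_right_mono)
        have "(of_int k)\<^sup>2 \<le> (1 + (of_int k)\<^sup>2 :: real) ^ 1" by simp
        also have "\<dots> \<le> (1 + (of_int k)\<^sup>2) ^ 2" by (rule power_increasing) auto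
        finally show "(of_int k)\<^sup>2 \<le> (1 + (of_int k)\<^sup>2 :: real) ^ 2" .
      qed auto
      finally have "(norm (p k) + \<bar>of_int k\<bar> * norm (p' k))\<^sup>2 / a\<^sup>2
        \<le> 2 * ((1 + (of_int k)\<^sup>2) ^ 1 * (norm (p k))\<^sup>2 + (1 + (of_int k)\<^sup>2) ^ 2 * (norm (p' k))\<^sup>2) / a\<^sup>2"
        by (rule divide_right_mono) simp
      then show ?thesis by (simp add: D_def power_divide)
    qed
    then have "(\<Sum>k\<in>{- int N..int N}. (D k)\<^sup>2) \<le> 2 / a\<^sup>2 * ((\<Sum>k\<in>{- int N..int N}. (1 + (of_int k)\<^sup>2) ^ 1 * (norm (p k))\<^sup>2)
        + (\<Sum>k\<in>{- int N..int N}. (1 + (of_int k)\<^sup>2) ^ 2 * (norm (p' k))\<^sup>2))"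
      unfolding sum.distrib[symmetric] sum_distrib_left by (intro sum_mono)
    also have "\<dots> \<le> 2 / a\<^sup>2 * (K\<^sup>2 + K\<^sup>2)"
    proof (intro mult_left_mono add_mono)
      show "(\<Sum>k\<in>{- int N..int N}. (1 + (of_int k)\<^sup>2) ^ 1 * (norm (p k))\<^sup>2) \<le> K\<^sup>2"
        unfolding p_def by (rule order_trans[OF sobolev_mode_sum_le[OF s1] sq[OF n1]]) (simp_all add: sobolev_norm_nonneg)
      show "(\<Sum>k\<in>{- int N..int N}. (1 + (of_int k)\<^sup>2) ^ 2 * (norm (p' k))\<^sup>2) \<le> K\<^sup>2"
        unfolding p'_def by (rule order_trans[OF sobolev_mode_sum_le[OF s2] sq[OF n2]]) (simp_all add: sobolev_norm_nonneg)
    qed (use a in simp)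
    finally show ?thesis by simp
  qed
  ultimately show ?thesis unfolding a_def by blast
qed

text \<open>
  The bound after the layer costs \<open>q + 1\<close> powers of \<open>1 + \<bar>k\<bar>\<close>, which the Sobolev norm of the data
  of order \<open>q + 2\<close> pays for.
\<close>
lemma derivative_bounds_after_layer:
  assumes sol: "is_solution b \<epsilon> u w" and b: "\<bar>b\<bar> < 1" and \<epsilon>: "0 < \<epsilon>" and q: "q \<le> 4"
    and T0: "0 \<le> T0" "real (q + 2) * \<epsilon> * ln (1 / \<epsilon>) \<le> T0" and B: "bounded_data q K u w"
  shows "\<exists>D. (\<forall>k :: int. derivative_bounds q b \<epsilon> k (\<lambda>t. fourier_mode (u t) (w t) k) T0 (D k)) \<and>
    (\<forall>N. (\<Sum>k\<in>{- int N..int N}. (D k)\<^sup>2) \<le> ((1 / (1 - b\<^sup>2) + 1) * 28 ^ 5)\<^sup>2 * 2 ^ (q + 1) * K)"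
proof -
  define S where "S = (1 / (1 - b\<^sup>2) + 1) * 28 ^ 5"
  have S: "0 \<le> S" using b by (simp add: S_def abs_square_le_1)
  define p where "p = (\<lambda>k. fourier_mode (u 0) (w 0) k)"
  define D where "D = (\<lambda>k. S * (1 + \<bar>of_int k\<bar>) ^ (q + 1) * norm (p k))"
  have "derivative_bounds q b \<epsilon> k (\<lambda>t. fourier_mode (u t) (w t) k) T0 (D k)" for k :: int
    unfolding derivative_bounds_def
  proof (intro allI impI conjI)
    fix r assume r: "T0 \<le> r"
    let ?A = "relax_gen b \<epsilon> (of_int k)"
    let ?y = "\<lambda>t. fourier_mode (u t) (w t) k"
    have bd: "norm ((?A ^^ m) (?y r)) \<le> S * (1 + \<bar>of_int k\<bar>) ^ m * norm (p k)" if "m \<le> q + 1" for m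
      unfolding S_def p_def
      by (rule mode_derivative_bound_after_layer[OF fourier_mode_solution[OF sol] b \<epsilon> q _ _ that]) (use r T0 in auto)
    show "norm ((?A ^^ (q + 1)) (?y r)) \<le> D k" unfolding D_def by (rule bd) simp
    have "\<bar>of_int k\<bar> * norm ((?A ^^ q) (?y r)) \<le> (1 + \<bar>of_int k\<bar>) * (S * (1 + \<bar>of_int k\<bar>) ^ q * norm (p k))"
      by (intro mult_mono bd) auto
    also have "\<dots> = D k" by (simp add: D_def mult_ac)
    finally show "\<bar>real_of_int k\<bar> * norm ((?A ^^ q) (?y r)) \<le> D k" .
  qed
  moreover have "(\<Sum>k\<in>{- int N..int N}. (D k)\<^sup>2) \<le> S\<^sup>2 * 2 ^ (q + 1) * K" for N
  proof -
    have "(D k)\<^sup>2 \<le> S\<^sup>2 * 2 ^ (q + 1) * ((1 + (of_int k)\<^sup>2) ^ (q + 2) * (norm (p k))\<^sup>2)" for k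
    proof -
      have "(D k)\<^sup>2 = S\<^sup>2 * (((1 + \<bar>of_int k\<bar>)\<^sup>2) ^ (q + 1) * (norm (p k))\<^sup>2)"
        by (simp only: D_def power_mult_distrib power_mult[symmetric] mult.assoc mult.commute[of "q + 1" 2])
      also have "\<dots> \<le> S\<^sup>2 * ((2 ^ (q + 1) * (1 + (of_int k)\<^sup>2) ^ (q + 2)) * (norm (p k))\<^sup>2)"
      proof (intro mult_left_mono mult_right_mono)
        have "(1 + \<bar>of_int k\<bar>)\<^sup>2 \<le> 2 * (1 + (of_int k)\<^sup>2 :: real)"
          using power2_add_le[of 1 "\<bar>of_int k\<bar>"] by simp
        then have "((1 + \<bar>of_int k\<bar>)\<^sup>2) ^ (q + 1) \<le> (2 * (1 + (of_int k)\<^sup>2 :: real)) ^ (q + 1)"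
          by (intro power_mono) auto
        also have "\<dots> = 2 ^ (q + 1) * (1 + (of_int k)\<^sup>2) ^ (q + 1)" by (rule power_mult_distrib)
        also have "\<dots> \<le> 2 ^ (q + 1) * (1 + (of_int k)\<^sup>2) ^ (q + 2)"
          by (intro mult_left_mono power_increasing) auto
        finally show "((1 + \<bar>of_int k\<bar>)\<^sup>2) ^ (q + 1) \<le> 2 ^ (q + 1) * (1 + (of_int k)\<^sup>2 :: real) ^ (q + 2)" .
      qed auto
      finally show ?thesis by (simp only: mult.assoc)
    qed
    then have "(\<Sum>k\<in>{- int N..int N}. (D k)\<^sup>2)
        \<le> S\<^sup>2 * 2 ^ (q + 1) * (\<Sum>k\<in>{- int N..int N}. (1 + (of_int k)\<^sup>2) ^ (q + 2) * (norm (p k))\<^sup>2)"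
      unfolding sum_distrib_left by (intro sum_mono)
    also have "\<dots> \<le> S\<^sup>2 * 2 ^ (q + 1) * K"
    proof (intro mult_left_mono)
      have "(\<Sum>k\<in>{- int N..int N}. (1 + (of_int k)\<^sup>2) ^ (q + 2) * (norm (p k))\<^sup>2)
          \<le> (sobolev_norm (q + 2) (u 0))\<^sup>2 + (sobolev_norm (q + 2) (w 0))\<^sup>2"
        unfolding p_def by (rule sobolev_mode_sum_le) (use B in \<open>auto simp: bounded_data_def\<close>)
      then show "(\<Sum>k\<in>{- int N..int N}. (1 + (of_int k)\<^sup>2) ^ (q + 2) * (norm (p k))\<^sup>2) \<le> K"
        using B unfolding bounded_data_def by linarith
    qed simp
    finally show ?thesis .
  qed
  ultimately show ?thesis unfolding S_def by blast
qed

theorem theorem3p11: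
  fixes b T K c_CFL :: real and q :: nat
  assumes "\<bar>b\<bar> < 1" and "q \<in> {1, 2, 3, 4}" and "T > 0" and "K > 0" and "c_CFL > 0"
  shows "\<exists>C :: real. \<forall>(\<epsilon> :: real) (N :: nat) (\<Delta>t :: real) (T0 :: real)
      (u :: real \<Rightarrow> real \<Rightarrow> complex) (w :: real \<Rightarrow> real \<Rightarrow> complex)
      (U :: nat \<Rightarrow> real \<Rightarrow> complex) (W :: nat \<Rightarrow> real \<Rightarrow> complex).
    \<epsilon> > 0 \<and> N \<ge> 1 \<and> \<Delta>t > 0 \<and> \<Delta>t \<le> min (c_CFL / (real N)\<^sup>2) 1 \<and> T0 \<ge> 0 \<and>
    is_solution b \<epsilon> u w \<and>
    (bounded_time_derivs q K u w \<or>
     (bounded_data q K u w \<and> T0 \<ge> real (q + 2) * \<epsilon> * ln (1 / \<epsilon>))) \<and>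
    imex_bdf q b \<epsilon> N \<Delta>t U W \<and>
    (\<forall>i<q. U i = fourier_proj N (u (T0 + i * \<Delta>t)) \<and> W i = fourier_proj N (w (T0 + i * \<Delta>t)))
    \<longrightarrow> (\<forall>n :: nat. T0 + n * \<Delta>t \<le> T \<longrightarrow>
          (L2_norm (\<lambda>x. u (T0 + n * \<Delta>t) x - U n x))\<^sup>2 + (L2_norm (\<lambda>x. w (T0 + n * \<Delta>t) x - W n x))\<^sup>2
            \<le> C * (\<Delta>t ^ (2 * q) + e_proj q \<epsilon> N \<Delta>t T0 u w))"
proof -
  note b = assms(1) and q = assms(2)
  define a where "a = 1 - b\<^sup>2"
  have a: "0 < a" "a \<le> 1" using b by (auto simp: a_def abs_square_less_1)
  have \<beta>: "0 < bdf_beta q" by (rule bdf_beta_pos[OF q])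
  have b1: "\<bar>b\<bar> \<le> 1" and c0: "0 \<le> c_CFL" using assms by auto
  obtain C1 where C1: "C1 \<ge> 0"
    "\<And>r \<eta> h e d \<tau> \<sigma> \<rho> n. \<lbrakk>r\<^sup>2 \<le> c_CFL * h; 0 \<le> \<eta>; 0 < h; h \<le> 1; \<And>i. i < q \<Longrightarrow> e i = 0 \<and> d i = 0;
      \<And>n. imex_mode_step q b r \<eta> h (\<lambda>i. e (n + i)) (\<lambda>i. d (n + i)) (\<tau> n) (\<sigma> n);
      \<And>n. (cmod (\<tau> n))\<^sup>2 + (cmod (\<sigma> n))\<^sup>2 \<le> \<rho>\<rbrakk> \<Longrightarrow>
      (cmod (e n))\<^sup>2 + (cmod (d n))\<^sup>2 \<le> C1 * exp (C1 * (h * real n)) * \<rho>"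
    using imex_mode_stability[OF q b c0] by blast
  obtain C2 where C2: "C2 \<ge> 0"
    "\<And>\<epsilon> \<kappa> y h T0 D. \<lbrakk>0 < \<epsilon>; mode_solution b \<epsilon> \<kappa> y; 0 < h; 0 \<le> T0;
      \<And>r. T0 \<le> r \<Longrightarrow> norm ((relax_gen b \<epsilon> \<kappa> ^^ (q + 1)) (y r)) \<le> D \<and> \<bar>\<kappa>\<bar> * norm ((relax_gen b \<epsilon> \<kappa> ^^ q) (y r)) \<le> D\<rbrakk> \<Longrightarrow>
      \<exists>\<tau> \<sigma>. \<forall>n. imex_mode_step q b (h * \<kappa>) (bdf_beta q * h / \<epsilon>) h
          (\<lambda>i. fst (y (T0 + real (n + i) * h))) (\<lambda>i. snd (y (T0 + real (n + i) * h))) (\<tau> n) (\<sigma> n) \<and>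
        (cmod (\<tau> n))\<^sup>2 + (cmod (\<sigma> n))\<^sup>2 \<le> C2 * (h ^ (2 * q) * D\<^sup>2)"
    using mode_consistency[OF q b1] by blast
  \<comment> \<open>A bound on the sum of the squared derivative bounds over the modes, valid in both cases.\<close>
  define M where "M = 4 / (1 - b\<^sup>2)\<^sup>2 * K\<^sup>2 + ((1 / (1 - b\<^sup>2) + 1) * 28 ^ 5)\<^sup>2 * 2 ^ (q + 1) * K"
  have M: "4 / (1 - b\<^sup>2)\<^sup>2 * K\<^sup>2 \<le> M" "((1 / (1 - b\<^sup>2) + 1) * 28 ^ 5)\<^sup>2 * 2 ^ (q + 1) * K \<le> M"
    using assms(4) by (simp_all add: M_def)
  define G where "G = C1 * exp (C1 * T) * C2"
  have G: "0 \<le> G" using C1 C2 by (simp add: G_def)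
  show ?thesis
  proof (intro exI[of _ "1 / a + 2 * pi * (G * M)"] allI impI, elim conjE)
    fix \<epsilon> \<Delta>t T0 :: real and N n :: nat and u w :: "real \<Rightarrow> real \<Rightarrow> complex" and U W :: "nat \<Rightarrow> real \<Rightarrow> complex"
    assume \<epsilon>: "\<epsilon> > 0" and N: "N \<ge> 1" and h: "\<Delta>t > 0" "\<Delta>t \<le> min (c_CFL / (real N)\<^sup>2) 1" and T0: "T0 \<ge> 0"
      and sol: "is_solution b \<epsilon> u w"
      and data: "bounded_time_derivs q K u w \<or>
        (bounded_data q K u w \<and> T0 \<ge> real (q + 2) * \<epsilon> * ln (1 / \<epsilon>))"
      and sch: "imex_bdf q b \<epsilon> N \<Delta>t U W"
      and ini: "\<forall>i<q. U i = fourier_proj N (u (T0 + i * \<Delta>t)) \<and> W i = fourier_proj N (w (T0 + i * \<Delta>t))"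
      and n: "T0 + n * \<Delta>t \<le> T"
    have U: "C1_periodic u" and W: "C1_periodic w" using sol by (auto simp: is_solution_def)
    note cu = continuous_slice[OF C1_periodicD(3)[OF U]] and cw = continuous_slice[OF C1_periodicD(3)[OF W]]
    define t where "t = (\<lambda>n. T0 + real n * \<Delta>t)"
    have t: "T0 \<le> t n" "0 \<le> t n" for n using T0 h(1) by (auto simp: t_def)
    let ?y = "\<lambda>k t. fourier_mode (u t) (w t) k"
    obtain D where D: "\<And>k :: int. derivative_bounds q b \<epsilon> k (?y k) T0 (D k)"
      and DM: "\<And>N. (\<Sum>k\<in>{- int N..int N}. (D k)\<^sup>2) \<le> M"
    proof -
      have q4: "q \<le> 4" using q by auto
      have "\<exists>D. (\<forall>k :: int. derivative_bounds q b \<epsilon> k (?y k) T0 (D k)) \<and> (\<forall>N. (\<Sum>k\<in>{- int N..int N}. (D k)\<^sup>2) \<le> M)"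
        using data
      proof
        assume "bounded_time_derivs q K u w"
        from derivative_bounds_of_time_derivatives[OF sol b \<epsilon> T0 this] show ?thesis
          using M(1) by (meson order_trans)
      next
        assume "bounded_data q K u w \<and> T0 \<ge> real (q + 2) * \<epsilon> * ln (1 / \<epsilon>)"
        then have "bounded_data q K u w" "real (q + 2) * \<epsilon> * ln (1 / \<epsilon>) \<le> T0" by auto
        from derivative_bounds_after_layer[OF sol b \<epsilon> q4 T0 this(2,1)] show ?thesis
          using M(2) by (meson order_trans)
      qed
      then show ?thesis using that by blast
    qed
    define e where "e = (\<lambda>k n. fourier_coeff (u (t n)) k - fourier_coeff (U n) k)"
    define d where "d = (\<lambda>k n. fourier_coeff (w (t n)) k - fourier_coeff (W n) k)"
    have mode: "(cmod (e k n))\<^sup>2 + (cmod (d k n))\<^sup>2 \<le> G * \<Delta>t ^ (2 * q) * (D k)\<^sup>2"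
      if k: "k \<in> {- int N..int N}" for k
    proof -
      obtain \<tau> \<sigma> where \<tau>: "\<And>n. imex_mode_step q b (\<Delta>t * of_int k) (bdf_beta q * \<Delta>t / \<epsilon>) \<Delta>t
          (\<lambda>i. fst (?y k (T0 + real (n + i) * \<Delta>t))) (\<lambda>i. snd (?y k (T0 + real (n + i) * \<Delta>t))) (\<tau> n) (\<sigma> n)"
        "\<And>n. (cmod (\<tau> n))\<^sup>2 + (cmod (\<sigma> n))\<^sup>2 \<le> C2 * (\<Delta>t ^ (2 * q) * (D k)\<^sup>2)"
        using C2(2)[OF \<epsilon> fourier_mode_solution[OF sol] h(1) T0, of k "D k"] D[of k]
        unfolding derivative_bounds_def by blast
      have step: "imex_mode_step q b (\<Delta>t * of_int k) (bdf_beta q * \<Delta>t / \<epsilon>) \<Delta>t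
          (\<lambda>i. e k (n + i)) (\<lambda>i. d k (n + i)) (\<tau> n) (\<sigma> n)" for n
        using imex_mode_step_diff[OF \<tau>(1)[of n] imex_bdf_modes[OF sch k, of n]]
        by (simp add: e_def d_def t_def fourier_mode_def)
      have cfl: "(\<Delta>t * of_int k)\<^sup>2 \<le> c_CFL * \<Delta>t"
      proof -
        have "\<bar>of_int k\<bar> \<le> real N" using k by (simp add: abs_le_iff)
        then have k2: "(of_int k)\<^sup>2 \<le> (real N)\<^sup>2" by (metis abs_ge_zero power2_abs power_mono)
        have "\<Delta>t * (real N)\<^sup>2 \<le> c_CFL" using h N by (simp add: field_simps)
        then have "\<Delta>t * (of_int k)\<^sup>2 \<le> c_CFL" using k2 h(1) by (meson less_imp_le mult_left_mono order_trans)
        then show ?thesis using h(1) by (simp add: power_mult_distrib power2_eq_square mult_ac mult_left_mono)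
      qed
      have "(cmod (e k n))\<^sup>2 + (cmod (d k n))\<^sup>2 \<le> C1 * exp (C1 * (\<Delta>t * real n)) * (C2 * (\<Delta>t ^ (2 * q) * (D k)\<^sup>2))"
      proof (rule C1(2)[OF cfl _ h(1) _ _ step \<tau>(2)])
        show "e k i = 0 \<and> d k i = 0" if "i < q" for i
          using ini that k by (simp add: e_def d_def t_def fourier_proj_eq_trig_sum fourier_coeff_trig_sum)
      qed (use h \<epsilon> \<beta> in auto)
      also have "\<dots> \<le> C1 * exp (C1 * T) * (C2 * (\<Delta>t ^ (2 * q) * (D k)\<^sup>2))"
      proof -
        have "\<Delta>t * real n \<le> T" using n T0 by (simp add: mult.commute)
        then have "exp (C1 * (\<Delta>t * real n)) \<le> exp (C1 * T)" using C1(1) by (simp add: mult_left_mono)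
        then show ?thesis using C1(1) C2(1) h(1) by (intro mult_right_mono mult_left_mono) auto
      qed
      finally show ?thesis by (simp add: G_def mult.assoc)
    qed
    have split: "(L2_norm (\<lambda>x. v (t n) x - V n x))\<^sup>2 = proj_error_sq N (v (t n))
        + 2 * pi * (\<Sum>k\<in>{- int N..int N}. (cmod (fourier_coeff (v (t n)) k - fourier_coeff (V n) k))\<^sup>2)"
      if "V n \<in> trig_polys N" "continuous_on {0..2 * pi} (v (t n))" for v and V :: "nat \<Rightarrow> real \<Rightarrow> complex"
      using L2_dist_trig_sum_split[OF that(2), of N "fourier_coeff (V n)"] trig_polys_eq_trig_sum[OF that(1)] by simp
    have err: "(L2_norm (\<lambda>x. u (t n) x - U n x))\<^sup>2 + (L2_norm (\<lambda>x. w (t n) x - W n x))\<^sup>2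
        = proj_error_sq N (u (t n)) + proj_error_sq N (w (t n))
          + 2 * pi * (\<Sum>k\<in>{- int N..int N}. (cmod (e k n))\<^sup>2 + (cmod (d k n))\<^sup>2)"
    proof -
      have "U n \<in> trig_polys N" "W n \<in> trig_polys N" using sch by (auto simp: imex_bdf_def)
      then show ?thesis
        using split[of U u] split[of W w] cu[OF t(2)] cw[OF t(2)]
        by (simp add: e_def d_def sum.distrib distrib_left)
    qed
    have low: "(\<Sum>k\<in>{- int N..int N}. (cmod (e k n))\<^sup>2 + (cmod (d k n))\<^sup>2) \<le> G * M * \<Delta>t ^ (2 * q)"
    proof -
      have "(\<Sum>k\<in>{- int N..int N}. (cmod (e k n))\<^sup>2 + (cmod (d k n))\<^sup>2) \<le> (\<Sum>k\<in>{- int N..int N}. G * \<Delta>t ^ (2 * q) * (D k)\<^sup>2)"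
        by (rule sum_mono) (rule mode)
      also have "\<dots> = G * \<Delta>t ^ (2 * q) * (\<Sum>k\<in>{- int N..int N}. (D k)\<^sup>2)"
        by (simp add: sum_distrib_left)
      also have "\<dots> \<le> G * \<Delta>t ^ (2 * q) * M"
        using G h(1) by (intro mult_left_mono DM) auto
      finally show ?thesis by (simp add: mult_ac)
    qed
    have pe: "0 \<le> proj_error_sq N f" for f by (simp add: proj_error_sq_def)
    have ep: "proj_error_sq N (u T0) + proj_error_sq N (w T0) \<le> e_proj q \<epsilon> N \<Delta>t T0 u w"
    proof -
      let ?f = "\<lambda>i. proj_error_sq N (u (T0 + real i * \<Delta>t)) + (1 + \<Delta>t / \<epsilon>) * proj_error_sq N (w (T0 + real i * \<Delta>t))"
      have "proj_error_sq N (u T0) + proj_error_sq N (w T0) \<le> ?f 0"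
        using pe[of "w T0"] h(1) \<epsilon> by (simp add: distrib_right)
      also have "\<dots> \<le> e_proj q \<epsilon> N \<Delta>t T0 u w"
        unfolding e_proj_def
        by (rule member_le_sum[of 0 "{..<q}" ?f]) (use q pe h(1) \<epsilon> in \<open>auto intro!: add_nonneg_nonneg mult_nonneg_nonneg\<close>)
      finally show ?thesis .
    qed
    have high: "proj_error_sq N (u (t n)) + proj_error_sq N (w (t n)) \<le> 1 / a * e_proj q \<epsilon> N \<Delta>t T0 u w"
    proof -
      have dec: "a * proj_error_sq N (u (t n)) + proj_error_sq N (w (t n))
          \<le> a * proj_error_sq N (u T0) + proj_error_sq N (w T0)"
        unfolding a_def by (rule projection_error_nonincreasing[OF sol \<epsilon> T0 t(1)])
      have "a * (proj_error_sq N (u (t n)) + proj_error_sq N (w (t n))) \<le> proj_error_sq N (u T0) + proj_error_sq N (w T0)"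
        using dec mult_right_mono[OF a(2) pe[of "w (t n)"]] mult_right_mono[OF a(2) pe[of "u T0"]]
        by (simp add: distrib_left)
      then show ?thesis using ep a(1) by (simp add: field_simps)
    qed
    have ep0: "0 \<le> e_proj q \<epsilon> N \<Delta>t T0 u w"
      using ep pe[of "u T0"] pe[of "w T0"] by linarith
    have M0: "0 \<le> M"
      using order_trans[OF sum_nonneg DM[of 0]] by simp
    have "(L2_norm (\<lambda>x. u (t n) x - U n x))\<^sup>2 + (L2_norm (\<lambda>x. w (t n) x - W n x))\<^sup>2
        \<le> 1 / a * e_proj q \<epsilon> N \<Delta>t T0 u w + 2 * pi * (G * M * \<Delta>t ^ (2 * q))"
      unfolding err using high low by (intro add_mono mult_left_mono) auto
    also have "\<dots> \<le> (1 / a + 2 * pi * (G * M)) * (\<Delta>t ^ (2 * q) + e_proj q \<epsilon> N \<Delta>t T0 u w)"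
    proof -
      have "0 \<le> 1 / a * \<Delta>t ^ (2 * q)" "0 \<le> 2 * pi * (G * M) * e_proj q \<epsilon> N \<Delta>t T0 u w"
        using a h(1) G M0 ep0 by auto
      then show ?thesis by (simp add: algebra_simps)
    qed
    finally show "(L2_norm (\<lambda>x. u (T0 + n * \<Delta>t) x - U n x))\<^sup>2 + (L2_norm (\<lambda>x. w (T0 + n * \<Delta>t) x - W n x))\<^sup>2
        \<le> (1 / a + 2 * pi * (G * M)) * (\<Delta>t ^ (2 * q) + e_proj q \<epsilon> N \<Delta>t T0 u w)"
      unfolding t_def .
  qed
qed

end
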